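(* Let $0<\alpha\le 1$ and let $a=\{a_k\}_{k\ge 1}\subset\mathbb{D}$ be a sequence satisfying $$\delta(a)=\inf_{n\ge 1}\ \prod_{k\ne n}\left|\frac{a_k-a_n}{1-\overline{a_k}a_n}\right|>0$$ and $$\sigma_\alpha(a)=\sup_{|\xi|=1}\ \sum_{k\ge 1}\left(\frac{1-|a_k|^2}{|1-\overline{\xi}a_k|}\right)^{\alpha}<\infty .$$ Then: (a) if $g\in\mathcal{F}_\alpha$, then $\bigl(g(a_k)(1-|a_k|^2)^{\alpha}\bigr)_{k\ge 1}\in\ell^1$; (b) for each sequence $x=\{x_k\}_{k\ge 1}\in\ell^1$ there is a function $g\in\mathcal{F}_\alpha$ such that $$g(a_k)(1-|a_k|^2)^{\alpha}=x_k\qquad\text{for all } k=1,2,\dots.$$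
   Context: $\mathbb{D}$ is the open unit disk in the complex plane and $\mathbb{T}$ is the unit circle. $M$ is the Banach space of all complex-valued Borel measures on $\mathbb{T}$ with the total variation norm. The space $\ell^1$ consists of absolutely summable complex sequences. For $\alpha>0$, $\mathcal{F}_\alpha$ is the family of functions $g$ on $\mathbb{D}$ for which there exists $\mu\in M$ such that $$g(z)=\int_{\mathbb{T}}\frac{1}{(1-\overline{\xi}z)^{\alpha}}\,d\mu(\xi),\qquad z\in\mathbb{D},$$ where the power is the principal branch. *)

theory Defs
  imports "HOL-Analysis.Analysis"
begin

text \<open>A complex measure is a countably additive set function on the \<open>\<sigma>\<close>-algebra of \<open>M\<close>;
  the measure carried by \<open>M\<close> itself plays no role. Values of \<open>\<mu>\<close> outside \<open>sets M\<close> are irrelevant.\<close>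

definition complex_measure :: "'a measure \<Rightarrow> ('a set \<Rightarrow> complex) \<Rightarrow> bool" where
  "complex_measure M \<mu> \<longleftrightarrow> \<mu> {} = 0 \<and>
     (\<forall>A :: nat \<Rightarrow> 'a set. range A \<subseteq> sets M \<longrightarrow> disjoint_family A \<longrightarrow>
        (\<lambda>n. \<mu> (A n)) sums \<mu> (\<Union>n. A n))"

text \<open>Positive variation \<open>\<nu>\<^sup>+ A = sup {\<nu> B | B \<subseteq> A}\<close> of a real signed measure; the negative variation
  is the positive variation of \<open>- \<nu>\<close>. Since \<open>\<nu> {} = 0\<close>, the truncation of negative values by
  \<open>ennreal\<close> does not affect the supremum.\<close>

definition pos_variation :: "'a measure \<Rightarrow> ('a set \<Rightarrow> real) \<Rightarrow> 'a measure" where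
  "pos_variation M \<nu> =
     measure_of (space M) (sets M) (\<lambda>A. SUP B\<in>{B \<in> sets M. B \<subseteq> A}. ennreal (\<nu> B))"

lemma emeasure_pos_variation:
  fixes \<nu> :: "'a set \<Rightarrow> real"
  assumes e: "\<nu> {} = 0" and ca: "\<And>A :: nat \<Rightarrow> 'a set. range A \<subseteq> sets M \<Longrightarrow> disjoint_family A \<Longrightarrow> (\<lambda>n. \<nu> (A n)) sums \<nu> (\<Union>n. A n)"
    and A: "A \<in> sets M"
  shows "emeasure (pos_variation M \<nu>) A = (SUP B\<in>{B \<in> sets M. B \<subseteq> A}. ennreal (\<nu> B))"
proof (rule emeasure_measure_of[OF pos_variation_def])
  let ?p = "\<lambda>A. SUP B\<in>{B \<in> sets M. B \<subseteq> A}. ennreal (\<nu> B)"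
  have setsP: "sets (pos_variation M \<nu>) = sets M" by (simp add: pos_variation_def sets.sigma_sets_eq)
  show "sets M \<subseteq> Pow (space M)" by (rule sets.space_closed)
  show "A \<in> sets (pos_variation M \<nu>)" using A setsP by simp
  have "{B \<in> sets M. B \<subseteq> {}} = {{}}" by auto
  then show "positive (sets (pos_variation M \<nu>)) ?p" by (simp add: positive_def e)
  have add2: "\<nu> (X \<union> Y) = \<nu> X + \<nu> Y" if "X \<in> sets M" "Y \<in> sets M" "X \<inter> Y = {}" for X Y
  proof -
    have d: "disjoint_family (binaryset X Y)" using that
      by (auto simp: disjoint_family_on_def binaryset_def)
    have r: "range (binaryset X Y) \<subseteq> sets M" using that by (auto simp: range_binaryset_eq)
    have "(\<lambda>n. \<nu> (binaryset X Y n)) sums (\<nu> X + \<nu> Y)"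
      using sums_finite[of "{0,1::nat}" "\<lambda>n. \<nu> (binaryset X Y n)"] by (auto simp: binaryset_def e)
    moreover have "(\<lambda>n. \<nu> (binaryset X Y n)) sums \<nu> (X \<union> Y)"
      using ca[OF r d] by (simp add: UN_binaryset_eq)
    ultimately show ?thesis by (rule sums_unique2[symmetric])
  qed
  show "countably_additive (sets (pos_variation M \<nu>)) ?p"
    unfolding setsP
  proof (rule countably_additiveI)
    fix A :: "nat \<Rightarrow> 'a set" assume r: "range A \<subseteq> sets M" and d: "disjoint_family A"
    have le: "?p (\<Union>i. A i) \<le> (\<Sum>i. ?p (A i))"
    proof (rule SUP_least)
      fix B assume "B \<in> {B \<in> sets M. B \<subseteq> (\<Union>i. A i)}"
      then have B: "B \<in> sets M" "B \<subseteq> (\<Union>i. A i)" by auto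
      have s: "(\<lambda>n. \<nu> (B \<inter> A n)) sums \<nu> (\<Union>n. B \<inter> A n)"
        using r B d by (intro ca) (auto simp: disjoint_family_on_def disjoint_iff)
      have eq: "(\<Union>n. B \<inter> A n) = B" using B by auto
      have "(\<lambda>N. ennreal (\<Sum>n<N. \<nu> (B \<inter> A n))) \<longlonglongrightarrow> ennreal (\<nu> B)"
        using s unfolding eq sums_def by (rule tendsto_ennrealI)
      then show "ennreal (\<nu> B) \<le> (\<Sum>i. ?p (A i))"
      proof (rule LIMSEQ_le_const2, intro exI allI impI)
        fix N
        have "ennreal (\<Sum>n<N. \<nu> (B \<inter> A n)) \<le> (\<Sum>n<N. ennreal (\<nu> (B \<inter> A n)))"
        proof (induction N)
          case (Suc N)
          have "ennreal (x + y) \<le> ennreal x + ennreal y" for x y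
          proof -
            have "ennreal (x + y) \<le> ennreal (max 0 x + max 0 y)" by (rule ennreal_leI) auto
            also have "\<dots> = ennreal (max 0 x) + ennreal (max 0 y)" by (rule ennreal_plus) auto
            finally show ?thesis by (simp add: max_def ennreal_neg split: if_splits)
          qed
          then show ?case using Suc by (simp, meson add_right_mono order_trans)
        qed simp
        also have "\<dots> \<le> (\<Sum>n<N. ?p (A n))"
          using r B by (intro sum_mono SUP_upper) auto
        also have "\<dots> \<le> (\<Sum>i. ?p (A i))" by (rule sum_le_suminf) auto
        finally show "ennreal (\<Sum>n<N. \<nu> (B \<inter> A n)) \<le> (\<Sum>i. ?p (A i))" .
      qed
    qed
    have mono: "?p X \<le> ?p Y" if "X \<subseteq> Y" for X Y using that by (intro SUP_subset_mono) auto
    have sup2: "?p X + ?p Y \<le> ?p (X \<union> Y)" if XY: "X \<in> sets M" "Y \<in> sets M" "X \<inter> Y = {}" for X Y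
    proof -
      have key: "ennreal (\<nu> B) + ennreal (\<nu> C) \<le> ?p (X \<union> Y)"
        if "B \<in> sets M" "B \<subseteq> X" "C \<in> sets M" "C \<subseteq> Y" for B C
      proof -
        consider "\<nu> B \<le> 0" | "\<nu> C \<le> 0" | "\<nu> B \<ge> 0" "\<nu> C \<ge> 0" by linarith
        then show ?thesis
        proof cases
          case 1 then show ?thesis using that by (auto simp: ennreal_neg intro!: SUP_upper)
        next
          case 2 then show ?thesis using that by (auto simp: ennreal_neg intro!: SUP_upper)
        next
          case 3
          have "ennreal (\<nu> B) + ennreal (\<nu> C) = ennreal (\<nu> (B \<union> C))"
            using 3 add2[of B C] that XY by (subst add2) (auto simp: ennreal_plus)
          also have "\<dots> \<le> ?p (X \<union> Y)" using that by (intro SUP_upper) auto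
          finally show ?thesis .
        qed
      qed
      have ne: "{B \<in> sets M. B \<subseteq> X} \<noteq> {}" "{B \<in> sets M. B \<subseteq> Y} \<noteq> {}" by auto
      have "?p X + ?p Y = (SUP B\<in>{B \<in> sets M. B \<subseteq> X}. ennreal (\<nu> B) + ?p Y)"
        by (rule ennreal_SUP_add_left[symmetric, OF ne(1)])
      also have "\<dots> = (SUP B\<in>{B \<in> sets M. B \<subseteq> X}. SUP C\<in>{B \<in> sets M. B \<subseteq> Y}. ennreal (\<nu> B) + ennreal (\<nu> C))"
        by (subst ennreal_SUP_add_right[symmetric, OF ne(2)]) simp
      also have "\<dots> \<le> ?p (X \<union> Y)" using key by (intro SUP_least) auto
      finally show ?thesis .
    qed
    have "(\<Sum>i. ?p (A i)) \<le> ?p (\<Union>i. A i)"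
    proof (rule suminf_le_const)
      fix N
      have "(\<Sum>i<N. ?p (A i)) \<le> ?p (\<Union>i<N. A i)"
      proof (induction N)
        case (Suc N)
        have "(\<Sum>i<Suc N. ?p (A i)) \<le> ?p (\<Union>i<N. A i) + ?p (A N)" using Suc by (simp add: add_right_mono)
        also have "\<dots> \<le> ?p ((\<Union>i<N. A i) \<union> A N)"
          using r d by (intro sup2) (auto simp: disjoint_family_on_def disjoint_iff less_le)
        finally show ?case by (simp add: lessThan_Suc Un_commute)
      qed simp
      also have "\<dots> \<le> ?p (\<Union>i. A i)" by (rule mono) auto
      finally show "(\<Sum>i<N. ?p (A i)) \<le> ?p (\<Union>i. A i)" .
    qed auto
    then show "(\<Sum>i. ?p (A i)) = ?p (\<Union>i. A i)" using le by (rule order.antisym)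
  qed
qed

text \<open>Integration against a complex measure through the Jordan decompositions of its real and
  imaginary parts.\<close>

definition complex_measure_integral ::
    "'a measure \<Rightarrow> ('a set \<Rightarrow> complex) \<Rightarrow> ('a \<Rightarrow> complex) \<Rightarrow> complex" where
  "complex_measure_integral M \<mu> f =
     ((LINT x|pos_variation M (\<lambda>A. Re (\<mu> A)). f x) - (LINT x|pos_variation M (\<lambda>A. - Re (\<mu> A)). f x))
     + \<i> * ((LINT x|pos_variation M (\<lambda>A. Im (\<mu> A)). f x) - (LINT x|pos_variation M (\<lambda>A. - Im (\<mu> A)). f x))"

abbreviation circle_borel :: "complex measure" where
  "circle_borel \<equiv> restrict_space borel (sphere 0 1)"

text \<open>Only the values of \<open>g\<close> on the open unit disk matter. For complex arguments \<open>powr\<close> is the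
  principal branch.\<close>

definition frac_cauchy_transforms :: "real \<Rightarrow> (complex \<Rightarrow> complex) set" where
  "frac_cauchy_transforms \<alpha> =
     {g. \<exists>\<mu>. complex_measure circle_borel \<mu> \<and>
        (\<forall>z\<in>ball 0 1. g z =
           complex_measure_integral circle_borel \<mu> (\<lambda>\<xi>. 1 / (1 - cnj \<xi> * z) powr of_real \<alpha>))}"

text \<open>The infinite product is the limit of the (decreasing) partial products; unlike
  \<open>prodinf\<close>, this gives the value \<open>0\<close> when the partial products tend to \<open>0\<close>.\<close>

definition separation_const :: "(nat \<Rightarrow> complex) \<Rightarrow> real" where
  "separation_const a =
     (INF n. lim (\<lambda>N. \<Prod>k\<in>{..<N} - {n}. cmod ((a k - a n) / (1 - cnj (a k) * a n))))"

definition sigma_const :: "real \<Rightarrow> (nat \<Rightarrow> complex) \<Rightarrow> ennreal" where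
  "sigma_const \<alpha> a =
     (SUP \<xi>\<in>sphere 0 1. \<Sum>k. ennreal (((1 - (cmod (a k))\<^sup>2) / cmod (1 - cnj \<xi> * a k)) powr \<alpha>))"

definition ell1 :: "(nat \<Rightarrow> complex) set" where
  "ell1 = {x. summable (\<lambda>k. cmod (x k))}"

end

theory Submission
  imports Defs "HOL-Probability.Probability" "HOL-Complex_Analysis.Complex_Analysis"
begin

text \<open>Part (a) is Tonelli: \<open>|g(a\<^sub>k)| (1 - |a\<^sub>k|\<^sup>2)\<^sup>\<alpha>\<close> is at most the \<open>|\<mu>|\<close>-integral of the
  \<open>k\<close>-th term of the sum in \<open>\<sigma>\<^sub>\<alpha>\<close>.

  For part (b), fix \<open>N\<close> and \<open>n < N\<close>, let \<open>\<beta>\<close> be the finite Blaschke product with zeros \<open>a\<^sub>k\<close>,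
  \<open>k < N\<close>, \<open>k \<noteq> n\<close>, and let \<open>f\<close> be the multiple of \<open>\<beta> z / (1 - cnj a\<^sub>n z)\<^sup>2\<close> that takes the value
  \<open>(1 - |a\<^sub>n|\<^sup>2) powr - \<alpha>\<close> at \<open>a\<^sub>n\<close>. It is the transform of a density on the circle,
  its fractional derivative of order \<open>1 - \<alpha>\<close>, whose \<open>L\<^sup>1\<close> norm is bounded by
  the integral of \<open>|\<alpha> f + z f'| (1 - |z|) powr (\<alpha> - 1)\<close> over the disc. The derivative of \<open>\<beta>\<close> contributes
  a sum over \<open>k\<close> that is dominated by the sum in \<open>\<sigma>\<^sub>\<alpha>\<close> at \<open>a\<^sub>n / |a\<^sub>n|\<close>, so the norms are bounded
  uniformly in \<open>n\<close> and \<open>N\<close>. (For \<open>\<alpha> = 1\<close> the density is \<open>f\<close> itself.) Summing against \<open>x\<close> solves the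
  first \<open>N\<close> equations with bounded norm, and a weak limit of these measures solves all of them.\<close>

subsection \<open>Means over the circle\<close>

text \<open>Finite Blaschke products are used because they extend holomorphically past the circle:
  Taylor coefficients are then absolutely summable on it and every interchange of sum and integral
  is dominated. The price is the dependence on N, which the weak limit removes. Write q = 1 -
  |a_n|^2. The multiple has leading constant q^(2 - \<alpha>) / \<beta>(a_n), and \<delta> enters
  only as a lower bound for |\<beta>(a_n)|. Differentiating the squared kernel costs (1 -
  |a_n|)^(\<alpha> - 2) after integration, which q^(2 - \<alpha>) compensates. Differentiating the
  k-th factor leaves a product of two squared kernels. On each circle it splits into a sum at the
  cost of 1 / |1 - cnj a_n a_k|^2, and the radial integral that remains is of order (1 -
  |a|)^(\<alpha> - 1) only for \<alpha> < 1; at \<alpha> = 1 it is a logarithm, whence the separate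
  case. Weak limits of the positive and negative parts of the densities may overlap, so they need
  not be the Jordan parts of the limit. Hence the integral against a complex measure has to be shown
  independent of the decomposition.\<close>

definition circ :: "real measure" where
  "circ = uniform_measure lborel {-pi..pi}"

lemma sets_circ [simp, measurable_cong]: "sets circ = sets borel"
  by (simp add: circ_def)

lemma space_circ [simp]: "space circ = UNIV"
  by (simp add: circ_def)

lemma prob_space_circ: "prob_space circ"
  unfolding circ_def by (rule prob_space_uniform_measure) auto

text \<open>Written against Lebesgue measure on the line, circle means become accessible to
  antiderivatives, and densities in the angle variable can later be fed to Helly's theorem.\<close>

lemma circ_eq_density: "circ = density lborel (\<lambda>t. ennreal (indicator {-pi..pi} t / (2*pi)))"
  unfolding circ_def uniform_measure_def
  by (intro density_cong) (auto simp: indicator_def divide_ennreal[symmetric])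

interpretation circ: prob_space circ
  by (rule prob_space_circ)

lemma measurable_cis [measurable]: "cis \<in> borel_measurable borel"
  by (intro borel_measurable_continuous_onI continuous_intros)

lemma measurable_cnj [measurable]: "cnj \<in> borel_measurable borel"
  by (intro borel_measurable_continuous_onI continuous_intros)

lemma integral_circ_cis:
  assumes "k \<noteq> 0"
  shows "(LINT t|circ. cis (of_int k * t)) = 0"
proof -
  have "((\<lambda>t. cis (of_int k * t) / (\<i> * of_int k)) has_vector_derivative cis (of_int k * t)) (at t within {-pi..pi})" for t
  proof -
    have "((\<lambda>z. exp (\<i> * (of_int k * z)) / (\<i> * of_int k)) has_field_derivative exp (\<i> * (of_int k * of_real t))) (at (of_real t))"
      using assms by (auto intro!: derivative_eq_intros simp: mult.commute[of _ "\<i>"])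
    from has_vector_derivative_real_field[OF this] show ?thesis
      by (simp add: cis_conv_exp)
  qed
  then have "(LBINT t=-pi..pi. cis (of_int k * t))
      = cis (of_int k * pi) / (\<i> * of_int k) - cis (of_int k * (-pi)) / (\<i> * of_int k)"
    by (intro interval_integral_FTC_finite) (auto intro!: continuous_intros)
  also have "cis (of_int k * pi) = cis (of_int k * (-pi))"
    by (simp add: cis.ctr sin_int_times_real mult.commute)
  finally have "(LINT t:{-pi..pi}|lborel. cis (of_int k * t)) = 0"
    by (simp add: interval_integral_Icc)
  moreover have "(LINT t|circ. cis (of_int k * t))
     = (LINT t|lborel. (indicator {-pi..pi} t / (2*pi)) *\<^sub>R cis (of_int k * t))"
    unfolding circ_eq_density by (subst integral_density) auto
  moreover have "(indicator {-pi..pi} t / (2*pi)) *\<^sub>R cis (of_int k * t)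
      = (1 / (2*pi)) *\<^sub>R (indicator {-pi..pi} t *\<^sub>R cis (of_int k * t))" for t
    by simp
  ultimately show ?thesis
    unfolding set_lebesgue_integral_def by (simp only: integral_scaleR_right scaleR_zero_right)
qed

lemma circ_integrable_bounded:
  fixes f :: "real \<Rightarrow> 'a::{banach,second_countable_topology}"
  assumes "f \<in> borel_measurable borel" "\<And>t. norm (f t) \<le> B"
  shows "integrable circ f"
  using assms by (intro circ.integrable_const_bound[where B = B]) auto

lemma integral_circ_orth:
  "(LINT t|circ. cis t ^ j * cnj (cis t) ^ i) = of_bool (i = j)"
proof (cases "i = j")
  case True
  have "cis t ^ j * cnj (cis t) ^ j = 1" for t
    by (simp add: cis_cnj flip: power_mult_distrib) (simp add: cis_mult)
  then show ?thesis using True circ.prob_space by (simp add: measure_def)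
next
  case False
  have "cis t ^ j * cnj (cis t) ^ i = cis (of_int (int j - int i) * t)" for t
    unfolding cis_cnj Complex.DeMoivre cis_mult by (rule arg_cong[of _ _ cis]) (simp add: algebra_simps)
  then show ?thesis using False integral_circ_cis[of "int j - int i"] by simp
qed

text \<open>Parseval for a series in \<open>cis t\<close> against one in its conjugate:
  orthogonality leaves only the diagonal. Both interchanges of sum and integral are dominated by
  products of the l1 norms of \<open>d\<close> and \<open>e\<close>.\<close>

lemma integral_circ_pairing:
  fixes d e :: "nat \<Rightarrow> complex"
  assumes d: "summable (\<lambda>j. cmod (d j))" and e: "summable (\<lambda>j. cmod (e j))"
  shows "(\<lambda>j. d j * e j) sums
    (LINT t|circ. (\<Sum>j. d j * cis t ^ j) * (\<Sum>i. e i * cnj (cis t) ^ i))"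
proof -
  have n1: "cmod (d j * cis t ^ j) = cmod (d j)" for j t by (simp add: norm_mult norm_power)
  have n2: "cmod (e j * cnj (cis t) ^ j) = cmod (e j)" for j t by (simp add: norm_mult norm_power)
  have se: "summable (\<lambda>i. e i * cnj (cis t) ^ i)" for t
    by (rule summable_norm_cancel) (simp only: n2 e)
  have sd: "summable (\<lambda>i. d i * cis t ^ i)" for t
    by (rule summable_norm_cancel) (simp only: n1 d)
  have be: "cmod (\<Sum>i. e i * cnj (cis t) ^ i) \<le> (\<Sum>i. cmod (e i))" for t
    by (rule order_trans[OF summable_norm]) (simp_all only: n2 e order_refl)
  have inner: "(LINT t|circ. cis t ^ j * (\<Sum>i. e i * cnj (cis t) ^ i)) = e j" for j
  proof -
    have int: "integrable circ (\<lambda>t. cis t ^ j * (e i * cnj (cis t) ^ i))" for i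
      by (rule circ_integrable_bounded[where B = "cmod (e i)"]) (auto simp: norm_mult norm_power)
    have "(\<lambda>i. LINT t|circ. cis t ^ j * (e i * cnj (cis t) ^ i)) sums
        (LINT t|circ. (\<Sum>i. cis t ^ j * (e i * cnj (cis t) ^ i)))"
      by (rule sums_integral) (use int e circ.prob_space in \<open>auto simp: norm_mult norm_power measure_def\<close>)
    moreover have "(LINT t|circ. cis t ^ j * (e i * cnj (cis t) ^ i)) = (if i = j then e j else 0)" for i
      using integral_mult_right_zero[of circ "e i" "\<lambda>t. cis t ^ j * cnj (cis t) ^ i"]
      by (simp add: integral_circ_orth mult_ac split: if_splits)
    moreover have "(\<lambda>i. if i = j then e j else 0) sums e j" by (rule sums_single)
    ultimately have "(LINT t|circ. (\<Sum>i. cis t ^ j * (e i * cnj (cis t) ^ i))) = e j"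
      by (simp add: sums_unique2)
    then show ?thesis by (simp add: suminf_mult[OF se])
  qed
  have int: "integrable circ (\<lambda>t. d j * cis t ^ j * (\<Sum>i. e i * cnj (cis t) ^ i))" for j
    by (rule circ_integrable_bounded[where B = "cmod (d j) * (\<Sum>i. cmod (e i))"])
      (auto simp: norm_mult norm_power intro!: mult_left_mono be)
  have sm: "summable (\<lambda>j. cmod (d j) * (\<Sum>i. cmod (e i)))"
    using d by (rule summable_mult2)
  have "(\<lambda>j. LINT t|circ. d j * cis t ^ j * (\<Sum>i. e i * cnj (cis t) ^ i)) sums
        (LINT t|circ. (\<Sum>j. d j * cis t ^ j * (\<Sum>i. e i * cnj (cis t) ^ i)))"
  proof (rule sums_integral)
    show "integrable circ (\<lambda>t. d j * cis t ^ j * (\<Sum>i. e i * cnj (cis t) ^ i))" for j by (rule int)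
    show "AE t in circ. summable (\<lambda>j. cmod (d j * cis t ^ j * (\<Sum>i. e i * cnj (cis t) ^ i)))"
      by (auto simp: norm_mult norm_power intro!: summable_mult2 d)
    show "summable (\<lambda>j. LINT t|circ. cmod (d j * cis t ^ j * (\<Sum>i. e i * cnj (cis t) ^ i)))"
    proof (rule summable_comparison_test'[OF sm, of 0])
      fix j
      have "(LINT t|circ. cmod (d j * cis t ^ j * (\<Sum>i. e i * cnj (cis t) ^ i)))
          \<le> (LINT t|circ. cmod (d j) * (\<Sum>i. cmod (e i)))"
        by (rule integral_mono[OF integrable_norm[OF int]])
          (auto simp: norm_mult norm_power intro!: mult_left_mono be)
      then show "norm (LINT t|circ. cmod (d j * cis t ^ j * (\<Sum>i. e i * cnj (cis t) ^ i)))
         \<le> cmod (d j) * (\<Sum>i. cmod (e i))"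
        using circ.prob_space by (simp add: measure_def)
    qed
  qed
  moreover have "(LINT t|circ. d j * cis t ^ j * (\<Sum>i. e i * cnj (cis t) ^ i)) = d j * e j" for j
    using inner[of j] integral_mult_right_zero[of circ "d j" "\<lambda>t. cis t ^ j * (\<Sum>i. e i * cnj (cis t) ^ i)"]
    by (simp add: mult.assoc)
  ultimately show ?thesis by (simp add: suminf_mult2[OF sd])
qed

lemma integral_circ_power_series:
  fixes d :: "nat \<Rightarrow> complex"
  assumes d: "summable (\<lambda>j. cmod (d j))"
  shows "(LINT t|circ. (\<Sum>j. d j * cis t ^ j)) = d 0"
proof -
  \<comment> \<open>Pairing with the unit sequence at 0 reads off the constant coefficient.\<close>
  define e :: "nat \<Rightarrow> complex" where "e = (\<lambda>i. if i = 0 then 1 else 0)"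
  have "(\<lambda>j. d j * e j) sums (LINT t|circ. (\<Sum>j. d j * cis t ^ j) * (\<Sum>i. e i * cnj (cis t) ^ i))"
    by (rule integral_circ_pairing[OF d], rule summable_finite[of "{0}"]) (auto simp: e_def)
  moreover have "(\<Sum>i. e i * cnj (cis t) ^ i) = 1" for t
    by (subst suminf_finite[of "{0}"]) (auto simp: e_def)
  moreover have "(\<lambda>j. d j * e j) sums d 0"
    using sums_finite[of "{0}" "\<lambda>j. d j * e j"] by (auto simp: e_def)
  ultimately show ?thesis by (simp add: sums_unique2)
qed

text \<open>These are the Taylor coefficients of (1 - w)^(-\<alpha>). In terms of
  \<open>pochhammer\<close> they carry no signs and are quotients of Gamma values.\<close>

definition binom_coeff :: "real \<Rightarrow> nat \<Rightarrow> real" where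
  "binom_coeff \<alpha> j = pochhammer \<alpha> j / fact j"

lemma binomial_kernel_sums:
  assumes "cmod w < 1"
  shows "(\<lambda>j. of_real (binom_coeff \<alpha> j) * w ^ j) sums (1 / (1 - w) powr of_real \<alpha>)"
proof -
  have "(\<lambda>n. (-of_real \<alpha> gchoose n) * (-w) ^ n) sums (1 + - w) powr (- of_real \<alpha>)"
    using assms by (intro gen_binomial_complex) auto
  moreover have "(-of_real \<alpha> gchoose n) * (-w) ^ n = of_real (binom_coeff \<alpha> n) * w ^ n" for n
  proof -
    have "(-complex_of_real \<alpha> gchoose n) = (-1) ^ n * of_real (binom_coeff \<alpha> n)"
      by (simp add: gbinomial_pochhammer binom_coeff_def pochhammer_of_real)
    moreover have "(-w) ^ n = (-1) ^ n * w ^ n" by (rule power_minus)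
    moreover have "(-1 :: complex) ^ n * (-1) ^ n = 1" by (simp flip: power_mult_distrib)
    ultimately show ?thesis by (metis mult.assoc mult.commute mult.left_neutral)
  qed
  ultimately show ?thesis by (simp add: powr_minus_divide)
qed

lemma summable_norm_binomial_kernel:
  assumes "cmod w < 1"
  shows "summable (\<lambda>j. cmod (of_real (binom_coeff \<alpha> j) * w ^ j))"
proof -
  obtain s where s: "cmod w < s" "s < 1" using dense assms by blast
  then have "0 < s" using norm_ge_zero[of w] by linarith
  then have "summable (\<lambda>j. of_real (binom_coeff \<alpha> j) * (of_real s :: complex) ^ j)"
    using sums_summable[OF binomial_kernel_sums[of "of_real s" \<alpha>]] s by simp
  then show ?thesis by (rule powser_insidea) (use s in auto)
qed

text \<open>On densities with nonnegative frequencies the transform is a coefficient multiplier.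
  Finding a density for a given function thus amounts to dividing its Taylor coefficients by
  \<open>binom_coeff\<close>.\<close>

lemma frac_cauchy_power_series:
  fixes d :: "nat \<Rightarrow> complex"
  assumes d: "summable (\<lambda>j. cmod (d j))" and z: "cmod z < 1"
  shows "(\<lambda>j. d j * of_real (binom_coeff \<alpha> j) * z ^ j) sums
    (LINT t|circ. (\<Sum>j. d j * cis t ^ j) * (1 / (1 - cnj (cis t) * z) powr of_real \<alpha>))"
proof -
  have "(\<Sum>i. of_real (binom_coeff \<alpha> i) * z ^ i * cnj (cis t) ^ i) = 1 / (1 - cnj (cis t) * z) powr of_real \<alpha>" for t
  proof -
    have "cmod (cnj (cis t) * z) < 1" using z by (simp add: norm_mult)
    note sums_unique[OF binomial_kernel_sums[OF this, of \<alpha>]]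
    moreover have "of_real (binom_coeff \<alpha> i) * (cnj (cis t) * z) ^ i
        = of_real (binom_coeff \<alpha> i) * z ^ i * cnj (cis t) ^ i" for i
      by (simp add: power_mult_distrib)
    ultimately show ?thesis by simp
  qed
  then show ?thesis
    using integral_circ_pairing[OF d summable_norm_binomial_kernel[OF z, of \<alpha>]] by (simp add: mult.assoc)
qed

text \<open>The Poisson kernel (1 - |A|^2) / |1 - A w|^2 has mean 1 over |w| = 1, being the real
  part of (1 + A w) / (1 - A w), a power series in w with constant term 1.\<close>

lemma integral_circ_poisson:
  fixes A :: complex
  assumes A: "cmod A < 1"
  shows "(LINT t|circ. (1 / cmod (1 - A * cis t))\<^sup>2) = 1 / (1 - (cmod A)\<^sup>2)"
proof -
  \<comment> \<open>Taylor coefficients of 2 / (1 - A w) - 1 = (1 + A w) / (1 - A w).\<close>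
  define d where "d j = (if j = 0 then 1 else 2 * A ^ j)" for j :: nat
  have sA: "(\<lambda>j. cmod (A ^ j)) sums (1 / (1 - cmod A))"
    using geometric_sums[of "cmod A"] A unfolding norm_power by simp
  have d: "summable (\<lambda>j. cmod (d j))"
  proof (rule summable_comparison_test'[where N = 0])
    show "summable (\<lambda>j. 2 * cmod (A ^ j))" by (rule summable_mult[OF sums_summable[OF sA]])
    show "norm (cmod (d j)) \<le> 2 * cmod (A ^ j)" for j by (simp add: d_def norm_mult)
  qed
  have nz: "1 - A * cis t \<noteq> 0" for t
  proof
    assume "1 - A * cis t = 0"
    then have "cmod (A * cis t) = 1" by simp
    then show False using A by (simp add: norm_mult)
  qed
  have ser: "(\<Sum>j. d j * cis t ^ j) = 2 / (1 - A * cis t) - 1" for t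
  proof -
    have "(\<lambda>j. 2 * (A * cis t) ^ j) sums (2 * (1 / (1 - A * cis t)))"
      by (intro sums_mult geometric_sums) (use A in \<open>simp add: norm_mult\<close>)
    then have "(\<lambda>j. 2 * (A * cis t) ^ j - (if j = 0 then 1 else 0)) sums (2 * (1 / (1 - A * cis t)) - 1)"
      by (intro sums_diff sums_single)
    moreover have "2 * (A * cis t) ^ j - (if j = 0 then 1 else 0) = d j * cis t ^ j" for j
      by (auto simp: d_def power_mult_distrib)
    ultimately show ?thesis by (simp add: sums_iff)
  qed
  have id: "(1 / cmod (1 - A * cis t))\<^sup>2 = Re (2 / (1 - A * cis t) - 1) / (1 - (cmod A)\<^sup>2)" for t
  proof -
    let ?w = "A * cis t"
    have w: "cmod ?w = cmod A" by (simp add: norm_mult)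
    have "Re (2 / (1 - ?w) - 1) = (1 - (cmod ?w)\<^sup>2) / (cmod (1 - ?w))\<^sup>2"
    proof -
      have "2 / (1 - ?w) - 1 = (1 + ?w) / (1 - ?w)" using nz[of t] by (simp add: field_simps)
      also have "\<dots> = (1 + ?w) * cnj (1 - ?w) / of_real ((cmod (1 - ?w))\<^sup>2)"
        by (subst complex_div_cnj) simp
      finally have "Re (2 / (1 - ?w) - 1) = Re ((1 + ?w) * cnj (1 - ?w)) / (cmod (1 - ?w))\<^sup>2"
        by (simp only: Re_divide_of_real)
      also have "Re ((1 + ?w) * cnj (1 - ?w)) = 1 - (cmod ?w)\<^sup>2"
        unfolding cmod_power2 by (simp add: algebra_simps power2_eq_square)
      finally show ?thesis .
    qed
    moreover have "1 - (cmod A)\<^sup>2 \<noteq> 0" using A abs_square_eq_1[of "cmod A"] by auto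
    ultimately show ?thesis using w by (simp add: power_divide)
  qed
  have int: "integrable circ (\<lambda>t. 2 / (1 - A * cis t) - 1)"
    unfolding ser[symmetric]
  proof (rule circ_integrable_bounded[where B = "\<Sum>j. cmod (d j)"])
    show "(\<lambda>t. \<Sum>j. d j * cis t ^ j) \<in> borel_measurable borel" by measurable
    fix t
    have n: "cmod (d j * cis t ^ j) = cmod (d j)" for j by (simp add: norm_mult norm_power)
    show "cmod (\<Sum>j. d j * cis t ^ j) \<le> (\<Sum>j. cmod (d j))"
      by (rule order_trans[OF summable_norm]) (simp_all only: n d order_refl)
  qed
  have "(LINT t|circ. 2 / (1 - A * cis t) - 1) = 1"
    using integral_circ_power_series[OF d] unfolding ser by (simp add: d_def)
  then have "(LINT t|circ. Re (2 / (1 - A * cis t) - 1)) = 1"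
    by (subst integral_Re[OF int]) simp
  then show ?thesis unfolding id by simp
qed

subsection \<open>Densities of fractional Cauchy transforms\<close>

text \<open>The weight of the disc integral, packaged as a measure on the radius because its moments
  are the Beta values that invert \<open>binom_coeff\<close> up to a linear factor.\<close>

definition radial :: "real \<Rightarrow> real measure" where
  "radial \<alpha> = density lborel (\<lambda>t. ennreal (indicator {0..1} t * (1 - t) powr (\<alpha> - 1)))"

lemma sets_radial [simp, measurable_cong]: "sets (radial \<alpha>) = sets borel"
  by (simp add: radial_def)

lemma space_radial [simp]: "space (radial \<alpha>) = UNIV"
  by (simp add: radial_def)

lemma AE_radial: "AE t in radial \<alpha>. 0 \<le> t \<and> t < 1"
  unfolding radial_def
proof (subst AE_density)
  \<comment> \<open>At t = 1 the density is \<open>0 powr (\<alpha> - 1)\<close>, which is 0 by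
    convention, so the implication even holds at every t.\<close>
  show "AE t in lborel. 0 < ennreal (indicator {0..1} t * (1 - t) powr (\<alpha> - 1)) \<longrightarrow> 0 \<le> t \<and> t < 1"
    by (auto simp: indicator_def less_le split: if_splits)
qed auto

lemma nn_integral_radial:
  assumes "f \<in> borel_measurable borel"
  shows "(\<integral>\<^sup>+t. f t \<partial>radial \<alpha>) = (\<integral>\<^sup>+t. ennreal ((1 - t) powr (\<alpha> - 1)) * f t * indicator {0..1} t \<partial>lborel)"
  unfolding radial_def using assms
  by (subst nn_integral_density) (auto simp: indicator_def intro!: nn_integral_cong)

lemma nn_integral_radial_moment:
  assumes "\<alpha> > 0"
  shows "(\<integral>\<^sup>+t. ennreal (t ^ j) \<partial>radial \<alpha>) = ennreal (Beta (real j + 1) \<alpha>)"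
proof -
  have "((\<lambda>t. t powr (real j + 1 - 1) * (1 - t) powr (\<alpha> - 1)) has_integral Beta (real j + 1) \<alpha>) {0..1}"
    using assms by (intro has_integral_Beta_real) auto
  \<comment> \<open>The point 0 is spiked because \<open>0 powr 0 = 0\<close> whereas
    \<open>0 ^ 0 = 1\<close>; the two integrands differ there when j = 0.\<close>
  then have "((\<lambda>t. t ^ j * (1 - t) powr (\<alpha> - 1)) has_integral Beta (real j + 1) \<alpha>) {0..1}"
    by (rule has_integral_spike[of "{0}", rotated 2]) (auto simp: powr_realpow)
  from nn_integral_has_integral_lebesgue'[OF _ this]
  have "(\<integral>\<^sup>+t. ennreal (t ^ j * (1 - t) powr (\<alpha> - 1)) * indicator {0..1} t \<partial>lborel) = ennreal (Beta (real j + 1) \<alpha>)"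
    by auto
  then show ?thesis
    by (subst nn_integral_radial)
      (auto simp: indicator_def ennreal_mult mult.commute intro!: nn_integral_cong elim!: trans[rotated])
qed

text \<open>By the functional equation, Gamma(j + 1 + \<alpha>) = (j + \<alpha>) Gamma(j +
  \<alpha>); the linear factor removes the first term of the product and the remaining Gamma values
  cancel against those of \<open>pochhammer\<close>.\<close>

lemma Beta_binom_coeff:
  assumes "\<alpha> > 0"
  shows "(real j + \<alpha>) * Beta (real j + 1) \<alpha> * binom_coeff \<alpha> j = 1"
proof -
  define g h where "g = Gamma (\<alpha> + real j)" and "h = Gamma \<alpha>"
  have 1: "Gamma (real j + 1) = fact j" by (metis Gamma_fact add.commute)
  have 2: "pochhammer \<alpha> j = g / h"
    unfolding g_def h_def using assms by (intro pochhammer_Gamma) (auto elim!: nonpos_Ints_cases)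
  have 3: "Gamma (real j + 1 + \<alpha>) = (real j + \<alpha>) * g"
    unfolding g_def using assms Gamma_plus1[of "\<alpha> + real j"] by (force simp: add_ac elim!: nonpos_Ints_cases)
  have pos: "g > 0" "h > 0" "real j + \<alpha> > 0" using assms by (auto simp: g_def h_def intro!: Gamma_real_pos)
  have "s * (F * h / (s * g)) * (g / h / F) = 1" if "s > 0" "F > 0" for s F :: real
    using that pos by (simp add: field_simps)
  from this[OF pos(3), of "fact j"] show ?thesis
    by (simp only: Beta_def binom_coeff_def 1 2 3 h_def[symmetric] fact_gt_zero True_implies_equals)
qed

lemma finite_measure_radial:
  assumes "\<alpha> > 0"
  shows "finite_measure (radial \<alpha>)" and "emeasure (radial \<alpha>) UNIV = ennreal (1 / \<alpha>)"
proof -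
  have "Beta 1 \<alpha> = 1 / \<alpha>" using Beta_binom_coeff[OF assms, of 0] assms by (simp add: binom_coeff_def field_simps)
  then show *: "emeasure (radial \<alpha>) UNIV = ennreal (1 / \<alpha>)"
    using nn_integral_radial_moment[OF assms, of 0] by simp
  show "finite_measure (radial \<alpha>)" by (rule finite_measureI) (simp add: *)
qed

lemma integral_radial_moment:
  assumes "\<alpha> > 0"
  shows "integrable (radial \<alpha>) (\<lambda>t. t ^ j)" "(LINT t|radial \<alpha>. t ^ j) = Beta (real j + 1) \<alpha>"
proof -
  have AE: "AE t in radial \<alpha>. 0 \<le> t ^ j" using AE_radial[of \<alpha>] by (auto elim!: eventually_mono)
  have B: "Beta (real j + 1) \<alpha> > 0" using assms by (auto simp: Beta_def intro!: divide_pos_pos mult_pos_pos Gamma_real_pos)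
  show "integrable (radial \<alpha>) (\<lambda>t. t ^ j)"
    by (rule integrableI_nonneg[OF _ AE]) (auto simp: nn_integral_radial_moment[OF assms])
  then show "(LINT t|radial \<alpha>. t ^ j) = Beta (real j + 1) \<alpha>"
    using nn_integral_eq_integral[OF _ AE] B nn_integral_radial_moment[OF assms, of j]
    by (metis ennreal_inj integral_nonneg_AE[OF AE] less_imp_le)
qed

text \<open>The operator w d/dw multiplies the n-th coefficient by n. Adding \<alpha> times the
  identity supplies exactly the linear factor that occurs in
  \<open>Beta_binom_coeff\<close>.\<close>

lemma holomorphic_euler_series:
  fixes f :: "complex \<Rightarrow> complex"
  assumes f: "f holomorphic_on ball 0 R" and w: "cmod w < R"
  shows "(\<lambda>n. (of_real \<alpha> + of_nat n) * ((deriv ^^ n) f 0 / fact n) * w ^ n) sums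
    (of_real \<alpha> * f w + w * deriv f w)"
proof -
  define b where "b n = (deriv ^^ n) f 0 / fact n" for n
  have b: "(\<lambda>n. b n * z ^ n) sums f z" if "cmod z < R" for z
    using holomorphic_power_series[OF f, of z] that by (simp add: b_def)
  have D: "((\<lambda>z. \<Sum>n. b n * z ^ n) has_field_derivative (\<Sum>n. diffs b n * w ^ n)) (at w)"
    by (rule termdiffs_strong'[of R]) (use b w in \<open>auto simp: sums_iff\<close>)
  have "deriv f w = (\<Sum>n. diffs b n * w ^ n)"
  proof (rule DERIV_imp_deriv, rule has_field_derivative_transform_within_open[OF D, of "ball 0 R"])
    show "w \<in> ball 0 R" using w by simp
    show "(\<Sum>n. b n * z ^ n) = f z" if "z \<in> ball 0 R" for z using b[of z] that by (simp add: sums_iff)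
  qed auto
  moreover have "summable (\<lambda>n. diffs b n * w ^ n)"
    by (rule termdiff_converges[of w R]) (use b w in \<open>auto simp: sums_iff\<close>)
  ultimately have "(\<lambda>n. of_nat n * b n * w ^ (n - Suc 0)) sums deriv f w"
    using diffs_equiv by metis
  then have "(\<lambda>n. w * (of_nat n * b n * w ^ (n - Suc 0))) sums (w * deriv f w)" by (rule sums_mult)
  moreover have "w * (of_nat n * b n * w ^ (n - Suc 0)) = of_nat n * (b n * w ^ n)" for n
    by (cases n) auto
  ultimately have "(\<lambda>n. of_nat n * (b n * w ^ n)) sums (w * deriv f w)" by simp
  from sums_add[OF sums_mult[OF b[OF w], of "of_real \<alpha>"] this]
  show ?thesis by (simp add: b_def ring_distribs mult.assoc add_divide_distrib)
qed

text \<open>The density is the fractional derivative of order \<open>1 - \<alpha>\<close> of \<open>f\<close>, which multiplies the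
  \<open>n\<close>-th Taylor coefficient by the inverse of \<open>binom_coeff \<alpha> n\<close>; since that inverse is a Beta
  integral times \<open>n + \<alpha>\<close>, it is a radial average of \<open>\<alpha> f + z f'\<close>.\<close>

lemma frac_cauchy_density:
  fixes f :: "complex \<Rightarrow> complex"
  assumes f: "f holomorphic_on ball 0 R" and R: "R > 1" and \<alpha>: "\<alpha> > 0"
  obtains \<phi> :: "real \<Rightarrow> complex" and B where
    "\<phi> \<in> borel_measurable borel" "\<And>t. cmod (\<phi> t) \<le> B"
    "\<And>z. cmod z < 1 \<Longrightarrow> (LINT t|circ. \<phi> t * (1 / (1 - cnj (cis t) * z) powr of_real \<alpha>)) = f z"
    "\<And>t. ennreal (cmod (\<phi> t)) \<le>
       (\<integral>\<^sup>+s. ennreal (cmod (of_real \<alpha> * f (of_real s * cis t) + of_real s * cis t * deriv f (of_real s * cis t))) \<partial>radial \<alpha>)"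
proof -
  define b where "b n = (deriv ^^ n) f 0 / fact n" for n
  define c where "c n = (of_real \<alpha> + of_nat n) * b n" for n
  define m where "m n = Beta (real n + 1) \<alpha>" for n
  define d where "d n = of_real (m n) * c n" for n
  define F where "F w = of_real \<alpha> * f w + w * deriv f w" for w
  have m_pos: "m n > 0" for n
    using \<alpha> by (auto simp: m_def Beta_def intro!: divide_pos_pos mult_pos_pos Gamma_real_pos)
  interpret V: finite_measure "radial \<alpha>" by (rule finite_measure_radial[OF \<alpha>])
  have m_le: "m n \<le> 1 / \<alpha>" for n
  proof -
    have "ennreal (m n) \<le> (\<integral>\<^sup>+t. 1 \<partial>radial \<alpha>)"
      unfolding m_def nn_integral_radial_moment[OF \<alpha>, symmetric]
      by (rule nn_integral_mono_AE, rule eventually_mono[OF AE_radial]) (auto simp: power_le_one)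
    also have "\<dots> = ennreal (1 / \<alpha>)" using finite_measure_radial(2)[OF \<alpha>] by simp
    finally show ?thesis using \<alpha> by (simp add: ennreal_le_iff)
  qed
  have cs: "(\<lambda>n. c n * w ^ n) sums F w" if "cmod w < R" for w
    using holomorphic_euler_series[OF f that] by (simp add: c_def b_def F_def)
  have c: "summable (\<lambda>n. cmod (c n))"
  proof -
    \<comment> \<open>Convergence at a radius beyond 1 gives absolute summability on the unit
      circle; this is what R > 1 is for.\<close>
    obtain \<rho> where \<rho>: "1 < \<rho>" "\<rho> < R" using dense R by blast
    have "summable (\<lambda>n. c n * of_real \<rho> ^ n)" using cs[of "of_real \<rho>"] \<rho> by (simp add: sums_iff)
    from powser_insidea[OF this, of 1] \<rho> show ?thesis by simp
  qed
  have c': "summable (\<lambda>n. 1 / \<alpha> * cmod (c n))" using c by (rule summable_mult)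
  have d: "summable (\<lambda>n. cmod (d n))"
  proof (rule summable_comparison_test'[OF c', of 0])
    fix n
    have "m n * cmod (c n) \<le> 1 / \<alpha> * cmod (c n)" by (rule mult_right_mono[OF m_le]) simp
    then show "norm (cmod (d n)) \<le> 1 / \<alpha> * cmod (c n)"
      using m_pos[of n] by (simp add: d_def norm_mult)
  qed
  define \<phi> where "\<phi> t = (\<Sum>n. d n * cis t ^ n)" for t
  have nd: "cmod (d j * cis t ^ j) = cmod (d j)" for j t by (simp add: norm_mult norm_power)
  show ?thesis
  proof (rule that[of \<phi> "\<Sum>n. cmod (d n)"])
    show "\<phi> \<in> borel_measurable borel" unfolding \<phi>_def by measurable
    show "cmod (\<phi> t) \<le> (\<Sum>n. cmod (d n))" for t
      unfolding \<phi>_def by (rule order_trans[OF summable_norm]) (simp_all only: nd d order_refl)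
    show "(LINT t|circ. \<phi> t * (1 / (1 - cnj (cis t) * z) powr of_real \<alpha>)) = f z" if z: "cmod z < 1" for z
    proof -
      have "d n * of_real (binom_coeff \<alpha> n) = b n" for n
      proof -
        have "d n * of_real (binom_coeff \<alpha> n) = of_real ((real n + \<alpha>) * m n * binom_coeff \<alpha> n) * b n"
          by (simp add: d_def c_def algebra_simps)
        also have "\<dots> = b n" unfolding m_def Beta_binom_coeff[OF \<alpha>] by simp
        finally show ?thesis .
      qed
      moreover have "(\<lambda>n. b n * z ^ n) sums f z"
        using holomorphic_power_series[OF f, of z] z R by (simp add: b_def)
      ultimately show ?thesis
        using frac_cauchy_power_series[OF d z, of \<alpha>] unfolding \<phi>_def[symmetric] by (simp add: sums_unique2)
    qed
    fix t
    have int: "integrable (radial \<alpha>) (\<lambda>s. c n * (of_real s * cis t) ^ n)" for n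
    proof -
      have "integrable (radial \<alpha>) (\<lambda>s. of_real (s ^ n) * (c n * cis t ^ n))"
        by (intro integrable_mult_left integrable_of_real integral_radial_moment \<alpha>)
      then show ?thesis by (simp add: power_mult_distrib mult_ac)
    qed
    have AEs: "AE s in radial \<alpha>. summable (\<lambda>n. cmod (c n * (of_real s * cis t) ^ n))"
      using AE_radial[of \<alpha>]
    proof eventually_elim
      case (elim s)
      show ?case
        by (rule summable_comparison_test'[OF c, of 0])
          (use elim in \<open>auto simp: norm_mult norm_power intro!: mult_left_le power_le_one\<close>)
    qed
    have sms: "summable (\<lambda>n. LINT s|radial \<alpha>. cmod (c n * (of_real s * cis t) ^ n))"
    proof (rule summable_comparison_test'[OF c', of 0])
      fix n
      have "(LINT s|radial \<alpha>. cmod (c n * (of_real s * cis t) ^ n)) \<le> (LINT s|radial \<alpha>. cmod (c n))"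
        by (rule integral_mono_AE[OF integrable_norm[OF int]], simp, rule eventually_mono[OF AE_radial])
          (auto simp: norm_mult norm_power intro!: mult_left_le power_le_one)
      also have "\<dots> = 1 / \<alpha> * cmod (c n)"
        using finite_measure_radial(2)[OF \<alpha>] \<alpha> by (simp add: measure_def)
      finally show "norm (LINT s|radial \<alpha>. cmod (c n * (of_real s * cis t) ^ n)) \<le> 1 / \<alpha> * cmod (c n)"
        by simp
    qed
    \<comment> \<open>The points s cis t lie in the unit disc for almost all s, so the exchange is
      dominated by the summable sequence |c n| / \<alpha>, where 1 / \<alpha> is the total mass of
      \<open>radial \<alpha>\<close>.\<close>
    have "(\<lambda>n. LINT s|radial \<alpha>. c n * (of_real s * cis t) ^ n) sums
        (LINT s|radial \<alpha>. (\<Sum>n. c n * (of_real s * cis t) ^ n))"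
      by (rule sums_integral[OF int AEs sms])
    moreover have "(LINT s|radial \<alpha>. c n * (of_real s * cis t) ^ n) = d n * cis t ^ n" for n
    proof -
      have "(LINT s|radial \<alpha>. c n * (of_real s * cis t) ^ n) = (LINT s|radial \<alpha>. of_real (s ^ n) * (c n * cis t ^ n))"
        by (simp add: power_mult_distrib mult_ac)
      also have "\<dots> = of_real (m n) * (c n * cis t ^ n)"
        by (subst integral_mult_left_zero, subst integral_complex_of_real) (simp add: integral_radial_moment[OF \<alpha>] m_def)
      finally show ?thesis by (simp add: d_def)
    qed
    ultimately have eq: "\<phi> t = (LINT s|radial \<alpha>. (\<Sum>n. c n * (of_real s * cis t) ^ n))"
      unfolding \<phi>_def by (simp add: sums_iff)
    have "ennreal (cmod (\<phi> t)) \<le> (\<integral>\<^sup>+s. ennreal (cmod (\<Sum>n. c n * (of_real s * cis t) ^ n)) \<partial>radial \<alpha>)"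
      unfolding eq by (rule integral_norm_bound_ennreal) (rule integrable_suminf[OF int AEs sms])
    also have "\<dots> = (\<integral>\<^sup>+s. ennreal (cmod (F (of_real s * cis t))) \<partial>radial \<alpha>)"
    proof (rule nn_integral_cong_AE)
      show "AE s in radial \<alpha>. ennreal (cmod (\<Sum>n. c n * (of_real s * cis t) ^ n)) = ennreal (cmod (F (of_real s * cis t)))"
        using AE_radial[of \<alpha>]
      proof eventually_elim
        case (elim s)
        then have "cmod (of_real s * cis t) < R" using R by (simp add: norm_mult)
        from sums_unique[OF cs[OF this]] show ?case by simp
      qed
    qed
    finally show "ennreal (cmod (\<phi> t)) \<le>
       (\<integral>\<^sup>+s. ennreal (cmod (of_real \<alpha> * f (of_real s * cis t) + of_real s * cis t * deriv f (of_real s * cis t))) \<partial>radial \<alpha>)"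
      unfolding F_def .
  qed
qed

subsection \<open>Kernel estimates\<close>

text \<open>The substitution v = (1 - t) / (1 - r t), whose derivative is -(1 - r) / (1 - r t)^2,
  turns the integral into that of v^(\<alpha> - 1) / (1 - r) over [0, 1]. The exponent -\<alpha> - 1
  is the one for which this is exact.\<close>

lemma has_integral_radial_kernel:
  fixes r \<alpha> :: real
  assumes r: "0 \<le> r" "r < 1" and \<alpha>: "\<alpha> > 0"
  shows "((\<lambda>t. (1 - t) powr (\<alpha> - 1) * (1 - r * t) powr (- \<alpha> - 1)) has_integral 1 / (\<alpha> * (1 - r))) {0..1}"
proof -
  define F where "F t = - (((1 - t) / (1 - r * t)) powr \<alpha>) / (\<alpha> * (1 - r))" for t
  have rt: "1 - r * t > 0" if "t \<le> 1" for t
    using mult_left_mono[OF that r(1)] r by simp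
  have "((\<lambda>t. (1 - t) powr (\<alpha> - 1) * (1 - r * t) powr (- \<alpha> - 1)) has_integral F 1 - F 0) {0..1}"
  \<comment> \<open>For \<alpha> < 1 the integrand blows up at 1, so the derivative is taken in the
    interior only; \<open>F\<close> stays continuous up to 1 since \<alpha> > 0.\<close>
  proof (rule fundamental_theorem_of_calculus_interior)
    show "continuous_on {0..1} F"
      unfolding F_def using rt \<alpha> r
      by (intro continuous_intros continuous_on_powr') (auto simp: less_imp_neq[symmetric] less_imp_le)
    fix t :: real assume t: "t \<in> {0<..<1}"
    then have u: "1 - r * t > 0" and s: "1 - t > 0" using rt[of t] by auto
    define g where "g = (\<lambda>t. (1 - t) / (1 - r * t))"
    have g: "(g has_real_derivative - (1 - r) / (1 - r * t)\<^sup>2) (at t)"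
    proof -
      have "(g has_real_derivative ((- 1) * (1 - r * t) - (1 - t) * (- r)) / ((1 - r * t) * (1 - r * t))) (at t)"
        unfolding g_def using u by (auto intro!: derivative_eq_intros)
      then show ?thesis by (simp add: power2_eq_square algebra_simps)
    qed
    have "((\<lambda>t. g t powr \<alpha>) has_real_derivative (\<alpha> * g t powr (\<alpha> - 1) * (- (1 - r) / (1 - r * t)\<^sup>2))) (at t)"
      by (rule DERIV_chain2[OF has_real_derivative_powr g]) (use u s in \<open>simp add: g_def\<close>)
    from DERIV_cdivide[OF DERIV_minus[OF this], of "\<alpha> * (1 - r)"]
    have "(F has_real_derivative - (\<alpha> * g t powr (\<alpha> - 1) * (- (1 - r) / (1 - r * t)\<^sup>2)) / (\<alpha> * (1 - r))) (at t)"
      unfolding F_def g_def by simp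
    also have "- (\<alpha> * g t powr (\<alpha> - 1) * (- (1 - r) / (1 - r * t)\<^sup>2)) / (\<alpha> * (1 - r)) = g t powr (\<alpha> - 1) / (1 - r * t)\<^sup>2"
      using \<alpha> r u by (simp add: divide_simps) (simp add: algebra_simps)
    also have "\<dots> = (1 - t) powr (\<alpha> - 1) * (1 - r * t) powr (- \<alpha> - 1)"
    proof -
      have "(1 - r * t) powr (- \<alpha> - 1) = (1 - r * t) powr (- (\<alpha> - 1) + (- 2))" by (rule arg_cong2[of _ _ _ _ "(powr)"]) auto
      also have "\<dots> = 1 / (1 - r * t) powr (\<alpha> - 1) * (1 / (1 - r * t)\<^sup>2)"
        unfolding powr_add powr_minus_divide using u by simp
      finally show ?thesis using u s by (simp add: powr_divide g_def)
    qed
    finally show "(F has_vector_derivative (1 - t) powr (\<alpha> - 1) * (1 - r * t) powr (- \<alpha> - 1)) (at t)"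
      by (simp add: has_real_derivative_iff_has_vector_derivative)
  qed simp
  moreover have "F 1 - F 0 = 1 / (\<alpha> * (1 - r))" by (simp add: F_def)
  ultimately show ?thesis by simp
qed

text \<open>Carries gauge integrals, which come from antiderivatives, over to the radial measure.
  The domination is asked only for t < 1, where the weight is nonzero, so the sign of the majorant
  at 1 is a separate condition.\<close>

lemma nn_integral_radial_le:
  assumes f: "f \<in> borel_measurable borel" and h: "(h has_integral I) {0..1}"
    and fh: "\<And>t. 0 \<le> t \<Longrightarrow> t < 1 \<Longrightarrow> 0 \<le> f t \<and> (1 - t) powr (\<alpha> - 1) * f t \<le> h t" and h1: "h 1 \<ge> 0"
  shows "(\<integral>\<^sup>+t. ennreal (f t) \<partial>radial \<alpha>) \<le> ennreal I"
proof -
  have h0: "0 \<le> h t" if "t \<in> {0..1}" for t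
  proof (cases "t = 1")
    case False
    then have "0 \<le> f t" "(1 - t) powr (\<alpha> - 1) * f t \<le> h t" using fh[of t] that by auto
    then show ?thesis by (meson mult_nonneg_nonneg order_trans powr_ge_zero)
  qed (use h1 in simp)
  have "(\<integral>\<^sup>+t. ennreal (f t) \<partial>radial \<alpha>) = (\<integral>\<^sup>+t. ennreal ((1 - t) powr (\<alpha> - 1)) * ennreal (f t) * indicator {0..1} t \<partial>lborel)"
    using f by (intro nn_integral_radial) auto
  also have "\<dots> \<le> (\<integral>\<^sup>+t. ennreal (h t) * indicator {0..1} t \<partial>lborel)"
  proof (rule nn_integral_mono)
    fix t :: real
    consider "t = 1" | "0 \<le> t" "t < 1" | "t \<notin> {0..1}" by fastforce
    then show "ennreal ((1 - t) powr (\<alpha> - 1)) * ennreal (f t) * indicator {0..1} t \<le> ennreal (h t) * indicator {0..1} t"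
    proof cases
      case 2
      then show ?thesis using fh[of t] by (simp add: indicator_def ennreal_leI flip: ennreal_mult)
    qed auto
  qed
  also have "\<dots> = ennreal I" using h0 h by (rule nn_integral_has_integral_lebesgue')
  finally show ?thesis .
qed

text \<open>Split (1 - r t)^(-2) into (1 - r t)^(\<alpha> - 1) and (1 - r t)^(-\<alpha> - 1). The
  first factor is at most (1 - r)^(\<alpha> - 1), as its exponent is not positive, and the second is
  integrated exactly.\<close>

lemma radial_kernel_2:
  assumes r: "0 \<le> r" "r < 1" and \<alpha>: "0 < \<alpha>" "\<alpha> \<le> 1"
  shows "(\<integral>\<^sup>+t. ennreal (1 / (1 - r * t)\<^sup>2) \<partial>radial \<alpha>) \<le> ennreal ((1 - r) powr (\<alpha> - 2) / \<alpha>)"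
proof -
  have "(\<integral>\<^sup>+t. ennreal (1 / (1 - r * t)\<^sup>2) \<partial>radial \<alpha>) \<le> ennreal ((1 - r) powr (\<alpha> - 1) * (1 / (\<alpha> * (1 - r))))"
  proof (rule nn_integral_radial_le[OF _ has_integral_mult_right[OF has_integral_radial_kernel[OF r \<alpha>(1)]]])
    fix t :: real assume t: "0 \<le> t" "t < 1"
    let ?u = "1 - r * t"
    have u: "1 - r \<le> ?u" using t r by (simp add: mult_left_le)
    then have u0: "?u > 0" using r by linarith
    have "1 / ?u\<^sup>2 = ?u powr (\<alpha> - 1) * ?u powr (- \<alpha> - 1)"
      using u0 by (simp add: powr_minus_divide flip: powr_add)
    also have "\<dots> \<le> (1 - r) powr (\<alpha> - 1) * ?u powr (- \<alpha> - 1)"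
      using u r \<alpha> by (intro mult_right_mono powr_mono2') auto
    finally have "1 / ?u\<^sup>2 \<le> (1 - r) powr (\<alpha> - 1) * ?u powr (- \<alpha> - 1)" .
    from mult_left_mono[OF this, of "(1 - t) powr (\<alpha> - 1)"]
    show "0 \<le> 1 / ?u\<^sup>2 \<and> (1 - t) powr (\<alpha> - 1) * (1 / ?u\<^sup>2) \<le> (1 - r) powr (\<alpha> - 1) * ((1 - t) powr (\<alpha> - 1) * ?u powr (- \<alpha> - 1))"
      by (simp add: mult_ac)
  qed auto
  also have "(1 - r) powr (\<alpha> - 1) * (1 / (\<alpha> * (1 - r))) = (1 - r) powr (\<alpha> - 2) / \<alpha>"
  proof -
    have "(1 - r) powr (\<alpha> - 2) = (1 - r) powr (\<alpha> - 1) * (1 - r) powr (-1)"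
      by (subst powr_add[symmetric]) simp
    then show ?thesis using r by (simp add: powr_minus_divide)
  qed
  finally show ?thesis .
qed

text \<open>Both summands come from \<open>radial_kernel_1\<close>: the first from integrating (1 -
  t + q)^(\<alpha> - 2), the second from the exact kernel. The blow-up as \<alpha> tends to 1
  reflects the logarithm in the limiting case; at \<alpha> = 1 itself division by zero makes the
  first summand 0.\<close>

definition rad_const :: "real \<Rightarrow> real" where
  "rad_const \<alpha> = 4 / (1 - \<alpha>) + 1 / \<alpha>"

text \<open>With s = 1 - t, q = 1 - r and u = 1 - r t one has u \<le> s + q, hence 1/u \<le> s/u^2 +
  q/u^2. After multiplication by s^(\<alpha> - 1) the first part is dominated by a power of s + q
  with an elementary antiderivative, and the second reduces to
  \<open>has_integral_radial_kernel\<close>.\<close>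

lemma radial_kernel_1:
  assumes r: "0 \<le> r" "r < 1" and \<alpha>: "0 < \<alpha>" "\<alpha> < 1"
  shows "(\<integral>\<^sup>+t. ennreal (1 / (1 - r * t)) \<partial>radial \<alpha>) \<le> ennreal (rad_const \<alpha> * (1 - r) powr (\<alpha> - 1))"
proof -
  define q where "q = 1 - r"
  have q: "q > 0" using r by (simp add: q_def)
  define F where "F t = (1 - t + q) powr (\<alpha> - 1) / (1 - \<alpha>)" for t
  have i1: "((\<lambda>t. (1 - t + q) powr (\<alpha> - 2)) has_integral F 1 - F 0) {0..1}"
  proof (rule fundamental_theorem_of_calculus_interior)
    show "continuous_on {0..1} F"
      unfolding F_def using q \<alpha> by (intro continuous_intros) auto
    fix t :: real assume t: "t \<in> {0<..<1}"
    then have s: "1 - t + q > 0" using q by auto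
    have "(F has_real_derivative ((\<alpha> - 1) * (1 - t + q) powr (\<alpha> - 1 - 1) * (- 1)) / (1 - \<alpha>)) (at t)"
      unfolding F_def using s \<alpha> by (auto intro!: derivative_eq_intros)
    also have "((\<alpha> - 1) * (1 - t + q) powr (\<alpha> - 1 - 1) * (- 1)) / (1 - \<alpha>) = (1 - t + q) powr (\<alpha> - 2)"
      using \<alpha> by (simp add: field_simps)
    finally show "(F has_vector_derivative (1 - t + q) powr (\<alpha> - 2)) (at t)"
      by (simp add: has_real_derivative_iff_has_vector_derivative)
  qed simp
  have "(\<integral>\<^sup>+t. ennreal (1 / (1 - r * t)) \<partial>radial \<alpha>) \<le> ennreal (4 * (F 1 - F 0) + q powr \<alpha> * (1 / (\<alpha> * (1 - r))))"
  proof (rule nn_integral_radial_le[OF _ has_integral_add[OF has_integral_mult_right[OF i1, of 4]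
        has_integral_mult_right[OF has_integral_radial_kernel[OF r \<alpha>(1)], of "q powr \<alpha>"]]])
    fix t :: real assume t: "0 \<le> t" "t < 1"
    define u s where "u = 1 - r * t" and "s = 1 - t"
    have s: "s > 0" using t by (simp add: s_def)
    have uq: "q \<le> u" using t r by (simp add: q_def u_def mult_left_le)
    have us: "s \<le> u" using t r by (simp add: s_def u_def mult_left_le_one_le)
    have usq: "u \<le> s + q"
    proof -
      have "s + q - u = (1 - t) * (1 - r)" by (simp add: s_def q_def u_def algebra_simps)
      moreover have "(1 - t) * (1 - r) \<ge> 0" using t r by simp
      ultimately show ?thesis by linarith
    qed
    have u0: "u > 0" using uq q by linarith
    \<comment> \<open>u exceeds both s and q, hence their mean; squaring the 2 in that mean gives
      the 4.\<close>
    have e1: "s powr \<alpha> / u\<^sup>2 \<le> 4 * (s + q) powr (\<alpha> - 2)"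
    proof -
      have "s powr \<alpha> / u\<^sup>2 \<le> (s + q) powr \<alpha> / ((s + q) / 2)\<^sup>2"
        using s q uq us u0 \<alpha> by (intro frac_le powr_mono2 power_mono) auto
      also have "\<dots> = 4 * (s + q) powr (\<alpha> - 2)"
        using s q by (simp add: powr_diff power_divide)
      finally show ?thesis .
    qed
    have e2: "q * s powr (\<alpha> - 1) / u\<^sup>2 \<le> q powr \<alpha> * (s powr (\<alpha> - 1) * u powr (- \<alpha> - 1))"
    proof -
      have "1 / u\<^sup>2 = u powr (\<alpha> - 1) * u powr (- \<alpha> - 1)"
        using u0 by (simp add: powr_minus_divide flip: powr_add)
      also have "\<dots> \<le> q powr (\<alpha> - 1) * u powr (- \<alpha> - 1)"
        using uq q \<alpha> by (intro mult_right_mono powr_mono2') auto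
      finally have "q * s powr (\<alpha> - 1) * (1 / u\<^sup>2) \<le> q * s powr (\<alpha> - 1) * (q powr (\<alpha> - 1) * u powr (- \<alpha> - 1))"
        using q by (intro mult_left_mono) auto
      also have "q powr \<alpha> = q * q powr (\<alpha> - 1)" using q by (simp add: powr_diff)
      then have "q * s powr (\<alpha> - 1) * (q powr (\<alpha> - 1) * u powr (- \<alpha> - 1)) = q powr \<alpha> * (s powr (\<alpha> - 1) * u powr (- \<alpha> - 1))"
        by simp
      finally show ?thesis by simp
    qed
    have "s powr (\<alpha> - 1) * (1 / u) = s powr (\<alpha> - 1) * u / u\<^sup>2" using u0 by (simp add: power2_eq_square)
    also have "\<dots> \<le> s powr (\<alpha> - 1) * (s + q) / u\<^sup>2"
      using usq by (intro divide_right_mono mult_left_mono) auto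
    also have "\<dots> = s powr \<alpha> / u\<^sup>2 + q * s powr (\<alpha> - 1) / u\<^sup>2"
      using s by (simp add: powr_diff distrib_left add_divide_distrib)
    finally have "s powr (\<alpha> - 1) * (1 / u) \<le> 4 * (s + q) powr (\<alpha> - 2) + q powr \<alpha> * (s powr (\<alpha> - 1) * u powr (- \<alpha> - 1))"
      using e1 e2 by linarith
    then show "0 \<le> 1 / (1 - r * t) \<and> (1 - t) powr (\<alpha> - 1) * (1 / (1 - r * t)) \<le>
       4 * (1 - t + q) powr (\<alpha> - 2) + q powr \<alpha> * ((1 - t) powr (\<alpha> - 1) * (1 - r * t) powr (- \<alpha> - 1))"
      using u0 by (simp add: u_def s_def)
  qed (use q in auto)
  also have "4 * (F 1 - F 0) + q powr \<alpha> * (1 / (\<alpha> * (1 - r))) \<le> rad_const \<alpha> * (1 - r) powr (\<alpha> - 1)"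
  proof -
    have "F 0 \<ge> 0" using q \<alpha> by (simp add: F_def)
    moreover have "F 1 = q powr (\<alpha> - 1) / (1 - \<alpha>)" by (simp add: F_def)
    moreover have "q powr \<alpha> * (1 / (\<alpha> * (1 - r))) = q powr (\<alpha> - 1) / \<alpha>"
      using q by (simp add: powr_diff q_def)
    ultimately show ?thesis unfolding rad_const_def q_def[symmetric] by (simp add: field_simps)
  qed
  finally show ?thesis by (simp add: ennreal_leI)
qed

section \<open>Kernel products integrated over circles and over the disc\<close>

lemma circle_kernel_2:
  assumes A: "cmod A < 1"
  shows "(\<integral>\<^sup>+t. ennreal ((1 / cmod (1 - A * cis t))\<^sup>2) \<partial>circ) = ennreal (1 / (1 - (cmod A)\<^sup>2))"
proof -
  have lb: "1 - cmod A \<le> cmod (1 - A * cis t)" for t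
    using norm_triangle_ineq2[of 1 "A * cis t"] by (simp add: norm_mult)
  have "integrable circ (\<lambda>t. (1 / cmod (1 - A * cis t))\<^sup>2)"
  proof (rule circ_integrable_bounded)
    show "norm ((1 / cmod (1 - A * cis t))\<^sup>2) \<le> (1 / (1 - cmod A))\<^sup>2" for t
      using lb[of t] A by (auto intro!: power_mono divide_left_mono mult_pos_pos simp: power_divide[symmetric] simp del: power_divide)
  qed measurable
  then show ?thesis
    by (subst nn_integral_eq_integral) (auto simp: integral_circ_poisson[OF A])
qed

text \<open>For |w| = 1, 1 - A cnj B = (1 - A w) + A w cnj(1 - B w), so the two factors cannot both
  be small compared with |1 - A cnj B|. Dividing D^2 \<le> 2 (x^2 + y^2) by x^2 y^2 replaces the
  product of the two kernels by a sum of Poisson kernels.\<close>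

lemma circle_kernel_22:
  assumes A: "cmod A < 1" and B: "cmod B < 1"
  shows "(\<integral>\<^sup>+t. ennreal ((1 / cmod (1 - A * cis t))\<^sup>2 * (1 / cmod (1 - B * cis t))\<^sup>2) \<partial>circ)
    \<le> ennreal (2 / (cmod (1 - A * cnj B))\<^sup>2 * (1 / (1 - (cmod A)\<^sup>2) + 1 / (1 - (cmod B)\<^sup>2)))"
proof -
  define D where "D = cmod (1 - A * cnj B)"
  have "cmod (A * cnj B) < 1"
    using A B by (simp add: norm_mult) (metis norm_ge_zero order_le_less_trans mult_left_le_one_le less_imp_le)
  then have D: "D > 0" unfolding D_def by (auto simp: right_minus_eq)
  have q: "1 - (cmod A)\<^sup>2 > 0" "1 - (cmod B)\<^sup>2 > 0" using A B by (auto simp: abs_square_less_1)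
  have pos: "cmod (1 - C * cis t) > 0" if "cmod C < 1" for C t
    by (rule less_le_trans[OF _ norm_triangle_ineq2]) (use that in \<open>simp add: norm_mult\<close>)
  have pt: "(1 / cmod (1 - A * cis t))\<^sup>2 * (1 / cmod (1 - B * cis t))\<^sup>2
     \<le> 2 / D\<^sup>2 * ((1 / cmod (1 - A * cis t))\<^sup>2 + (1 / cmod (1 - B * cis t))\<^sup>2)" for t
  proof -
    define x y where "x = cmod (1 - A * cis t)" and "y = cmod (1 - B * cis t)"
    have xy: "x > 0" "y > 0" using pos A B by (auto simp: x_def y_def)
    have "cis t * cnj (cis t) = 1" by (simp add: cis_cnj cis_mult)
    then have "1 - A * cnj B = (1 - A * cis t) + A * cis t * cnj (1 - B * cis t)"
      by (simp add: algebra_simps)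
    then have "D \<le> x + cmod A * y"
      unfolding D_def x_def y_def
      by (metis norm_triangle_ineq norm_mult norm_cis mult.right_neutral complex_mod_cnj)
    also have "\<dots> \<le> x + y" using A xy by (simp add: mult_left_le_one_le)
    finally have "D\<^sup>2 \<le> (x + y)\<^sup>2" using D by (intro power_mono) auto
    also have "\<dots> \<le> 2 * (x\<^sup>2 + y\<^sup>2)" using sum_squares_ge_zero[of "x - y" 0] by (simp add: power2_eq_square algebra_simps)
    finally have "1 \<le> 2 / D\<^sup>2 * (x\<^sup>2 + y\<^sup>2)" using D by (simp add: field_simps)
    then have "1 * (1 / (x\<^sup>2 * y\<^sup>2)) \<le> 2 / D\<^sup>2 * (x\<^sup>2 + y\<^sup>2) * (1 / (x\<^sup>2 * y\<^sup>2))"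
      by (rule mult_right_mono) simp
    also have "\<dots> = 2 / D\<^sup>2 * ((1 / x)\<^sup>2 + (1 / y)\<^sup>2)" using xy by (simp add: field_simps)
    finally show ?thesis using xy by (simp add: x_def y_def power_divide)
  qed
  have "(\<integral>\<^sup>+t. ennreal ((1 / cmod (1 - A * cis t))\<^sup>2 * (1 / cmod (1 - B * cis t))\<^sup>2) \<partial>circ)
     \<le> (\<integral>\<^sup>+t. ennreal (2 / D\<^sup>2) * (ennreal ((1 / cmod (1 - A * cis t))\<^sup>2) + ennreal ((1 / cmod (1 - B * cis t))\<^sup>2)) \<partial>circ)"
    using pt by (intro nn_integral_mono) (simp flip: ennreal_plus ennreal_mult add: ennreal_leI)
  also have "\<dots> = ennreal (2 / D\<^sup>2) * (ennreal (1 / (1 - (cmod A)\<^sup>2)) + ennreal (1 / (1 - (cmod B)\<^sup>2)))"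
    by (subst nn_integral_cmult, measurable, subst nn_integral_add, measurable, simp only: circle_kernel_2[OF A] circle_kernel_2[OF B])
  also have "\<dots> = ennreal (2 / D\<^sup>2 * (1 / (1 - (cmod A)\<^sup>2) + 1 / (1 - (cmod B)\<^sup>2)))"
    using q by (simp only: ennreal_mult' ennreal_plus divide_nonneg_nonneg zero_le_numeral zero_le_power2 zero_le_one less_imp_le)
  finally show ?thesis unfolding D_def .
qed

lemma nn_integral_circ_radial_swap:
  fixes f :: "real \<Rightarrow> real \<Rightarrow> ennreal"
  assumes "(\<lambda>(t, s). f t s) \<in> borel_measurable (borel \<Otimes>\<^sub>M borel)" and "\<alpha> > 0"
  shows "(\<integral>\<^sup>+t. \<integral>\<^sup>+s. f t s \<partial>radial \<alpha> \<partial>circ) = (\<integral>\<^sup>+s. \<integral>\<^sup>+t. f t s \<partial>circ \<partial>radial \<alpha>)"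
proof -
  interpret V: finite_measure "radial \<alpha>" by (rule finite_measure_radial[OF assms(2)])
  interpret P: pair_sigma_finite circ "radial \<alpha>" ..
  have "(\<lambda>(t, s). f t s) \<in> borel_measurable (circ \<Otimes>\<^sub>M radial \<alpha>)"
    using assms(1) by (simp cong: measurable_cong_sets sets_pair_measure_cong)
  then show ?thesis by (rule P.Fubini'[symmetric])
qed

lemma one_minus_cnj_mult_ge: "1 - cmod b * cmod z \<le> cmod (1 - cnj b * z)"
  using norm_triangle_ineq2[of 1 "cnj b * z"] by (simp add: norm_mult)

text \<open>On the circle of radius s one of the three kernel factors is bounded by its supremum and
  the other two form a Poisson kernel. This leaves (1 - |b| s)^(-2), the case of
  \<open>radial_kernel_2\<close>.\<close>

lemma area_kernel_3:
  assumes b: "cmod b < 1" and \<alpha>: "0 < \<alpha>" "\<alpha> \<le> 1"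
  shows "(\<integral>\<^sup>+t. \<integral>\<^sup>+s. ennreal ((1 / cmod (1 - cnj b * (of_real s * cis t))) ^ 3) \<partial>radial \<alpha> \<partial>circ)
    \<le> ennreal ((1 - cmod b) powr (\<alpha> - 2) / \<alpha>)"
proof -
  have "(\<integral>\<^sup>+t. \<integral>\<^sup>+s. ennreal ((1 / cmod (1 - cnj b * (of_real s * cis t))) ^ 3) \<partial>radial \<alpha> \<partial>circ)
      = (\<integral>\<^sup>+s. \<integral>\<^sup>+t. ennreal ((1 / cmod (1 - cnj b * (of_real s * cis t))) ^ 3) \<partial>circ \<partial>radial \<alpha>)"
    by (rule nn_integral_circ_radial_swap[OF _ \<alpha>(1)]) measurable
  also have "\<dots> \<le> (\<integral>\<^sup>+s. ennreal (1 / (1 - cmod b * s)\<^sup>2) \<partial>radial \<alpha>)"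
  proof (rule nn_integral_mono_AE, rule eventually_mono[OF AE_radial])
    fix s :: real assume s: "0 \<le> s \<and> s < 1"
    define A where "A = cnj b * of_real s"
    have nA: "cmod A = cmod b * s" using s by (simp add: A_def norm_mult)
    have A: "cmod A < 1" unfolding nA using b s by (metis norm_ge_zero less_imp_le order_le_less_trans mult_left_le)
    have "(\<integral>\<^sup>+t. ennreal ((1 / cmod (1 - A * cis t)) ^ 3) \<partial>circ)
       \<le> (\<integral>\<^sup>+t. ennreal (1 / (1 - cmod A)) * ennreal ((1 / cmod (1 - A * cis t))\<^sup>2) \<partial>circ)"
    proof (rule nn_integral_mono)
      fix t
      have "1 - cmod A \<le> cmod (1 - A * cis t)" using one_minus_cnj_mult_ge[of "cnj A" "cis t"] by simp
      then have "1 / cmod (1 - A * cis t) \<le> 1 / (1 - cmod A)" using A by (intro frac_le) auto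
      from mult_right_mono[OF this, of "(1 / cmod (1 - A * cis t))\<^sup>2"]
      show "ennreal ((1 / cmod (1 - A * cis t)) ^ 3) \<le> ennreal (1 / (1 - cmod A)) * ennreal ((1 / cmod (1 - A * cis t))\<^sup>2)"
        using A by (simp add: power3_eq_cube power2_eq_square ennreal_leI flip: ennreal_mult)
    qed
    also have "\<dots> = ennreal (1 / (1 - cmod A)) * ennreal (1 / (1 - (cmod A)\<^sup>2))"
      by (subst nn_integral_cmult, measurable, simp only: circle_kernel_2[OF A])
    also have "\<dots> \<le> ennreal (1 / (1 - cmod A)) * ennreal (1 / (1 - cmod A))"
    proof -
      have "(cmod A)\<^sup>2 \<le> cmod A" using A by (simp add: power2_eq_square mult_left_le_one_le)
      then have "1 / (1 - (cmod A)\<^sup>2) \<le> 1 / (1 - cmod A)" using A by (intro divide_left_mono mult_pos_pos) auto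
      then show ?thesis by (intro mult_left_mono ennreal_leI) auto
    qed
    also have "\<dots> = ennreal (1 / (1 - cmod b * s)\<^sup>2)"
      using A unfolding nA by (simp add: power2_eq_square flip: ennreal_mult)
    finally show "(\<integral>\<^sup>+t. ennreal ((1 / cmod (1 - cnj b * (of_real s * cis t))) ^ 3) \<partial>circ) \<le> ennreal (1 / (1 - cmod b * s)\<^sup>2)"
      by (simp add: A_def mult.assoc)
  qed
  also have "\<dots> \<le> ennreal ((1 - cmod b) powr (\<alpha> - 2) / \<alpha>)"
    by (rule radial_kernel_2) (use b \<alpha> in auto)
  finally show ?thesis .
qed

text \<open>\<open>circle_kernel_22\<close> is applied on every circle of radius s. Since its
  separation factor is comparable to |1 - cnj b a| uniformly in s, that factor leaves the integral,
  and \<open>radial_kernel_1\<close>, hence \<alpha> < 1, handles the rest.\<close>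

lemma area_kernel_22:
  assumes a: "cmod a < 1" and b: "cmod b < 1" and \<alpha>: "0 < \<alpha>" "\<alpha> < 1"
  shows "(\<integral>\<^sup>+t. \<integral>\<^sup>+s. ennreal ((1 / cmod (1 - cnj b * (of_real s * cis t)))\<^sup>2 * (1 / cmod (1 - cnj a * (of_real s * cis t)))\<^sup>2) \<partial>radial \<alpha> \<partial>circ)
    \<le> ennreal (8 * rad_const \<alpha> / (cmod (1 - cnj b * a))\<^sup>2 * ((1 - cmod b) powr (\<alpha> - 1) + (1 - cmod a) powr (\<alpha> - 1)))"
proof -
  define D where "D = cmod (1 - cnj b * a)"
  have ab: "cmod (cnj b * a) < 1" using a b by (simp add: norm_mult)
      (metis norm_ge_zero order_le_less_trans mult_left_le_one_le less_imp_le)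
  then have D: "D > 0" unfolding D_def by (auto simp: right_minus_eq)
  have K: "rad_const \<alpha> \<ge> 0" using \<alpha> by (simp add: rad_const_def)
  have "(\<integral>\<^sup>+t. \<integral>\<^sup>+s. ennreal ((1 / cmod (1 - cnj b * (of_real s * cis t)))\<^sup>2 * (1 / cmod (1 - cnj a * (of_real s * cis t)))\<^sup>2) \<partial>radial \<alpha> \<partial>circ)
      = (\<integral>\<^sup>+s. \<integral>\<^sup>+t. ennreal ((1 / cmod (1 - cnj b * (of_real s * cis t)))\<^sup>2 * (1 / cmod (1 - cnj a * (of_real s * cis t)))\<^sup>2) \<partial>circ \<partial>radial \<alpha>)"
    by (rule nn_integral_circ_radial_swap[OF _ \<alpha>(1)]) measurable
  also have "\<dots> \<le> (\<integral>\<^sup>+s. ennreal (8 / D\<^sup>2) * (ennreal (1 / (1 - cmod b * s)) + ennreal (1 / (1 - cmod a * s))) \<partial>radial \<alpha>)"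
  proof (rule nn_integral_mono_AE, rule eventually_mono[OF AE_radial])
    fix s :: real assume s: "0 \<le> s \<and> s < 1"
    define A B where "A = cnj b * of_real s" and "B = cnj a * of_real s"
    have nA: "cmod A = cmod b * s" and nB: "cmod B = cmod a * s" using s by (auto simp: A_def B_def norm_mult)
    have A: "cmod A < 1" and B: "cmod B < 1" unfolding nA nB using a b s
      by (metis norm_ge_zero less_imp_le order_le_less_trans mult_left_le)+
    have sq: "1 / (1 - x\<^sup>2) \<le> 1 / (1 - x)" "1 / (1 - x\<^sup>2) \<ge> 0" if "0 \<le> x" "x < 1" for x :: real
    proof -
      have "x\<^sup>2 \<le> x" using that by (simp add: power2_eq_square mult_left_le_one_le)
      then show "1 / (1 - x\<^sup>2) \<le> 1 / (1 - x)" "1 / (1 - x\<^sup>2) \<ge> 0" using that by (auto intro!: divide_left_mono mult_pos_pos)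
    qed
    \<comment> \<open>Replacing w by s^2 w moves 1 - w by at most 1 - s^2, which is itself at most
      |1 - s^2 w|. The factor 2 is squared below and turns the 2 of \<open>circle_kernel_22\<close>
      into 8.\<close>
    have DA: "D \<le> 2 * cmod (1 - A * cnj B)"
    proof -
      define w where "w = cnj b * a"
      have AB: "A * cnj B = of_real (s\<^sup>2) * w" by (simp add: A_def B_def w_def power2_eq_square)
      have s2: "0 \<le> s\<^sup>2" "s\<^sup>2 \<le> 1" using s by (auto simp: power_le_one)
      have "1 - w = (1 - of_real (s\<^sup>2) * w) - of_real (1 - s\<^sup>2) * w" by (simp add: algebra_simps)
      then have "D \<le> cmod (1 - of_real (s\<^sup>2) * w) + cmod (of_real (1 - s\<^sup>2) * w)"
        unfolding D_def w_def[symmetric] by (metis norm_triangle_ineq4)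
      also have "cmod (of_real (1 - s\<^sup>2) * w) \<le> 1 - s\<^sup>2"
        using ab s2 unfolding norm_mult norm_of_real w_def[symmetric] by (simp add: mult_left_le)
      also have "1 - s\<^sup>2 \<le> 1 - cmod (of_real (s\<^sup>2) * w)"
        using ab s2 unfolding norm_mult norm_of_real w_def[symmetric] by (simp add: mult_left_le)
      also have "\<dots> \<le> cmod (1 - of_real (s\<^sup>2) * w)"
        using norm_triangle_ineq2[of 1 "of_real (s\<^sup>2) * w"] by simp
      finally show ?thesis unfolding AB by simp
    qed
    have "(\<integral>\<^sup>+t. ennreal ((1 / cmod (1 - A * cis t))\<^sup>2 * (1 / cmod (1 - B * cis t))\<^sup>2) \<partial>circ)
      \<le> ennreal (2 / (cmod (1 - A * cnj B))\<^sup>2 * (1 / (1 - (cmod A)\<^sup>2) + 1 / (1 - (cmod B)\<^sup>2)))"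
      by (rule circle_kernel_22[OF A B])
    also have "\<dots> \<le> ennreal (8 / D\<^sup>2 * (1 / (1 - cmod A) + 1 / (1 - cmod B)))"
    proof (intro ennreal_leI mult_mono add_mono sq)
      have "D\<^sup>2 \<le> (2 * cmod (1 - A * cnj B))\<^sup>2" using DA D by (intro power_mono) auto
      then have "D\<^sup>2 \<le> 4 * (cmod (1 - A * cnj B))\<^sup>2" by (simp add: power_mult_distrib)
      moreover have "(cmod (1 - A * cnj B))\<^sup>2 > 0" using DA D by (intro zero_less_power) linarith
      ultimately show "2 / (cmod (1 - A * cnj B))\<^sup>2 \<le> 8 / D\<^sup>2" using D by (simp add: field_simps)
    qed (use A B sq(2)[of "cmod A"] sq(2)[of "cmod B"] in auto)
    also have "\<dots> = ennreal (8 / D\<^sup>2) * (ennreal (1 / (1 - cmod b * s)) + ennreal (1 / (1 - cmod a * s)))"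
      using A B unfolding nA nB by (simp flip: ennreal_plus ennreal_mult)
    finally show "(\<integral>\<^sup>+t. ennreal ((1 / cmod (1 - cnj b * (of_real s * cis t)))\<^sup>2 * (1 / cmod (1 - cnj a * (of_real s * cis t)))\<^sup>2) \<partial>circ)
      \<le> ennreal (8 / D\<^sup>2) * (ennreal (1 / (1 - cmod b * s)) + ennreal (1 / (1 - cmod a * s)))"
      by (simp add: A_def B_def mult.assoc)
  qed
  also have "\<dots> = ennreal (8 / D\<^sup>2) * ((\<integral>\<^sup>+s. ennreal (1 / (1 - cmod b * s)) \<partial>radial \<alpha>) + (\<integral>\<^sup>+s. ennreal (1 / (1 - cmod a * s)) \<partial>radial \<alpha>))"
    by (subst nn_integral_cmult, measurable, subst nn_integral_add, measurable)
  also have "\<dots> \<le> ennreal (8 / D\<^sup>2) * (ennreal (rad_const \<alpha> * (1 - cmod b) powr (\<alpha> - 1)) + ennreal (rad_const \<alpha> * (1 - cmod a) powr (\<alpha> - 1)))"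
    by (intro mult_left_mono add_mono radial_kernel_1) (use a b \<alpha> in auto)
  also have "\<dots> = ennreal (8 * rad_const \<alpha> / D\<^sup>2 * ((1 - cmod b) powr (\<alpha> - 1) + (1 - cmod a) powr (\<alpha> - 1)))"
    using K by (simp add: algebra_simps add_divide_distrib flip: ennreal_plus ennreal_mult)
  finally show ?thesis unfolding D_def .
qed

subsection \<open>Interpolating functions\<close>

text \<open>Only finite products occur, so the unimodular factor that makes infinite products
  converge is left out.\<close>

definition blaschke_factor :: "complex \<Rightarrow> complex \<Rightarrow> complex" where
  "blaschke_factor a z = (a - z) / (1 - cnj a * z)"

lemma cnj_mult_neq_1:
  assumes "cmod a < 1" "cmod z \<le> 1"
  shows "1 - cnj a * z \<noteq> 0"
proof -
  have "cmod a * cmod z \<le> cmod a" using assms by (simp add: mult_left_le)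
  then have "0 < cmod (1 - cnj a * z)" using one_minus_cnj_mult_ge[of a z] assms by linarith
  then show ?thesis by auto
qed

lemma norm_blaschke_factor_le_1:
  assumes "cmod a < 1" "cmod z \<le> 1"
  shows "cmod (blaschke_factor a z) \<le> 1"
proof -
  have "(cmod (1 - cnj a * z))\<^sup>2 - (cmod (a - z))\<^sup>2 = (1 - (cmod a)\<^sup>2) * (1 - (cmod z)\<^sup>2)"
    unfolding cmod_power2 by (simp add: power2_eq_square algebra_simps)
  moreover have "(1 - (cmod a)\<^sup>2) * (1 - (cmod z)\<^sup>2) \<ge> 0"
    using assms by (intro mult_nonneg_nonneg) (auto simp: power_le_one)
  ultimately have "(cmod (a - z))\<^sup>2 \<le> (cmod (1 - cnj a * z))\<^sup>2" by linarith
  then have "cmod (a - z) \<le> cmod (1 - cnj a * z)" by (rule power2_le_imp_le) simp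
  then show ?thesis by (simp add: blaschke_factor_def norm_divide divide_le_eq_1)
qed

lemma DERIV_blaschke_factor:
  assumes "1 - cnj a * z \<noteq> 0"
  shows "(blaschke_factor a has_field_derivative - of_real (1 - (cmod a)\<^sup>2) / (1 - cnj a * z)\<^sup>2) (at z)"
proof -
  have "(blaschke_factor a has_field_derivative ((- 1) * (1 - cnj a * z) - (a - z) * (- cnj a)) / ((1 - cnj a * z) * (1 - cnj a * z))) (at z)"
    unfolding blaschke_factor_def[abs_def] using assms by (auto intro!: derivative_eq_intros)
  moreover have "(- 1) * (1 - cnj a * z) - (a - z) * (- cnj a) = - of_real (1 - (cmod a)\<^sup>2)"
    using complex_norm_square[of a] by (simp add: algebra_simps)
  ultimately show ?thesis by (simp only: power2_eq_square[of "1 - cnj a * z"])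
qed

lemma ennreal_combination:
  assumes "c \<ge> 0" "x \<ge> 0" "\<And>k. k \<in> I \<Longrightarrow> q k \<ge> 0" "\<And>k. k \<in> I \<Longrightarrow> y k \<ge> 0"
  shows "ennreal c * (4 * ennreal x + (\<Sum>k\<in>I. ennreal (q k) * ennreal (y k))) = ennreal (c * (4 * x + (\<Sum>k\<in>I. q k * y k)))"
proof -
  have "(\<Sum>k\<in>I. ennreal (q k) * ennreal (y k)) = (\<Sum>k\<in>I. ennreal (q k * y k))"
    using assms by (intro sum.cong) (auto simp: ennreal_mult)
  also have "\<dots> = ennreal (\<Sum>k\<in>I. q k * y k)"
    using assms by (intro sum_ennreal) auto
  finally have 1: "(\<Sum>k\<in>I. ennreal (q k) * ennreal (y k)) = ennreal (\<Sum>k\<in>I. q k * y k)" .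
  have "(\<Sum>k\<in>I. q k * y k) \<ge> 0" using assms by (intro sum_nonneg) auto
  moreover have "4 * ennreal x = ennreal (4 * x)" using assms by (subst ennreal_mult) auto
  ultimately show ?thesis unfolding 1 using assms by (simp add: ennreal_mult ennreal_plus)
qed

text \<open>Stated over an arbitrary measure because it is applied twice: to the inner radial
  integral and then to the outer circle integral.\<close>

lemma nn_integral_combination:
  fixes C :: ennreal and X :: "'a \<Rightarrow> ennreal"
  assumes [measurable]: "X \<in> borel_measurable M" "\<And>k. Y k \<in> borel_measurable M"
  shows "(\<integral>\<^sup>+s. C * (4 * X s + (\<Sum>k\<in>I. Q k * Y k s)) \<partial>M)
    = C * (4 * (\<integral>\<^sup>+s. X s \<partial>M) + (\<Sum>k\<in>I. Q k * (\<integral>\<^sup>+s. Y k s \<partial>M)))"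
  by (simp add: nn_integral_cmult nn_integral_add nn_integral_sum)

text \<open>Later \<open>b\<close> is the node at which the value is prescribed, \<open>I\<close>
  indexes the other nodes, which become zeros, and \<open>c\<close> is the normalising
  constant.\<close>

locale interp_function =
  fixes a :: "nat \<Rightarrow> complex" and I :: "nat set" and b c :: complex
  assumes fin: "finite I" and a: "\<And>k. cmod (a k) < 1" and b: "cmod b < 1"
begin

definition "\<beta> z = (\<Prod>k\<in>I. blaschke_factor (a k) z)"
definition "u w z = 1 / cmod (1 - cnj w * z)" for w z :: complex
text \<open>The square keeps the norm under control: the circle mean of |1 - cnj b z|^(-2) is 1 / (1
  - |b|^2), whereas that of the first power grows logarithmically, too fast for its value 1 / (1 -
  |b|^2) at \<open>b\<close> when \<alpha> = 1.\<close>

definition "f z = c * \<beta> z / (1 - cnj b * z)\<^sup>2"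

lemma norm_\<beta>_le_1: "cmod z \<le> 1 \<Longrightarrow> cmod (\<beta> z) \<le> 1"
  unfolding \<beta>_def prod_norm[symmetric] by (rule prod_le_1) (auto intro: norm_blaschke_factor_le_1 a)

lemma DERIV_f:
  assumes "1 - cnj b * z \<noteq> 0" "\<And>k. k \<in> I \<Longrightarrow> 1 - cnj (a k) * z \<noteq> 0"
  shows "(f has_field_derivative
    c * ((\<Sum>i\<in>I. (- of_real (1 - (cmod (a i))\<^sup>2) / (1 - cnj (a i) * z)\<^sup>2) * (\<Prod>j\<in>I - {i}. blaschke_factor (a j) z)) / (1 - cnj b * z)\<^sup>2
       + \<beta> z * (2 * cnj b / (1 - cnj b * z) ^ 3))) (at z)"
proof -
  have 1: "((\<lambda>z. \<Prod>k\<in>I. blaschke_factor (a k) z) has_field_derivative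
     (\<Sum>i\<in>I. (- of_real (1 - (cmod (a i))\<^sup>2) / (1 - cnj (a i) * z)\<^sup>2) * (\<Prod>j\<in>I - {i}. blaschke_factor (a j) z))) (at z)"
    by (rule has_field_derivative_prod, rule DERIV_blaschke_factor, rule assms(2))
  have 2: "((\<lambda>z. 1 / (1 - cnj b * z)\<^sup>2) has_field_derivative 2 * cnj b / (1 - cnj b * z) ^ 3) (at z)"
    using assms(1) by (auto intro!: derivative_eq_intros simp: power2_eq_square power3_eq_cube)
  have "f = (\<lambda>z. c * ((\<Prod>k\<in>I. blaschke_factor (a k) z) * (1 / (1 - cnj b * z)\<^sup>2)))"
    by (simp add: fun_eq_iff f_def \<beta>_def)
  then show ?thesis using DERIV_cmult[OF DERIV_mult[OF 1 2], of c] by (simp add: \<beta>_def algebra_simps)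
qed

lemma holomorphic_f: obtains R where "R > 1" "f holomorphic_on ball 0 R"
proof -
  define m where "m = Max (insert (cmod b) ((\<lambda>k. cmod (a k)) ` I))"
  have "m \<in> insert (cmod b) ((\<lambda>k. cmod (a k)) ` I)" unfolding m_def using fin by (intro Max_in) auto
  then have m1: "m < 1" using a b by auto
  have bm: "cmod b \<le> m" and am: "\<And>k. k \<in> I \<Longrightarrow> cmod (a k) \<le> m"
    unfolding m_def using fin by (auto intro: Max_ge)
  have m0: "m \<ge> 0" using bm norm_ge_zero[of b] by linarith
  \<comment> \<open>Any R > 1 with m R < 1 keeps all poles outside; 2 / (1 + m) is such a number,
    also for m = 0.\<close>
  define R where "R = 2 / (1 + m)"
  have nz: "1 - cnj w * z \<noteq> 0" if "cmod w \<le> m" "cmod z < R" for w z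
  proof -
    have "cmod w * cmod z \<le> m * R" using that m0 by (intro mult_mono) auto
    also have "m * R < 1" using m0 m1 by (simp add: R_def field_simps)
    finally have "0 < cmod (1 - cnj w * z)" using one_minus_cnj_mult_ge[of w z] by linarith
    then show ?thesis by auto
  qed
  show ?thesis
  proof (rule that[of R])
    show "R > 1" using m0 m1 by (simp add: R_def field_simps)
    show "f holomorphic_on ball 0 R"
      unfolding holomorphic_on_open[OF open_ball]
      using nz bm am by (auto intro!: exI DERIV_f)
  qed
qed

lemma norm_f_le: "cmod z \<le> 1 \<Longrightarrow> cmod (f z) \<le> cmod c * (u b z)\<^sup>2"
  using norm_\<beta>_le_1[of z]
  by (auto simp: f_def u_def norm_mult norm_divide norm_power power_divide mult_left_le intro!: divide_right_mono)

text \<open>By the product rule each Blaschke derivative contributes (1 - |a_k|^2) u_k^2, the other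
  factors being at most 1. Of the coefficient 4, one 2 comes from differentiating the squared kernel
  and the other from absorbing \<alpha> f, which is possible because u \<ge> 1/2 turns u^2 into at
  most 2 u^3.\<close>

lemma norm_euler_f_le:
  assumes z: "cmod z \<le> 1" and \<alpha>: "0 < \<alpha>" "\<alpha> \<le> 1"
  shows "cmod (of_real \<alpha> * f z + z * deriv f z) \<le>
    cmod c * (4 * u b z ^ 3 + (\<Sum>k\<in>I. (1 - (cmod (a k))\<^sup>2) * ((u b z)\<^sup>2 * (u (a k) z)\<^sup>2)))"
proof -
  define S where "S = (\<Sum>i\<in>I. (- of_real (1 - (cmod (a i))\<^sup>2) / (1 - cnj (a i) * z)\<^sup>2) * (\<Prod>j\<in>I - {i}. blaschke_factor (a j) z))"
  have "deriv f z = c * (S / (1 - cnj b * z)\<^sup>2 + \<beta> z * (2 * cnj b / (1 - cnj b * z) ^ 3))"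
    unfolding S_def by (rule DERIV_imp_deriv[OF DERIV_f]) (use a b z cnj_mult_neq_1 in auto)
  then have "cmod (deriv f z) \<le> cmod c * (cmod (S / (1 - cnj b * z)\<^sup>2) + cmod (\<beta> z * (2 * cnj b / (1 - cnj b * z) ^ 3)))"
    unfolding norm_mult[of c, symmetric] by (simp only: norm_mult[of c] mult_left_mono[OF norm_triangle_ineq norm_ge_zero])
  also have "cmod (S / (1 - cnj b * z)\<^sup>2) = cmod S * (u b z)\<^sup>2"
    by (simp add: norm_divide norm_power u_def power_divide)
  also have "cmod (\<beta> z * (2 * cnj b / (1 - cnj b * z) ^ 3)) \<le> 2 * u b z ^ 3"
  proof -
    have "cmod (\<beta> z) * cmod b \<le> 1" using norm_\<beta>_le_1[OF z] b by (simp add: mult_le_one)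
    then have "cmod (\<beta> z) * cmod b * (2 * u b z ^ 3) \<le> 1 * (2 * u b z ^ 3)"
      by (intro mult_right_mono) (auto simp: u_def)
    then show ?thesis by (simp add: norm_mult norm_divide norm_power u_def power_divide mult_ac)
  qed
  also have "cmod S \<le> (\<Sum>k\<in>I. (1 - (cmod (a k))\<^sup>2) * (u (a k) z)\<^sup>2)"
    unfolding S_def
  proof (rule sum_norm_le)
    fix k
    have q: "1 - (cmod (a k))\<^sup>2 \<ge> 0" using a[of k] by (simp add: power_le_one)
    have "cmod (\<Prod>j\<in>I - {k}. blaschke_factor (a j) z) \<le> 1"
      unfolding prod_norm[symmetric] by (rule prod_le_1) (auto intro: norm_blaschke_factor_le_1 a z)
    moreover have "cmod (- of_real (1 - (cmod (a k))\<^sup>2) / (1 - cnj (a k) * z)\<^sup>2) = (1 - (cmod (a k))\<^sup>2) * (u (a k) z)\<^sup>2"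
      using q unfolding norm_divide norm_minus_cancel norm_of_real norm_power u_def by (simp add: power_divide)
    ultimately show "cmod ((- of_real (1 - (cmod (a k))\<^sup>2) / (1 - cnj (a k) * z)\<^sup>2) * (\<Prod>j\<in>I - {k}. blaschke_factor (a j) z))
        \<le> (1 - (cmod (a k))\<^sup>2) * (u (a k) z)\<^sup>2"
      using q by (simp only: norm_mult) (simp add: mult_left_le)
  qed
  finally have D: "cmod (deriv f z) \<le> cmod c * ((\<Sum>k\<in>I. (1 - (cmod (a k))\<^sup>2) * (u (a k) z)\<^sup>2) * (u b z)\<^sup>2 + 2 * u b z ^ 3)"
    by (simp add: mult_left_mono mult_right_mono)
  have ub: "1 / 2 \<le> u b z"
  proof -
    have "cmod (1 - cnj b * z) \<le> 1 + cmod b * cmod z" using norm_triangle_ineq4[of 1 "cnj b * z"] by (simp add: norm_mult)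
    also have "cmod b * cmod z \<le> 1" using b z by (simp add: mult_le_one)
    finally have "cmod (1 - cnj b * z) \<le> 2" by simp
    then show ?thesis using cnj_mult_neq_1[OF b z] by (simp add: u_def field_simps)
  qed
  have "1 * (u b z)\<^sup>2 \<le> (2 * u b z) * (u b z)\<^sup>2" by (rule mult_right_mono) (use ub in auto)
  then have "(u b z)\<^sup>2 \<le> 2 * u b z ^ 3" by (simp add: power3_eq_cube power2_eq_square mult.assoc)
  then have "cmod (f z) \<le> cmod c * (2 * u b z ^ 3)"
    by (rule order_trans[OF norm_f_le[OF z] mult_left_mono]) simp
  moreover have "\<alpha> * cmod (f z) \<le> cmod (f z)" using \<alpha> by (simp add: mult_left_le_one_le)
  ultimately have "\<alpha> * cmod (f z) \<le> cmod c * (2 * u b z ^ 3)" by linarith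
  moreover have "cmod z * cmod (deriv f z) \<le> cmod (deriv f z)" using z by (simp add: mult_left_le_one_le)
  moreover have "cmod (of_real \<alpha> * f z + z * deriv f z) \<le> \<alpha> * cmod (f z) + cmod z * cmod (deriv f z)"
    using norm_triangle_ineq[of "of_real \<alpha> * f z" "z * deriv f z"] \<alpha> by (simp add: norm_mult)
  ultimately have "cmod (of_real \<alpha> * f z + z * deriv f z) \<le> cmod c * (2 * u b z ^ 3) + cmod c * ((\<Sum>k\<in>I. (1 - (cmod (a k))\<^sup>2) * (u (a k) z)\<^sup>2) * (u b z)\<^sup>2 + 2 * u b z ^ 3)"
    using D by linarith
  also have "\<dots> = cmod c * (4 * u b z ^ 3 + (\<Sum>k\<in>I. (1 - (cmod (a k))\<^sup>2) * ((u b z)\<^sup>2 * (u (a k) z)\<^sup>2)))"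
  proof -
    have "(\<Sum>k\<in>I. (1 - (cmod (a k))\<^sup>2) * (u (a k) z)\<^sup>2) * (u b z)\<^sup>2 = (\<Sum>k\<in>I. (1 - (cmod (a k))\<^sup>2) * ((u b z)\<^sup>2 * (u (a k) z)\<^sup>2))"
      by (simp add: sum_distrib_right sum_distrib_left mult_ac)
    then show ?thesis by (simp add: distrib_left)
  qed
  finally show ?thesis .
qed

lemma measurable_u [measurable]: "(\<lambda>p. u w (F p)) \<in> borel_measurable M" if "F \<in> borel_measurable M"
  using that unfolding u_def by measurable

lemma nn_integral_euler_f_le:
  assumes \<alpha>: "0 < \<alpha>" "\<alpha> < 1"
  shows "(\<integral>\<^sup>+t. \<integral>\<^sup>+s. ennreal (cmod (of_real \<alpha> * f (of_real s * cis t) + of_real s * cis t * deriv f (of_real s * cis t))) \<partial>radial \<alpha> \<partial>circ)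
   \<le> ennreal (cmod c * (4 * ((1 - cmod b) powr (\<alpha> - 2) / \<alpha>) + (\<Sum>k\<in>I. (1 - (cmod (a k))\<^sup>2) *
       (8 * rad_const \<alpha> / (cmod (1 - cnj b * a k))\<^sup>2 * ((1 - cmod b) powr (\<alpha> - 1) + (1 - cmod (a k)) powr (\<alpha> - 1))))))"
proof -
  interpret V: finite_measure "radial \<alpha>" by (rule finite_measure_radial[OF \<alpha>(1)])
  have q: "1 - (cmod (a k))\<^sup>2 \<ge> 0" for k using a[of k] by (simp add: power_le_one)
  have K: "rad_const \<alpha> \<ge> 0" using \<alpha> by (simp add: rad_const_def)
  have u0: "u w z \<ge> 0" for w z by (simp add: u_def)
  have "(\<integral>\<^sup>+t. \<integral>\<^sup>+s. ennreal (cmod (of_real \<alpha> * f (of_real s * cis t) + of_real s * cis t * deriv f (of_real s * cis t))) \<partial>radial \<alpha> \<partial>circ)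
    \<le> (\<integral>\<^sup>+t. \<integral>\<^sup>+s. ennreal (cmod c) * (4 * ennreal (u b (of_real s * cis t) ^ 3) + (\<Sum>k\<in>I. ennreal (1 - (cmod (a k))\<^sup>2) *
         ennreal ((u b (of_real s * cis t))\<^sup>2 * (u (a k) (of_real s * cis t))\<^sup>2))) \<partial>radial \<alpha> \<partial>circ)"
  proof (intro nn_integral_mono nn_integral_mono_AE, rule eventually_mono[OF AE_radial])
    fix t s :: real assume "0 \<le> s \<and> s < 1"
    then have "cmod (of_real s * cis t) \<le> 1" by (simp add: norm_mult)
    from norm_euler_f_le[OF this, of \<alpha>] \<alpha> show "ennreal (cmod (of_real \<alpha> * f (of_real s * cis t) + of_real s * cis t * deriv f (of_real s * cis t)))
      \<le> ennreal (cmod c) * (4 * ennreal (u b (of_real s * cis t) ^ 3) + (\<Sum>k\<in>I. ennreal (1 - (cmod (a k))\<^sup>2) *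
         ennreal ((u b (of_real s * cis t))\<^sup>2 * (u (a k) (of_real s * cis t))\<^sup>2)))"
      using q u0 by (subst ennreal_combination) (auto intro: ennreal_leI)
  qed
  also have "\<dots> = ennreal (cmod c) * (4 * (\<integral>\<^sup>+t. \<integral>\<^sup>+s. ennreal (u b (of_real s * cis t) ^ 3) \<partial>radial \<alpha> \<partial>circ)
      + (\<Sum>k\<in>I. ennreal (1 - (cmod (a k))\<^sup>2) * (\<integral>\<^sup>+t. \<integral>\<^sup>+s. ennreal ((u b (of_real s * cis t))\<^sup>2 * (u (a k) (of_real s * cis t))\<^sup>2) \<partial>radial \<alpha> \<partial>circ)))"
  proof -
    have m [measurable]: "(\<lambda>p. of_real (snd p) * cis (fst p)) \<in> borel_measurable (circ \<Otimes>\<^sub>M radial \<alpha>)"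
      by measurable
    have m1: "(\<lambda>s. ennreal (u b (of_real s * cis t) ^ 3)) \<in> borel_measurable (radial \<alpha>)" for t
      by measurable
    have m2: "(\<lambda>s. ennreal ((u b (of_real s * cis t))\<^sup>2 * (u (a k) (of_real s * cis t))\<^sup>2)) \<in> borel_measurable (radial \<alpha>)" for t k
      by measurable
    have "(\<lambda>p. ennreal (u b (of_real (snd p) * cis (fst p)) ^ 3)) \<in> borel_measurable (circ \<Otimes>\<^sub>M radial \<alpha>)"
      by measurable
    \<comment> \<open>Measurability of the inner integral in the angle comes from joint
      measurability on the product.\<close>
    from V.borel_measurable_nn_integral_fst[OF this]
    have m3: "(\<lambda>t. \<integral>\<^sup>+s. ennreal (u b (of_real s * cis t) ^ 3) \<partial>radial \<alpha>) \<in> borel_measurable circ" by simp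
    have "(\<lambda>p. ennreal ((u b (of_real (snd p) * cis (fst p)))\<^sup>2 * (u (a k) (of_real (snd p) * cis (fst p)))\<^sup>2)) \<in> borel_measurable (circ \<Otimes>\<^sub>M radial \<alpha>)" for k
      by measurable
    from V.borel_measurable_nn_integral_fst[OF this]
    have m4: "(\<lambda>t. \<integral>\<^sup>+s. ennreal ((u b (of_real s * cis t))\<^sup>2 * (u (a k) (of_real s * cis t))\<^sup>2) \<partial>radial \<alpha>) \<in> borel_measurable circ" for k by simp
    show ?thesis
      unfolding nn_integral_combination[OF m1 m2] by (rule nn_integral_combination[OF m3 m4])
  qed
  also have "\<dots> \<le> ennreal (cmod c) * (4 * ennreal ((1 - cmod b) powr (\<alpha> - 2) / \<alpha>)
      + (\<Sum>k\<in>I. ennreal (1 - (cmod (a k))\<^sup>2) * ennreal (8 * rad_const \<alpha> / (cmod (1 - cnj b * a k))\<^sup>2 * ((1 - cmod b) powr (\<alpha> - 1) + (1 - cmod (a k)) powr (\<alpha> - 1)))))"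
    unfolding u_def
    by (intro mult_left_mono add_mono sum_mono area_kernel_3 area_kernel_22) (use a b \<alpha> in auto)
  also have "\<dots> = ennreal (cmod c * (4 * ((1 - cmod b) powr (\<alpha> - 2) / \<alpha>) + (\<Sum>k\<in>I. (1 - (cmod (a k))\<^sup>2) *
       (8 * rad_const \<alpha> / (cmod (1 - cnj b * a k))\<^sup>2 * ((1 - cmod b) powr (\<alpha> - 1) + (1 - cmod (a k)) powr (\<alpha> - 1))))))"
    using q K \<alpha> by (intro ennreal_combination) auto
  finally show ?thesis .
qed

end

text \<open>For \<alpha> = 1 every \<open>binom_coeff\<close> equals 1, so the multiplier is the
  identity and the boundary values serve as density, which is Cauchy's formula.\<close>

lemma cauchy_density:
  fixes f :: "complex \<Rightarrow> complex"
  assumes f: "f holomorphic_on ball 0 R" and R: "R > 1"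
  obtains B where "(\<lambda>t. f (cis t)) \<in> borel_measurable borel" "\<And>t. cmod (f (cis t)) \<le> B"
    "\<And>z. cmod z < 1 \<Longrightarrow> (LINT t|circ. f (cis t) * (1 / (1 - cnj (cis t) * z) powr of_real 1)) = f z"
proof -
  define d where "d n = (deriv ^^ n) f 0 / fact n" for n
  have d: "(\<lambda>n. d n * w ^ n) sums f w" if "cmod w < R" for w
    using holomorphic_power_series[OF f, of w] that by (simp add: d_def)
  obtain \<rho> where \<rho>: "1 < \<rho>" "\<rho> < R" using dense R by blast
  have "summable (\<lambda>n. d n * of_real \<rho> ^ n)" using d[of "of_real \<rho>"] \<rho> by (simp add: sums_iff)
  from powser_insidea[OF this, of 1] \<rho> have s: "summable (\<lambda>n. cmod (d n))" by simp
  have nd: "cmod (d j * cis t ^ j) = cmod (d j)" for j t by (simp add: norm_mult norm_power)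
  have eq: "f (cis t) = (\<Sum>n. d n * cis t ^ n)" for t
    using d[of "cis t"] R by (simp add: sums_iff)
  show ?thesis
  proof (rule that)
    show "(\<lambda>t. f (cis t)) \<in> borel_measurable borel" unfolding eq by measurable
    show "cmod (f (cis t)) \<le> (\<Sum>n. cmod (d n))" for t
      unfolding eq by (rule order_trans[OF summable_norm]) (simp_all only: nd s order_refl)
    fix z :: complex assume z: "cmod z < 1"
    have "binom_coeff 1 n = 1" for n by (simp add: binom_coeff_def flip: pochhammer_fact)
    then have "(\<lambda>n. d n * z ^ n) sums (LINT t|circ. f (cis t) * (1 / (1 - cnj (cis t) * z) powr of_real 1))"
      using frac_cauchy_power_series[OF s z, of 1] unfolding eq by simp
    then show "(LINT t|circ. f (cis t) * (1 / (1 - cnj (cis t) * z) powr of_real 1)) = f z"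
      using d[of z] z R sums_unique2 by fastforce
  qed
qed

context interp_function
begin

text \<open>|\<beta>| \<le> 1 leaves only the squared kernel, whose mean is the Poisson
  integral.\<close>

lemma norm_density_1_le:
  "(\<integral>\<^sup>+t. ennreal (cmod (f (cis t))) \<partial>circ) \<le> ennreal (cmod c / (1 - (cmod b)\<^sup>2))"
proof -
  have "(\<integral>\<^sup>+t. ennreal (cmod (f (cis t))) \<partial>circ) \<le> (\<integral>\<^sup>+t. ennreal (cmod c) * ennreal ((u b (cis t))\<^sup>2) \<partial>circ)"
    by (intro nn_integral_mono) (simp add: norm_f_le ennreal_leI flip: ennreal_mult)
  also have "\<dots> = ennreal (cmod c) * (\<integral>\<^sup>+t. ennreal ((u b (cis t))\<^sup>2) \<partial>circ)"
    by (rule nn_integral_cmult) measurable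
  also have "\<dots> = ennreal (cmod c) * ennreal (1 / (1 - (cmod b)\<^sup>2))"
    using circle_kernel_2[of "cnj b"] b by (simp add: u_def)
  also have "\<dots> = ennreal (cmod c / (1 - (cmod b)\<^sup>2))"
    using b by (simp add: abs_square_less_1 less_imp_le flip: ennreal_mult)
  finally show ?thesis .
qed

end

text \<open>The area integral of the previous bound, weighted by \<open>(1 - |b|\<^sup>2) powr (2 - \<alpha>)\<close>, is
  controlled by the sum defining \<open>\<sigma>\<^sub>\<alpha>\<close> at the radial projection \<open>\<xi>\<close> of \<open>b\<close>.\<close>

lemma interp_weight_le:
  assumes a: "cmod a < 1" and b: "cmod b < 1" and \<xi>: "cmod \<xi> = 1" "b = of_real (cmod b) * \<xi>"
    and \<alpha>: "0 < \<alpha>" "\<alpha> < 1"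
  shows "(1 - (cmod b)\<^sup>2) powr (2 - \<alpha>) * ((1 - (cmod a)\<^sup>2) *
       (8 * rad_const \<alpha> / (cmod (1 - cnj b * a))\<^sup>2 * ((1 - cmod b) powr (\<alpha> - 1) + (1 - cmod a) powr (\<alpha> - 1))))
    \<le> 256 * rad_const \<alpha> * ((1 - (cmod a)\<^sup>2) / cmod (1 - cnj \<xi> * a)) powr \<alpha>"
proof -
  define p q D where "p = 1 - (cmod b)\<^sup>2" and "q = 1 - (cmod a)\<^sup>2" and "D = cmod (1 - cnj b * a)"
  define K where "K = rad_const \<alpha>"
  have K: "K \<ge> 0" using \<alpha> by (simp add: K_def rad_const_def)
  have two: "1 - x\<^sup>2 \<le> 2 * (1 - x)" for x :: real using zero_le_power2[of "1 - x"] by (simp add: power2_eq_square algebra_simps)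
  have pq: "p > 0" "q > 0" using a b by (auto simp: p_def q_def abs_square_less_1)
  have D0: "D > 0" using cnj_mult_neq_1[OF b, of a] a by (simp add: D_def)
  have "1 - cmod b \<le> D" "1 - cmod a \<le> D"
    using one_minus_cnj_mult_ge[of b a] a b mult_left_le[of "cmod a" "cmod b"] mult_left_le_one_le[of "cmod a" "cmod b"]
    by (auto simp: D_def)
  then have pD: "p \<le> 2 * D" and qD: "q \<le> 2 * D"
    using two[of "cmod b"] two[of "cmod a"] by (auto simp: p_def q_def)
  \<comment> \<open>The exponent \<alpha> - 1 is not positive, so passing from 1 - x to 1 - x^2
    \<le> 2 (1 - x) costs a factor 2^(1 - \<alpha>) \<le> 2.\<close>
  have halve: "(1 - x) powr (\<alpha> - 1) \<le> 2 * (1 - x\<^sup>2) powr (\<alpha> - 1)" if "0 \<le> x" "x < 1" for x :: real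
  proof -
    have x2: "1 - x\<^sup>2 > 0" using that by (simp add: abs_square_less_1)
    have "(1 - x) powr (\<alpha> - 1) \<le> ((1 - x\<^sup>2) / 2) powr (\<alpha> - 1)"
      using x2 two[of x] \<alpha> by (intro powr_mono2') auto
    also have "\<dots> = 2 powr (1 - \<alpha>) * (1 - x\<^sup>2) powr (\<alpha> - 1)"
      using x2 by (simp add: powr_divide powr_diff)
    also have "2 powr (1 - \<alpha>) \<le> (2 :: real) powr 1" using \<alpha> by (intro powr_mono) auto
    finally show ?thesis using x2 by (simp add: mult_right_mono)
  qed
  \<comment> \<open>The expression is homogeneous of degree 0 in p, q, D, so it depends only on
    these two ratios. Both lie in (0, 2], and surplus powers of them can be replaced by constants,
    keeping just y^\<alpha>.\<close>
  define x y where "x = p / D" and "y = q / D"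
  have x: "0 < x" "x \<le> 2" and y: "0 < y" "y \<le> 2" using pq D0 pD qD by (auto simp: x_def y_def field_simps)
  have t1: "x * y \<le> 4 * y powr \<alpha>"
  proof -
    have "y powr (1 - \<alpha>) \<le> 2 powr (1 - \<alpha>)" using y \<alpha> by (intro powr_mono2) auto
    also have "2 powr (1 - \<alpha>) \<le> (2 :: real) powr 1" using \<alpha> by (intro powr_mono) auto
    finally have "y powr (1 - \<alpha>) * y powr \<alpha> \<le> 2 * y powr \<alpha>" by (intro mult_right_mono) auto
    moreover have "y powr (1 - \<alpha>) * y powr \<alpha> = y" using y by (simp flip: powr_add)
    ultimately have "y \<le> 2 * y powr \<alpha>" by simp
    from mult_mono[OF x(2) this] x y show ?thesis by simp
  qed
  have t2: "x powr (2 - \<alpha>) * y powr \<alpha> \<le> 4 * y powr \<alpha>"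
  proof -
    have "x powr (2 - \<alpha>) \<le> 2 powr (2 - \<alpha>)" using x \<alpha> by (intro powr_mono2) auto
    also have "\<dots> \<le> (2 :: real) powr 2" using \<alpha> by (intro powr_mono) auto
    finally show ?thesis by (intro mult_right_mono) auto
  qed
  have "p powr (2 - \<alpha>) * (q * (8 * K / D\<^sup>2 * ((1 - cmod b) powr (\<alpha> - 1) + (1 - cmod a) powr (\<alpha> - 1))))
    \<le> p powr (2 - \<alpha>) * (q * (8 * K / D\<^sup>2 * (2 * p powr (\<alpha> - 1) + 2 * q powr (\<alpha> - 1))))"
    using halve[of "cmod a"] halve[of "cmod b"] a b K pq unfolding p_def[symmetric] q_def[symmetric]
    by (intro mult_left_mono add_mono) auto
  also have "\<dots> = 16 * K * (x * y + x powr (2 - \<alpha>) * y powr \<alpha>)"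
  proof -
    have "p powr (2 - \<alpha>) * p powr (\<alpha> - 1) = p" using pq by (simp flip: powr_add)
    then have e1: "p powr (2 - \<alpha>) * q / D\<^sup>2 * p powr (\<alpha> - 1) = x * y"
      by (simp add: x_def y_def power2_eq_square mult_ac)
    have "q * q powr (\<alpha> - 1) = q powr \<alpha>" using pq by (simp add: powr_diff)
    moreover have "D powr (2 - \<alpha>) * D powr \<alpha> = D\<^sup>2" using D0 by (simp flip: powr_add)
    ultimately have e2: "p powr (2 - \<alpha>) * q / D\<^sup>2 * q powr (\<alpha> - 1) = x powr (2 - \<alpha>) * y powr \<alpha>"
      using pq D0 by (simp add: x_def y_def powr_divide mult_ac)
    have "p powr (2 - \<alpha>) * (q * (8 * K / D\<^sup>2 * (2 * p powr (\<alpha> - 1) + 2 * q powr (\<alpha> - 1))))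
      = 16 * K * (p powr (2 - \<alpha>) * q / D\<^sup>2 * p powr (\<alpha> - 1) + p powr (2 - \<alpha>) * q / D\<^sup>2 * q powr (\<alpha> - 1))"
      using D0 by (simp add: field_simps)
    then show ?thesis unfolding e1 e2 .
  qed
  also have "\<dots> \<le> 16 * K * (8 * y powr \<alpha>)"
    using t1 t2 K by (intro mult_left_mono) auto
  \<comment> \<open>Moving b out to \<xi> on the circle changes 1 - cnj b a by at most 1 - |b| \<le>
    D, so the two denominators are comparable. The factor 2 completes 256 = 16 * 8 * 2.\<close>
  also have "y powr \<alpha> \<le> 2 * (q / cmod (1 - cnj \<xi> * a)) powr \<alpha>"
  proof -
    define E where "E = cmod (1 - cnj \<xi> * a)"
    have E0: "E > 0"
      unfolding E_def by (rule less_le_trans[OF _ one_minus_cnj_mult_ge]) (use \<xi>(1) a in simp)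
    have "cnj b = of_real (cmod b) * cnj \<xi>" using arg_cong[OF \<xi>(2), of cnj] by simp
    then have "1 - cnj \<xi> * a = (1 - cnj b * a) - of_real (1 - cmod b) * (cnj \<xi> * a)" by (simp add: algebra_simps)
    then have "E \<le> D + cmod (of_real (1 - cmod b) * (cnj \<xi> * a))"
      unfolding E_def D_def by (metis norm_triangle_ineq4)
    also have "cmod (of_real (1 - cmod b) * (cnj \<xi> * a)) \<le> 1 - cmod b"
      using \<xi>(1) a b unfolding norm_mult norm_of_real by (simp add: mult_left_le)
    finally have "E \<le> 2 * D" using \<open>1 - cmod b \<le> D\<close> by simp
    then have "y \<le> 2 * (q / E)" using D0 E0 pq by (simp add: y_def field_simps)
    then have "y powr \<alpha> \<le> (2 * (q / E)) powr \<alpha>" using y \<alpha> by (intro powr_mono2) auto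
    also have "\<dots> = 2 powr \<alpha> * (q / E) powr \<alpha>" by (rule powr_mult)
    also have "2 powr \<alpha> \<le> (2 :: real) powr 1" using \<alpha> by (intro powr_mono) auto
    finally show ?thesis unfolding E_def by (simp add: mult_right_mono)
  qed
  finally show ?thesis using K unfolding p_def q_def D_def K_def by (simp add: mult_left_mono)
qed

lemma radial_projection:
  obtains \<xi> where "cmod \<xi> = 1" "b = of_real (cmod b) * \<xi>"
proof (cases "b = 0")
  case False
  then have "cmod (sgn b) = 1" by (simp add: norm_sgn)
  moreover have "b = of_real (cmod b) * sgn b" using False by (simp add: sgn_eq)
  ultimately show ?thesis by (rule that)
qed (rule that[of 1], auto)

text \<open>The hypotheses are finite versions of the conditions on \<delta> and \<sigma>: partial
  products and finite sums are all that a finite Blaschke product sees. The densities are bounded so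
  that their products with continuous kernels are integrable.\<close>

lemma interpolation_density:
  fixes a :: "nat \<Rightarrow> complex"
  assumes \<alpha>: "0 < \<alpha>" "\<alpha> \<le> 1" and a: "\<And>k. cmod (a k) < 1" and \<delta>: "\<delta> > 0"
    and sep: "\<And>n N. \<delta> \<le> (\<Prod>k\<in>{..<N} - {n}. cmod ((a k - a n) / (1 - cnj (a k) * a n)))"
    and S: "\<And>\<xi> J. cmod \<xi> = 1 \<Longrightarrow> finite J \<Longrightarrow> (\<Sum>k\<in>J. ((1 - (cmod (a k))\<^sup>2) / cmod (1 - cnj \<xi> * a k)) powr \<alpha>) \<le> S"
    and n: "n < N"
  obtains \<phi> B where "\<phi> \<in> borel_measurable borel" "\<And>t. cmod (\<phi> t) \<le> B"
    "(\<integral>\<^sup>+t. ennreal (cmod (\<phi> t)) \<partial>circ) \<le> ennreal ((16 / \<alpha> + 256 * \<bar>rad_const \<alpha> * S\<bar>) / \<delta>)"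
    "\<And>k. k < N \<Longrightarrow> (LINT t|circ. \<phi> t * (1 / (1 - cnj (cis t) * a k) powr of_real \<alpha>))
        * of_real ((1 - (cmod (a k))\<^sup>2) powr \<alpha>) = of_bool (k = n)"
proof -
  define I where "I = {..<N} - {n}"
  define q where "q k = 1 - (cmod (a k))\<^sup>2" for k
  have q: "q k > 0" for k using a[of k] by (simp add: q_def abs_square_less_1)
  define \<beta>n where "\<beta>n = (\<Prod>k\<in>I. blaschke_factor (a k) (a n))"
  \<comment> \<open>f(a_n) = c \<beta>(a_n) / q_n^2, so this choice gives the value
    q_n^(-\<alpha>).\<close>
  define c where "c = of_real (q n powr (2 - \<alpha>)) / \<beta>n"
  interpret interp_function a I "a n" c
    by unfold_locales (auto simp: I_def a)
  have \<beta>n: "\<beta> (a n) = \<beta>n" by (simp add: \<beta>_def \<beta>n_def)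
  have \<beta>ge: "\<delta> \<le> cmod \<beta>n"
    using sep[of n N] by (simp add: \<beta>n_def I_def blaschke_factor_def flip: prod_norm)
  then have \<beta>0: "\<beta>n \<noteq> 0" using \<delta> by auto
  have cle: "cmod c \<le> q n powr (2 - \<alpha>) / \<delta>"
    using \<beta>ge \<delta> by (simp add: c_def norm_divide frac_le)
  obtain R where R: "R > 1" "f holomorphic_on ball 0 R" by (rule holomorphic_f)
  have fk: "f (a k) * of_real ((1 - (cmod (a k))\<^sup>2) powr \<alpha>) = of_bool (k = n)" if "k < N" for k
  proof (cases "k = n")
    case False
    then have "k \<in> I" using that by (simp add: I_def)
    then have "\<beta> (a k) = 0" using fin by (auto simp: \<beta>_def blaschke_factor_def prod_zero_iff)
    then show ?thesis using False by (simp add: f_def)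
  next
    case True
    have "1 - cnj (a n) * a n = of_real (q n)" using complex_norm_square[of "a n"] by (simp add: q_def mult.commute)
    then have "f (a n) = c * \<beta>n / (of_real (q n))\<^sup>2" by (simp add: f_def \<beta>n)
    also have "\<dots> = of_real (q n powr (2 - \<alpha>) / (q n)\<^sup>2)"
      unfolding c_def using \<beta>0 by simp
    finally have "f (a n) = of_real (q n powr (2 - \<alpha>) / (q n)\<^sup>2)" .
    moreover have "q n powr (2 - \<alpha>) / (q n)\<^sup>2 * q n powr \<alpha> = 1"
      using q[of n] by (simp add: powr_diff)
    ultimately show ?thesis unfolding True q_def[symmetric] by (simp only: of_real_1 simp_thms of_bool_eq flip: of_real_mult)
  qed
  show ?thesis
  proof (cases "\<alpha> = 1")
    case True
    obtain B where B: "(\<lambda>t. f (cis t)) \<in> borel_measurable borel" "\<And>t. cmod (f (cis t)) \<le> B"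
      "\<And>z. cmod z < 1 \<Longrightarrow> (LINT t|circ. f (cis t) * (1 / (1 - cnj (cis t) * z) powr of_real 1)) = f z"
      by (rule cauchy_density[OF R(2,1)], rule that)
    show ?thesis
    proof (rule that[OF B(1,2)])
      \<comment> \<open>At \<alpha> = 1 the norm is at most 1 / \<delta>, which lies below the
        constant of the other case; one bound then serves both.\<close>
      have "cmod c / (1 - (cmod (a n))\<^sup>2) \<le> 1 / \<delta>"
        using cle q[of n] True \<delta> by (simp add: q_def[symmetric] field_simps)
      also have "\<dots> \<le> (16 / \<alpha> + 256 * \<bar>rad_const \<alpha> * S\<bar>) / \<delta>"
        using \<delta> True by (intro divide_right_mono) auto
      finally show "(\<integral>\<^sup>+t. ennreal (cmod (f (cis t))) \<partial>circ) \<le> ennreal ((16 / \<alpha> + 256 * \<bar>rad_const \<alpha> * S\<bar>) / \<delta>)"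
        by (intro order_trans[OF norm_density_1_le] ennreal_leI)
      show "(LINT t|circ. f (cis t) * (1 / (1 - cnj (cis t) * a k) powr of_real \<alpha>))
        * of_real ((1 - (cmod (a k))\<^sup>2) powr \<alpha>) = of_bool (k = n)" if "k < N" for k
        using fk[OF that] B(3)[OF a[of k]] True by simp
    qed
  next
    case False
    then have \<alpha>1: "\<alpha> < 1" using \<alpha> by simp
    obtain \<phi> B where \<phi>: "\<phi> \<in> borel_measurable borel" "\<And>t. cmod (\<phi> t) \<le> B"
      "\<And>z. cmod z < 1 \<Longrightarrow> (LINT t|circ. \<phi> t * (1 / (1 - cnj (cis t) * z) powr of_real \<alpha>)) = f z"
      "\<And>t. ennreal (cmod (\<phi> t)) \<le>
       (\<integral>\<^sup>+s. ennreal (cmod (of_real \<alpha> * f (of_real s * cis t) + of_real s * cis t * deriv f (of_real s * cis t))) \<partial>radial \<alpha>)"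
      by (rule frac_cauchy_density[OF R(2,1) \<alpha>(1)], rule that)
    obtain \<xi> where \<xi>: "cmod \<xi> = 1" "a n = of_real (cmod (a n)) * \<xi>" by (rule radial_projection)
    define G where "G k = (1 - (cmod (a k))\<^sup>2) *
       (8 * rad_const \<alpha> / (cmod (1 - cnj (a n) * a k))\<^sup>2 * ((1 - cmod (a n)) powr (\<alpha> - 1) + (1 - cmod (a k)) powr (\<alpha> - 1)))" for k
    have K: "rad_const \<alpha> \<ge> 0" using \<alpha> \<alpha>1 by (simp add: rad_const_def)
    have G0: "G k \<ge> 0" for k unfolding G_def q_def[symmetric] using q[of k] K by (intro mult_nonneg_nonneg add_nonneg_nonneg) auto
    have "cmod c * (4 * ((1 - cmod (a n)) powr (\<alpha> - 2) / \<alpha>) + (\<Sum>k\<in>I. G k))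
      \<le> q n powr (2 - \<alpha>) / \<delta> * (4 * ((1 - cmod (a n)) powr (\<alpha> - 2) / \<alpha>) + (\<Sum>k\<in>I. G k))"
      using cle \<alpha> G0 by (intro mult_right_mono add_nonneg_nonneg sum_nonneg) auto
    also have "\<dots> = (4 / \<alpha> * (q n powr (2 - \<alpha>) * (1 - cmod (a n)) powr (\<alpha> - 2)) + (\<Sum>k\<in>I. q n powr (2 - \<alpha>) * G k)) / \<delta>"
      unfolding sum_distrib_left[symmetric] by (simp add: distrib_left add_divide_distrib mult_ac)
    \<comment> \<open>The second 4 bounds 2^(2 - \<alpha>), the loss in comparing 1 - |a_n|^2 with 1
      - |a_n|; this is the origin of 16 / \<alpha>.\<close>
    also have "\<dots> \<le> (4 / \<alpha> * 4 + 256 * \<bar>rad_const \<alpha> * S\<bar>) / \<delta>"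
    proof (intro divide_right_mono add_mono mult_left_mono)
      have "q n \<le> 2 * (1 - cmod (a n))" unfolding q_def using zero_le_power2[of "1 - cmod (a n)"] by (simp add: power2_eq_square algebra_simps)
      then have "q n powr (2 - \<alpha>) \<le> (2 * (1 - cmod (a n))) powr (2 - \<alpha>)"
        using q[of n] \<alpha> by (intro powr_mono2) auto
      also have "\<dots> = 2 powr (2 - \<alpha>) * (1 - cmod (a n)) powr (2 - \<alpha>)" by (rule powr_mult)
      also have "2 powr (2 - \<alpha>) \<le> (2 :: real) powr 2" using \<alpha> by (intro powr_mono) auto
      finally have "q n powr (2 - \<alpha>) \<le> 4 * (1 - cmod (a n)) powr (2 - \<alpha>)" by (simp add: mult_right_mono)
      from mult_right_mono[OF this, of "(1 - cmod (a n)) powr (\<alpha> - 2)"]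
      have "q n powr (2 - \<alpha>) * (1 - cmod (a n)) powr (\<alpha> - 2) \<le> 4 * ((1 - cmod (a n)) powr (2 - \<alpha>) * (1 - cmod (a n)) powr (\<alpha> - 2))"
        by simp
      also have "(1 - cmod (a n)) powr (2 - \<alpha>) * (1 - cmod (a n)) powr (\<alpha> - 2) = 1"
        using a[of n] by (simp flip: powr_add)
      finally show "q n powr (2 - \<alpha>) * (1 - cmod (a n)) powr (\<alpha> - 2) \<le> 4" by simp
      have "(\<Sum>k\<in>I. q n powr (2 - \<alpha>) * G k) \<le> (\<Sum>k\<in>I. 256 * rad_const \<alpha> * ((1 - (cmod (a k))\<^sup>2) / cmod (1 - cnj \<xi> * a k)) powr \<alpha>)"
        unfolding q_def G_def by (intro sum_mono interp_weight_le a \<xi> \<alpha> \<alpha>1)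
      also have "\<dots> \<le> 256 * rad_const \<alpha> * S"
        unfolding sum_distrib_left[symmetric] using K by (intro mult_left_mono S \<xi> fin) auto
      finally show "(\<Sum>k\<in>I. q n powr (2 - \<alpha>) * G k) \<le> 256 * \<bar>rad_const \<alpha> * S\<bar>" by (simp add: abs_if split: if_splits)
    qed (use \<delta> \<alpha> in auto)
    finally have bound: "cmod c * (4 * ((1 - cmod (a n)) powr (\<alpha> - 2) / \<alpha>) + (\<Sum>k\<in>I. G k))
      \<le> (16 / \<alpha> + 256 * \<bar>rad_const \<alpha> * S\<bar>) / \<delta>" by simp
    show ?thesis
    proof (rule that[OF \<phi>(1,2)])
      have "(\<integral>\<^sup>+t. ennreal (cmod (\<phi> t)) \<partial>circ) \<le> (\<integral>\<^sup>+t. \<integral>\<^sup>+s. ennreal (cmod (of_real \<alpha> * f (of_real s * cis t) + of_real s * cis t * deriv f (of_real s * cis t))) \<partial>radial \<alpha> \<partial>circ)"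
        by (intro nn_integral_mono \<phi>)
      also have "\<dots> \<le> ennreal (cmod c * (4 * ((1 - cmod (a n)) powr (\<alpha> - 2) / \<alpha>) + (\<Sum>k\<in>I. G k)))"
        unfolding G_def by (rule nn_integral_euler_f_le[OF \<alpha>(1) \<alpha>1])
      finally show "(\<integral>\<^sup>+t. ennreal (cmod (\<phi> t)) \<partial>circ) \<le> ennreal ((16 / \<alpha> + 256 * \<bar>rad_const \<alpha> * S\<bar>) / \<delta>)"
        by (rule order_trans[OF _ ennreal_leI[OF bound]])
      show "(LINT t|circ. \<phi> t * (1 / (1 - cnj (cis t) * a k) powr of_real \<alpha>))
        * of_real ((1 - (cmod (a k))\<^sup>2) powr \<alpha>) = of_bool (k = n)" if "k < N" for k
        using fk[OF that] \<phi>(3)[OF a[of k]] by simp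
    qed
  qed
qed

subsection \<open>Jordan decomposition and summability\<close>

text \<open>Equality of two differences of measures, written with sums to avoid subtracting infinite
  values. The sum form survives every step of the induction from indicators through monotone
  limits.\<close>

lemma nn_integral_add_eq:
  assumes sets: "sets P1 = sets M" "sets P2 = sets M" "sets P3 = sets M" "sets P4 = sets M"
    and eq: "\<And>A. A \<in> sets M \<Longrightarrow> emeasure P1 A + emeasure P2 A = emeasure P3 A + emeasure P4 A"
    and f: "f \<in> borel_measurable M"
  shows "integral\<^sup>N P1 f + integral\<^sup>N P2 f = integral\<^sup>N P3 f + integral\<^sup>N P4 f"
proof -
  note [measurable_cong] = sets
  note sp = sets[THEN sets_eq_imp_space_eq]
  show ?thesis using f
  proof (induction rule: borel_measurable_induct)
    case (cong f g)
    then show ?case using sp by (metis nn_integral_cong)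
  next
    case (set A)
    then show ?case using sets eq by simp
  next
    case (mult u c)
    then show ?case by (simp add: nn_integral_cmult flip: distrib_left)
  next
    case (add u v)
    have "integral\<^sup>N P (\<lambda>x. v x + u x) = integral\<^sup>N P v + integral\<^sup>N P u" if "sets P = sets M" for P
      using \<open>u \<in> borel_measurable M\<close> \<open>v \<in> borel_measurable M\<close> that by (intro nn_integral_add) (simp_all cong: measurable_cong_sets)
    then have "integral\<^sup>N P1 (\<lambda>x. v x + u x) + integral\<^sup>N P2 (\<lambda>x. v x + u x)
        = (integral\<^sup>N P1 v + integral\<^sup>N P2 v) + (integral\<^sup>N P1 u + integral\<^sup>N P2 u)"
      using sets by (simp add: ac_simps)
    also have "\<dots> = (integral\<^sup>N P3 v + integral\<^sup>N P4 v) + (integral\<^sup>N P3 u + integral\<^sup>N P4 u)"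
      using add.IH by simp
    also have "\<dots> = integral\<^sup>N P3 (\<lambda>x. v x + u x) + integral\<^sup>N P4 (\<lambda>x. v x + u x)"
      using sets \<open>\<And>P. sets P = sets M \<Longrightarrow> integral\<^sup>N P (\<lambda>x. v x + u x) = integral\<^sup>N P v + integral\<^sup>N P u\<close>
      by (simp add: ac_simps)
    finally show ?case .
  next
    case (seq U)
    have S: "integral\<^sup>N P (\<Squnion>i. U i) = (\<Squnion>i. integral\<^sup>N P (U i))" if "sets P = sets M" for P
      using nn_integral_monotone_convergence_SUP[OF \<open>incseq U\<close>, of P] seq(1) that
      by (simp add: image_image SUP_apply[abs_def] cong: measurable_cong_sets)
    have I: "incseq (\<lambda>i. integral\<^sup>N P (U i))" for P
      using \<open>incseq U\<close> by (auto simp: incseq_def le_fun_def intro!: nn_integral_mono)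
    show ?case unfolding S[OF sets(1)] S[OF sets(2)] S[OF sets(3)] S[OF sets(4)]
      by (simp add: seq.IH flip: ennreal_SUP_add[OF I I])
  qed
qed

lemma integral_add_eq:
  fixes f :: "'a \<Rightarrow> complex"
  assumes sets: "sets P1 = sets M" "sets P2 = sets M" "sets P3 = sets M" "sets P4 = sets M"
    and eq: "\<And>A. A \<in> sets M \<Longrightarrow> emeasure P1 A + emeasure P2 A = emeasure P3 A + emeasure P4 A"
    and int: "integrable P1 f" "integrable P2 f" "integrable P3 f" "integrable P4 f"
  shows "integral\<^sup>L P1 f + integral\<^sup>L P2 f = integral\<^sup>L P3 f + integral\<^sup>L P4 f"
proof -
  have R: "integral\<^sup>L P1 g + integral\<^sup>L P2 g = integral\<^sup>L P3 g + integral\<^sup>L P4 g"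
    if g: "integrable P1 g" "integrable P2 g" "integrable P3 g" "integrable P4 g" for g :: "'a \<Rightarrow> real"
  proof -
    have gm: "g \<in> borel_measurable M"
      using borel_measurable_integrable[OF g(1)] sets(1) by (simp cong: measurable_cong_sets)
    have fin: "integral\<^sup>N P (\<lambda>x. ennreal (h x)) < top" if "integrable P h" for P and h :: "'a \<Rightarrow> real"
      using that by (simp add: real_integrable_def less_top)
    have E: "enn2real (integral\<^sup>N P1 (\<lambda>x. ennreal (h x))) + enn2real (integral\<^sup>N P2 (\<lambda>x. ennreal (h x)))
      = enn2real (integral\<^sup>N P3 (\<lambda>x. ennreal (h x))) + enn2real (integral\<^sup>N P4 (\<lambda>x. ennreal (h x)))"
      if "h \<in> borel_measurable M" "integrable P1 h" "integrable P2 h" "integrable P3 h" "integrable P4 h" for h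
      using nn_integral_add_eq[OF sets eq, of "\<lambda>x. ennreal (h x)"] that fin
      by (simp flip: enn2real_plus)
    show ?thesis
      using E[of g] E[of "\<lambda>x. - g x"] g gm by (simp add: real_lebesgue_integral_def)
  qed
  show ?thesis
  proof (rule complex_eqI)
    show "Re (integral\<^sup>L P1 f + integral\<^sup>L P2 f) = Re (integral\<^sup>L P3 f + integral\<^sup>L P4 f)"
      using R[of "\<lambda>x. Re (f x)"] int by simp
    show "Im (integral\<^sup>L P1 f + integral\<^sup>L P2 f) = Im (integral\<^sup>L P3 f + integral\<^sup>L P4 f)"
      using R[of "\<lambda>x. Im (f x)"] int by simp
  qed
qed

lemma sets_pos_variation: "sets (pos_variation M \<nu>) = sets M"
  by (simp add: pos_variation_def sets.sigma_sets_eq)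

context
  fixes M P Q :: "'a measure"
  assumes P: "finite_measure P" "sets P = sets M" and Q: "finite_measure Q" "sets Q = sets M"
begin

lemma emeasure_pos_variation_diff:
  assumes A: "A \<in> sets M"
  shows "emeasure (pos_variation M (\<lambda>A. measure P A - measure Q A)) A
    = (SUP B\<in>{B \<in> sets M. B \<subseteq> A}. ennreal (measure P B - measure Q B))"
proof (rule emeasure_pos_variation[OF _ _ A])
  fix A :: "nat \<Rightarrow> 'a set" assume "range A \<subseteq> sets M" "disjoint_family A"
  then show "(\<lambda>n. measure P (A n) - measure Q (A n)) sums (measure P (\<Union>n. A n) - measure Q (\<Union>n. A n))"
    using P Q by (intro sums_diff finite_measure.finite_measure_UNION) auto
qed simp

lemma pos_variation_diff_le:
  assumes A: "A \<in> sets M"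
  shows "emeasure (pos_variation M (\<lambda>A. measure P A - measure Q A)) A \<le> emeasure P A"
  unfolding emeasure_pos_variation_diff[OF A]
proof (rule SUP_least)
  interpret P: finite_measure P by (rule P)
  fix B assume B: "B \<in> {B \<in> sets M. B \<subseteq> A}"
  have "measure P B \<le> measure P A"
    using P.finite_measure_mono[of B A] B A P(2) by auto
  then have "measure P B - measure Q B \<le> measure P A"
    using measure_nonneg[of Q B] by linarith
  then show "ennreal (measure P B - measure Q B) \<le> emeasure P A"
    by (simp add: P.emeasure_eq_measure ennreal_leI)
qed

lemma finite_pos_variation_diff: "finite_measure (pos_variation M (\<lambda>A. measure P A - measure Q A))"
proof (rule finite_measureI)
  let ?V = "pos_variation M (\<lambda>A. measure P A - measure Q A)"
  have "space ?V = space M" "space P = space M" by (intro sets_eq_imp_space_eq sets_pos_variation P)+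
  then have "emeasure ?V (space ?V) \<le> emeasure P (space P)"
    using pos_variation_diff_le[of "space M"] by simp
  also have "\<dots> < \<infinity>" using finite_measure.emeasure_finite[OF P(1)] by (simp add: less_top)
  finally show "emeasure ?V (space ?V) \<noteq> \<infinity>" by simp
qed

end

text \<open>For B inside A, (P - Q)(B) = (P - Q)(A) + (Q - P)(A - B): passing to the complement
  trades a competitor for one variation into a competitor for the other. Exchanging P and Q gives
  the reverse inequality, so no Hahn decomposition is required.\<close>

lemma jordan_diff_le:
  assumes P: "finite_measure P" "sets P = sets M" and Q: "finite_measure Q" "sets Q = sets M" and A: "A \<in> sets M"
  shows "emeasure (pos_variation M (\<lambda>A. measure P A - measure Q A)) A + emeasure Q A
    \<le> emeasure (pos_variation M (\<lambda>A. measure Q A - measure P A)) A + emeasure P A"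
proof -
  interpret P: finite_measure P by (rule P)
  interpret Q: finite_measure Q by (rule Q)
  let ?V = "emeasure (pos_variation M (\<lambda>A. measure Q A - measure P A)) A"
  have key: "ennreal (measure P B - measure Q B) + emeasure Q A \<le> ?V + emeasure P A"
    if B: "B \<in> sets M" "B \<subseteq> A" and nn: "measure P B - measure Q B \<ge> 0" for B
  proof -
    have PA: "measure P A = measure P B + measure P (A - B)"
      using P.finite_measure_Diff[of A B] A B P(2) by simp
    have QA: "measure Q A = measure Q B + measure Q (A - B)"
      using Q.finite_measure_Diff[of A B] A B Q(2) by simp
    have "ennreal (measure P B - measure Q B) + emeasure Q A = ennreal ((measure P B - measure Q B) + measure Q A)"
      using nn by (simp add: Q.emeasure_eq_measure)
    also have "\<dots> \<le> ennreal (max 0 (measure Q (A - B) - measure P (A - B)) + measure P A)"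
      using PA QA by (intro ennreal_leI) (simp add: max_def)
    also have "\<dots> = ennreal (max 0 (measure Q (A - B) - measure P (A - B))) + emeasure P A"
      by (simp add: P.emeasure_eq_measure)
    also have "ennreal (max 0 (measure Q (A - B) - measure P (A - B))) = ennreal (measure Q (A - B) - measure P (A - B))"
      by (simp add: max_def ennreal_neg)
    also have "\<dots> \<le> ?V"
      unfolding emeasure_pos_variation_diff[OF Q P A] using A B by (intro SUP_upper) auto
    finally show ?thesis by (simp add: add_right_mono)
  qed
  have "emeasure (pos_variation M (\<lambda>A. measure P A - measure Q A)) A + emeasure Q A
    = (SUP B\<in>{B \<in> sets M. B \<subseteq> A}. ennreal (measure P B - measure Q B) + emeasure Q A)"
    unfolding emeasure_pos_variation_diff[OF P Q A] by (subst ennreal_SUP_add_left) auto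
  also have "\<dots> \<le> ?V + emeasure P A"
  proof (rule SUP_least)
    fix B assume B: "B \<in> {B \<in> sets M. B \<subseteq> A}"
    show "ennreal (measure P B - measure Q B) + emeasure Q A \<le> ?V + emeasure P A"
    proof (cases "measure P B - measure Q B \<ge> 0")
      case False
      \<comment> \<open>A negative value is truncated to 0, the value at the empty set, which is
        itself an admissible competitor.\<close>
      then have "ennreal (measure P B - measure Q B) = ennreal (measure P {} - measure Q {})" by (simp add: ennreal_neg)
      then show ?thesis using key[of "{}"] by simp
    qed (use key B in auto)
  qed
  finally show ?thesis .
qed

text \<open>Lets any representation P - Q by finite measures stand in for the Jordan decomposition
  used by \<open>complex_measure_integral\<close>.\<close>

lemma integral_jordan_diff:
  fixes f :: "'a \<Rightarrow> complex"
  assumes P: "finite_measure P" "sets P = sets M" and Q: "finite_measure Q" "sets Q = sets M"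
    and f: "f \<in> borel_measurable M" "\<And>x. x \<in> space M \<Longrightarrow> cmod (f x) \<le> B"
  shows "(LINT x|pos_variation M (\<lambda>A. measure P A - measure Q A). f x) - (LINT x|pos_variation M (\<lambda>A. measure Q A - measure P A). f x)
    = (LINT x|P. f x) - (LINT x|Q. f x)"
proof -
  have int: "integrable R f" if "finite_measure R" "sets R = sets M" for R
  proof (rule finite_measure.integrable_const_bound[OF that(1)])
    show "AE x in R. cmod (f x) \<le> B" using f(2) sets_eq_imp_space_eq[OF that(2)] by (intro AE_I2) auto
    show "f \<in> borel_measurable R" using f(1) that(2) by (simp cong: measurable_cong_sets)
  qed
  have "(LINT x|pos_variation M (\<lambda>A. measure P A - measure Q A). f x) + (LINT x|Q. f x)
    = (LINT x|pos_variation M (\<lambda>A. measure Q A - measure P A). f x) + (LINT x|P. f x)"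
    by (rule integral_add_eq[OF sets_pos_variation Q(2) sets_pos_variation P(2)])
      (auto intro!: int finite_pos_variation_diff P Q sets_pos_variation antisym jordan_diff_le)
  then show ?thesis by (simp add: algebra_simps)
qed

section \<open>The kernel on the circle, and part (a)\<close>

lemma norm_powr_of_real:
  assumes "w \<noteq> 0"
  shows "cmod (w powr of_real \<alpha>) = cmod w powr \<alpha>"
  using assms by (simp add: powr_def)

text \<open>For |z| < 1 the base 1 - cnj \<xi> z stays in the right half plane, away from the cut of
  the principal branch.\<close>

lemma continuous_on_kernel:
  assumes "cmod z < 1"
  shows "continuous_on (sphere 0 1) (\<lambda>\<xi>. 1 / (1 - cnj \<xi> * z) powr of_real \<alpha>)"
proof -
  have r: "Re (1 - cnj \<xi> * z) > 0" if "\<xi> \<in> sphere 0 1" for \<xi>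
  proof -
    have "Re (cnj \<xi> * z) \<le> cmod (cnj \<xi> * z)" by (rule complex_Re_le_cmod)
    also have "\<dots> < 1" using that assms by (simp add: norm_mult)
    finally show ?thesis by simp
  qed
  have nz: "1 - cnj \<xi> * z \<noteq> 0" if "\<xi> \<in> sphere 0 1" for \<xi>
    using r[OF that] by (metis less_irrefl zero_complex.simps(1))
  have "continuous_on (sphere 0 1) (\<lambda>\<xi>. (1 - cnj \<xi> * z) powr of_real \<alpha>)"
  proof (rule continuous_on_powr_complex)
    show "sphere 0 1 \<subseteq> {\<xi>. 0 \<le> Re (1 - cnj \<xi> * z) \<or> Im (1 - cnj \<xi> * z) \<noteq> 0}"
      using r less_imp_le by blast
    show "0 < Re (of_real \<alpha>)" if "\<xi> \<in> sphere 0 1" "1 - cnj \<xi> * z = 0" for \<xi>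
      using nz that by blast
  qed (intro continuous_intros)+
  then show ?thesis using nz by (intro continuous_on_divide continuous_on_const) (auto simp: powr_eq_0_iff)
qed

lemma kernel_bounded:
  assumes z: "cmod z < 1"
  obtains B where "\<And>\<xi>. \<xi> \<in> sphere 0 1 \<Longrightarrow> cmod (1 / (1 - cnj \<xi> * z) powr of_real \<alpha>) \<le> B"
proof -
  have "bounded ((\<lambda>\<xi>. 1 / (1 - cnj \<xi> * z) powr of_real \<alpha>) ` sphere 0 1)"
    by (intro compact_imp_bounded compact_continuous_image continuous_on_kernel z) auto
  then show ?thesis using that unfolding bounded_iff by blast
qed

lemma measurable_kernel:
  assumes "cmod z < 1"
  shows "(\<lambda>\<xi>. 1 / (1 - cnj \<xi> * z) powr of_real \<alpha>) \<in> borel_measurable circle_borel"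
  by (intro borel_measurable_continuous_on_restrict continuous_on_kernel assms)

text \<open>Applied to each of the four variations without first proving them finite: on a measure
  of infinite mass the kernel, at least 2^(-\<alpha>) in modulus, is not integrable, and the Bochner
  integral is 0 by default. For finite mass, the sum under the integral is bounded by
  \<open>sigma_const\<close>.\<close>

lemma cauchy_transform_summable:
  fixes a :: "nat \<Rightarrow> complex"
  assumes \<alpha>: "0 < \<alpha>" and a: "\<And>k. cmod (a k) < 1" and \<sigma>: "sigma_const \<alpha> a < \<infinity>"
    and P: "sets P = sets circle_borel"
  shows "summable (\<lambda>k. cmod (LINT \<xi>|P. 1 / (1 - cnj \<xi> * a k) powr of_real \<alpha>) * (1 - (cmod (a k))\<^sup>2) powr \<alpha>)"
proof -
  define K where "K k \<xi> = 1 / (1 - cnj \<xi> * a k) powr of_real \<alpha>" for k \<xi>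
  define w where "w k = (1 - (cmod (a k))\<^sup>2) powr \<alpha>" for k
  have sp: "space P = sphere 0 1" using sets_eq_imp_space_eq[OF P] by simp
  have Km: "K k \<in> borel_measurable P" for k
    using measurable_kernel[OF a[of k], of \<alpha>] P unfolding K_def[abs_def] by (simp cong: measurable_cong_sets)
  have nz: "1 - cnj \<xi> * a k \<noteq> 0" if "\<xi> \<in> sphere 0 1" for \<xi> k
    using one_minus_cnj_mult_ge[of \<xi> "a k"] that a[of k] by auto
  have nK: "cmod (K k \<xi>) = 1 / cmod (1 - cnj \<xi> * a k) powr \<alpha>" if "\<xi> \<in> sphere 0 1" for k \<xi>
    using nz[OF that] by (simp add: K_def norm_divide norm_powr_of_real)
  show ?thesis
  proof (cases "emeasure P (space P) = \<infinity>")
    case True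
    have "\<not> integrable P (K k)" for k
    proof
      assume "integrable P (K k)"
      then have fin: "(\<integral>\<^sup>+\<xi>. ennreal (cmod (K k \<xi>)) \<partial>P) < \<infinity>" by (simp add: integrable_iff_bounded)
      have "(\<integral>\<^sup>+\<xi>. ennreal (2 powr - \<alpha>) \<partial>P) \<le> (\<integral>\<^sup>+\<xi>. ennreal (cmod (K k \<xi>)) \<partial>P)"
      proof (intro nn_integral_mono ennreal_leI)
        fix \<xi> assume "\<xi> \<in> space P"
        then have \<xi>: "\<xi> \<in> sphere 0 1" using sp by simp
        have "cmod (1 - cnj \<xi> * a k) \<le> 1 + cmod (cnj \<xi> * a k)" using norm_triangle_ineq4[of 1 "cnj \<xi> * a k"] by simp
        also have "\<dots> \<le> 2" using \<xi> a[of k] by (simp add: norm_mult)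
        finally have "cmod (1 - cnj \<xi> * a k) powr \<alpha> \<le> 2 powr \<alpha>" using \<alpha> by (intro powr_mono2) auto
        then show "2 powr - \<alpha> \<le> cmod (K k \<xi>)"
          using nz[OF \<xi>, of k] by (simp add: nK[OF \<xi>] powr_minus_divide frac_le)
      qed
      moreover have "(\<integral>\<^sup>+\<xi>. ennreal (2 powr - \<alpha>) \<partial>P) = \<infinity>" using True by (simp add: ennreal_mult_top)
      ultimately show False using fin by simp
    qed
    then have "(LINT \<xi>|P. K k \<xi>) = 0" for k by (rule not_integrable_integral_eq)
    then show ?thesis unfolding K_def by simp
  next
    case False
    have le: "ennreal (cmod (LINT \<xi>|P. K k \<xi>) * w k) \<le> (\<integral>\<^sup>+\<xi>. ennreal (((1 - (cmod (a k))\<^sup>2) / cmod (1 - cnj \<xi> * a k)) powr \<alpha>) \<partial>P)" for k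
    proof -
      have "ennreal (cmod (LINT \<xi>|P. K k \<xi>)) \<le> (\<integral>\<^sup>+\<xi>. ennreal (cmod (K k \<xi>)) \<partial>P)"
        by (cases "integrable P (K k)") (auto simp: integral_norm_bound_ennreal not_integrable_integral_eq)
      then have "ennreal (cmod (LINT \<xi>|P. K k \<xi>)) * ennreal (w k) \<le> (\<integral>\<^sup>+\<xi>. ennreal (cmod (K k \<xi>)) \<partial>P) * ennreal (w k)"
        by (rule mult_right_mono) simp
      also have "\<dots> = (\<integral>\<^sup>+\<xi>. ennreal (cmod (K k \<xi>)) * ennreal (w k) \<partial>P)"
        using Km by (intro nn_integral_multc[symmetric]) auto
      also have "\<dots> = (\<integral>\<^sup>+\<xi>. ennreal (((1 - (cmod (a k))\<^sup>2) / cmod (1 - cnj \<xi> * a k)) powr \<alpha>) \<partial>P)"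
        using sp a[of k] by (intro nn_integral_cong) (simp add: nK w_def powr_divide power_le_one flip: ennreal_mult)
      finally show ?thesis by (simp add: w_def ennreal_mult)
    qed
    have "(\<Sum>k. ennreal (cmod (LINT \<xi>|P. K k \<xi>) * w k)) \<le> (\<Sum>k. \<integral>\<^sup>+\<xi>. ennreal (((1 - (cmod (a k))\<^sup>2) / cmod (1 - cnj \<xi> * a k)) powr \<alpha>) \<partial>P)"
      using le by (intro suminf_le) auto
    also have "\<dots> = (\<integral>\<^sup>+\<xi>. (\<Sum>k. ennreal (((1 - (cmod (a k))\<^sup>2) / cmod (1 - cnj \<xi> * a k)) powr \<alpha>)) \<partial>P)"
    proof (rule nn_integral_suminf[symmetric])
      show "(\<lambda>\<xi>. ennreal (((1 - (cmod (a k))\<^sup>2) / cmod (1 - cnj \<xi> * a k)) powr \<alpha>)) \<in> borel_measurable P" for k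
      proof -
        have "(\<lambda>\<xi>. ennreal (((1 - (cmod (a k))\<^sup>2) / cmod (1 - cnj \<xi> * a k)) powr \<alpha>)) \<in> borel_measurable circle_borel"
          by (rule measurable_restrict_space1) measurable
        then show ?thesis using P by (simp cong: measurable_cong_sets)
      qed
    qed
    also have "\<dots> \<le> (\<integral>\<^sup>+\<xi>. sigma_const \<alpha> a \<partial>P)"
      unfolding sigma_const_def by (intro nn_integral_mono SUP_upper) (simp add: sp)
    also have "\<dots> < \<infinity>" using False \<sigma> by (simp add: ennreal_mult_less_top less_top)
    finally show ?thesis
      unfolding K_def[symmetric] w_def[symmetric]
      by (intro summable_suminf_not_top) (auto simp: w_def)
  qed
qed

lemma frac_cauchy_transform_ell1:
  fixes a :: "nat \<Rightarrow> complex"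
  assumes \<alpha>: "0 < \<alpha>" and a: "\<And>k. cmod (a k) < 1" and \<sigma>: "sigma_const \<alpha> a < \<infinity>"
    and g: "g \<in> frac_cauchy_transforms \<alpha>"
  shows "(\<lambda>k. g (a k) * of_real ((1 - (cmod (a k))\<^sup>2) powr \<alpha>)) \<in> ell1"
proof -
  obtain \<mu> where \<mu>: "\<And>z. z \<in> ball 0 1 \<Longrightarrow> g z = complex_measure_integral circle_borel \<mu> (\<lambda>\<xi>. 1 / (1 - cnj \<xi> * z) powr of_real \<alpha>)"
    using g by (auto simp: frac_cauchy_transforms_def)
  define L where "L \<nu> k = (LINT \<xi>|pos_variation circle_borel \<nu>. 1 / (1 - cnj \<xi> * a k) powr of_real \<alpha>)" for \<nu> k
  define w where "w k = (1 - (cmod (a k))\<^sup>2) powr \<alpha>" for k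
  have s: "summable (\<lambda>k. cmod (L \<nu> k) * w k)" for \<nu>
    unfolding L_def w_def by (intro cauchy_transform_summable \<alpha> a \<sigma> sets_pos_variation)
  define L1 L2 L3 L4 where "L1 = L (\<lambda>A. Re (\<mu> A))" and "L2 = L (\<lambda>A. - Re (\<mu> A))"
    and "L3 = L (\<lambda>A. Im (\<mu> A))" and "L4 = L (\<lambda>A. - Im (\<mu> A))"
  have ga: "g (a k) = (L1 k - L2 k) + \<i> * (L3 k - L4 k)" for k
    using \<mu>[of "a k"] a[of k] by (simp add: complex_measure_integral_def L_def L1_def L2_def L3_def L4_def)
  have "summable (\<lambda>k. cmod (L1 k) * w k + cmod (L2 k) * w k + (cmod (L3 k) * w k + cmod (L4 k) * w k))"
    unfolding L1_def L2_def L3_def L4_def by (intro summable_add s)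
  then show ?thesis
    unfolding ell1_def mem_Collect_eq w_def[symmetric]
  proof (rule summable_comparison_test'[where N = 0])
    fix k
    have "cmod (g (a k)) \<le> cmod (L1 k - L2 k) + cmod (\<i> * (L3 k - L4 k))" unfolding ga by (rule norm_triangle_ineq)
    also have "\<dots> \<le> cmod (L1 k) + cmod (L2 k) + (cmod (L3 k) + cmod (L4 k))"
      by (intro add_mono norm_triangle_ineq4) (simp add: norm_mult norm_triangle_ineq4)
    finally have "cmod (g (a k)) * w k \<le> (cmod (L1 k) + cmod (L2 k) + (cmod (L3 k) + cmod (L4 k))) * w k"
      by (rule mult_right_mono) (simp add: w_def)
    then show "norm (cmod (g (a k) * of_real (w k))) \<le> cmod (L1 k) * w k + cmod (L2 k) * w k + (cmod (L3 k) * w k + cmod (L4 k) * w k)"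
      by (simp add: norm_mult w_def distrib_right)
  qed
qed

subsection \<open>Weak compactness and interpolation\<close>

text \<open>A continuous stand-in for the indicator of [-pi, pi], as weak convergence tests only
  continuous functions: it is 1 up to 4 > pi and vanishes from 5 on.\<close>

definition cutoff :: "real \<Rightarrow> real" where
  "cutoff x = max 0 (min 1 (5 - \<bar>x\<bar>))"

lemma cutoff: "0 \<le> cutoff x" "cutoff x \<le> 1" "\<bar>x\<bar> \<le> 4 \<Longrightarrow> cutoff x = 1" "\<bar>x\<bar> \<ge> 5 \<Longrightarrow> cutoff x = 0"
  by (auto simp: cutoff_def)

lemma continuous_on_cutoff: "continuous_on UNIV cutoff"
  unfolding cutoff_def by (intro continuous_intros)

lemma cis_measurable_circle [measurable]: "cis \<in> borel \<rightarrow>\<^sub>M circle_borel"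
  by (rule measurable_restrict_space2) auto

text \<open>Helly's theorem is about probability measures on the line, so the missing mass is put on
  \<open>{10..11}\<close>, where \<open>cutoff\<close> makes it invisible.\<close>

lemma circle_weak_compactness:
  fixes h :: "nat \<Rightarrow> real \<Rightarrow> real"
  assumes h [measurable]: "\<And>n. h n \<in> borel_measurable borel" and h0: "\<And>n t. 0 \<le> h n t"
    and hC: "\<And>n. (\<integral>\<^sup>+t. ennreal (h n t) \<partial>circ) \<le> ennreal C" and C: "C > 0"
  obtains r \<nu> where "strict_mono (r :: nat \<Rightarrow> nat)" "finite_measure \<nu>" "sets \<nu> = sets circle_borel"
    "\<And>f :: complex \<Rightarrow> complex. continuous_on (sphere 0 1) f \<Longrightarrow>
      (\<lambda>n. LINT t|circ. of_real (h (r n) t) * f (cis t)) \<longlonglongrightarrow> (LINT \<xi>|\<nu>. f \<xi>)"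
proof -
  define e where "e n t = indicator {-pi..pi} t * h n t / (2 * pi * C)" for n t
  define m where "m n = enn2real (\<integral>\<^sup>+t. ennreal (e n t) \<partial>lborel)" for n
  define d where "d n t = e n t + (1 - m n) * indicator {10..11} t" for n t
  define P where "P n = density lborel (\<lambda>t. ennreal (d n t))" for n
  have e0: "e n t \<ge> 0" for n t using h0 C by (simp add: e_def)
  have [measurable]: "e n \<in> borel_measurable borel" for n unfolding e_def[abs_def] by measurable
  have me: "(\<integral>\<^sup>+t. ennreal (e n t) \<partial>lborel) \<le> 1" for n
  proof -
    have "(\<integral>\<^sup>+t. ennreal (e n t) \<partial>lborel) = (\<integral>\<^sup>+t. ennreal (1 / C) * ennreal (h n t) \<partial>circ)"
      unfolding circ_eq_density using C h0
      by (subst nn_integral_density) (auto simp: e_def mult_ac simp flip: ennreal_mult intro!: nn_integral_cong)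
    also have "\<dots> = ennreal (1 / C) * (\<integral>\<^sup>+t. ennreal (h n t) \<partial>circ)"
      by (rule nn_integral_cmult) measurable
    also have "\<dots> \<le> ennreal (1 / C) * ennreal C" by (intro mult_left_mono hC) simp
    also have "\<dots> = 1" using C by (simp flip: ennreal_mult)
    finally show ?thesis .
  qed
  have m: "(\<integral>\<^sup>+t. ennreal (e n t) \<partial>lborel) = ennreal (m n)" for n
    using me[of n] unfolding m_def by (subst ennreal_enn2real) (auto simp: less_top[symmetric] top_unique)
  have m1: "0 \<le> m n" "m n \<le> 1" for n
  proof -
    show "0 \<le> m n" by (simp add: m_def)
    have "ennreal (m n) \<le> ennreal 1" using me[of n] unfolding m by simp
    then show "m n \<le> 1" by (subst (asm) ennreal_le_iff) auto
  qed
  have d0: "d n t \<ge> 0" for n t using e0 m1(2)[of n] by (simp add: d_def)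
  have [measurable]: "d n \<in> borel_measurable borel" for n unfolding d_def[abs_def] by measurable
  have mass: "(\<integral>\<^sup>+t. ennreal (d n t) \<partial>lborel) = 1" for n
  proof -
    have "(\<integral>\<^sup>+t. ennreal (d n t) \<partial>lborel) = (\<integral>\<^sup>+t. ennreal (e n t) + ennreal (1 - m n) * indicator {10..11} t \<partial>lborel)"
      using e0 m1(2)[of n] by (intro nn_integral_cong) (auto simp: d_def indicator_def ennreal_plus)
    also have "\<dots> = ennreal (m n) + ennreal (1 - m n)"
      by (subst nn_integral_add) (auto simp: m nn_integral_cmult)
    also have "\<dots> = 1" using m1[of n] by (simp flip: ennreal_plus)
    finally show ?thesis .
  qed
  have rd: "real_distribution (P n)" for n
  proof (intro real_distribution.intro prob_spaceI real_distribution_axioms.intro)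
    show "emeasure (P n) (space (P n)) = 1"
      unfolding P_def by (simp add: emeasure_density mass)
  qed (simp add: P_def)
  have "tight P"
    unfolding tight_def
  proof (intro conjI allI impI rd)
    fix \<epsilon> :: real assume \<epsilon>: "\<epsilon> > 0"
    have "measure (P n) {-20<..20} = 1" for n
    proof -
      \<comment> \<open>All mass sits on [-pi, pi] and [10, 11], so tightness is immediate.\<close>
      have "emeasure (P n) {-20<..20} = (\<integral>\<^sup>+t. ennreal (d n t) * indicator {-20<..20} t \<partial>lborel)"
        unfolding P_def by (rule emeasure_density) auto
      also have "\<dots> = (\<integral>\<^sup>+t. ennreal (d n t) \<partial>lborel)"
        using pi_less_4 by (intro nn_integral_cong) (auto simp: d_def e_def indicator_def)
      finally show ?thesis by (simp add: mass measure_def)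
    qed
    then show "\<exists>a b. a < b \<and> (\<forall>n. 1 - \<epsilon> < measure (P n) {a<..b})"
      using \<epsilon> by (intro exI[of _ "-20"] exI[of _ 20]) auto
  qed
  from tight_imp_convergent_subsubsequence[OF this, of id]
  obtain r Q where r: "strict_mono r" and Q: "real_distribution Q" and w: "weak_conv_m (P \<circ> r) Q"
    by (auto simp: strict_mono_def)
  interpret Q: real_distribution Q by (rule Q)
  have [measurable]: "cutoff \<in> borel_measurable borel"
    by (rule borel_measurable_continuous_onI[OF continuous_on_cutoff])
  \<comment> \<open>The factor C undoes the normalisation to probability measures; the cutoff
    discards the auxiliary mass that survives in the limit.\<close>
  define D where "D = density Q (\<lambda>x. ennreal (C * cutoff x))"
  define \<nu> where "\<nu> = distr D circle_borel cis"
  have sD [measurable_cong]: "sets D = sets borel" by (simp add: D_def)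
  show ?thesis
  proof (rule that[OF r])
    show "sets \<nu> = sets circle_borel" by (simp add: \<nu>_def)
    have "emeasure D (space D) = (\<integral>\<^sup>+x. ennreal (C * cutoff x) \<partial>Q)"
      unfolding D_def by (simp add: emeasure_density)
    also have "\<dots> \<le> (\<integral>\<^sup>+x. ennreal C \<partial>Q)"
      using C cutoff by (intro nn_integral_mono ennreal_leI) (simp add: mult_left_le)
    also have "\<dots> < \<infinity>" using Q.emeasure_space_1 by simp
    finally have "finite_measure D" by (intro finite_measureI) simp
    then show "finite_measure \<nu>" unfolding \<nu>_def
      by (rule finite_measure.finite_measure_distr) measurable
    fix f :: "complex \<Rightarrow> complex" assume f: "continuous_on (sphere 0 1) f"
    define F where "F x = cutoff x *\<^sub>R f (cis x)" for x
    have fc: "continuous_on UNIV (\<lambda>x. f (cis x))"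
      by (rule continuous_on_compose2[OF f]) (auto intro!: continuous_intros)
    have [measurable]: "(\<lambda>x. f (cis x)) \<in> borel_measurable borel"
      by (rule borel_measurable_continuous_onI[OF fc])
    have Fc: "isCont F x" for x
      using continuous_on_scaleR[OF continuous_on_cutoff fc] by (simp add: F_def[abs_def] continuous_on_eq_continuous_at)
    have "bounded (f ` sphere 0 1)" by (intro compact_imp_bounded compact_continuous_image f) auto
    then obtain B where B: "\<And>\<xi>. \<xi> \<in> sphere 0 1 \<Longrightarrow> cmod (f \<xi>) \<le> B" unfolding bounded_iff by blast
    have FB: "norm (F x) \<le> B" for x
    proof -
      have "norm (F x) \<le> cmod (f (cis x))" using cutoff(1,2)[of x] by (simp add: F_def mult_left_le_one_le)
      also have "\<dots> \<le> B" by (rule B) simp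
      finally show ?thesis .
    qed
    have "(\<lambda>n. integral\<^sup>L ((P \<circ> r) n) F) \<longlonglongrightarrow> integral\<^sup>L Q F"
      by (rule weak_conv_imp_integral_bdd_continuous_conv[OF _ Q w Fc FB]) (simp add: rd)
    then have "(\<lambda>n. C *\<^sub>R integral\<^sup>L (P (r n)) F) \<longlonglongrightarrow> C *\<^sub>R integral\<^sup>L Q F"
      by (intro tendsto_scaleR tendsto_const) simp
    moreover have "C *\<^sub>R integral\<^sup>L (P n) F = (LINT t|circ. of_real (h n t) * f (cis t))" for n
    proof -
      have "integral\<^sup>L (P n) F = (LINT t|lborel. d n t *\<^sub>R F t)"
        unfolding P_def using d0 by (intro integral_density) (auto simp: F_def[abs_def])
      also have "\<dots> = (LINT t|lborel. (1 / C) *\<^sub>R ((indicator {-pi..pi} t / (2*pi)) *\<^sub>R (of_real (h n t) * f (cis t))))"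
      proof (intro Bochner_Integration.integral_cong refl)
        fix t :: real
        consider "t \<in> {-pi..pi}" | "t \<in> {10..11}" | "t \<notin> {-pi..pi}" "t \<notin> {10..11}" by blast
        then show "d n t *\<^sub>R F t = (1 / C) *\<^sub>R ((indicator {-pi..pi} t / (2*pi)) *\<^sub>R (of_real (h n t) * f (cis t)))"
        proof cases
          case 1
          then have "cutoff t = 1" "t \<notin> {10..11}" using pi_less_4 by (auto intro!: cutoff(3))
          with 1 show ?thesis by (simp add: d_def e_def F_def scaleR_conv_of_real)
        next
          case 2
          then have "cutoff t = 0" "t \<notin> {-pi..pi}" using pi_less_4 by (auto intro!: cutoff(4))
          then show ?thesis by (simp add: F_def)
        qed (simp add: d_def e_def)
      qed
      also have "\<dots> = (1 / C) *\<^sub>R (LINT t|lborel. (indicator {-pi..pi} t / (2*pi)) *\<^sub>R (of_real (h n t) * f (cis t)))"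
        by (rule integral_scaleR_right)
      also have "(LINT t|lborel. (indicator {-pi..pi} t / (2*pi)) *\<^sub>R (of_real (h n t) * f (cis t))) = (LINT t|circ. of_real (h n t) * f (cis t))"
        unfolding circ_eq_density by (subst integral_density) auto
      finally show ?thesis using C by simp
    qed
    moreover have "C *\<^sub>R integral\<^sup>L Q F = (LINT \<xi>|\<nu>. f \<xi>)"
    proof -
      have "(LINT \<xi>|\<nu>. f \<xi>) = (LINT x|D. f (cis x))"
        unfolding \<nu>_def by (intro integral_distr borel_measurable_continuous_on_restrict f) measurable
      also have "\<dots> = (LINT x|Q. (C * cutoff x) *\<^sub>R f (cis x))"
        unfolding D_def using C cutoff(1) by (intro integral_density) auto
      also have "\<dots> = (LINT x|Q. C *\<^sub>R F x)" by (simp add: F_def)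
      finally show ?thesis by simp
    qed
    ultimately show "(\<lambda>n. LINT t|circ. of_real (h (r n) t) * f (cis t)) \<longlonglongrightarrow> (LINT \<xi>|\<nu>. f \<xi>)" by simp
  qed
qed

text \<open>Shaped for nested extraction: it starts from a given subsequence \<open>s\<close>, and
  its limits persist along any further subsequence \<open>q\<close>.\<close>

lemma circle_weak_compactness_subseq:
  fixes h :: "nat \<Rightarrow> real \<Rightarrow> real" and s :: "nat \<Rightarrow> nat"
  assumes "\<And>n. h n \<in> borel_measurable borel" "\<And>n t. 0 \<le> h n t"
    "\<And>n. (\<integral>\<^sup>+t. ennreal (h n t) \<partial>circ) \<le> ennreal C" "C > 0" and s: "strict_mono s"
  obtains r \<nu> where "strict_mono (r :: nat \<Rightarrow> nat)" "finite_measure \<nu>" "sets \<nu> = sets circle_borel"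
    "\<And>(f :: complex \<Rightarrow> complex) (q :: nat \<Rightarrow> nat). continuous_on (sphere 0 1) f \<Longrightarrow> strict_mono q \<Longrightarrow>
      (\<lambda>n. LINT t|circ. of_real (h (s (r (q n))) t) * f (cis t)) \<longlonglongrightarrow> (LINT \<xi>|\<nu>. f \<xi>)"
proof -
  obtain r \<nu> where r: "strict_mono (r :: nat \<Rightarrow> nat)" "finite_measure \<nu>" "sets \<nu> = sets circle_borel"
    "\<And>f :: complex \<Rightarrow> complex. continuous_on (sphere 0 1) f \<Longrightarrow>
      (\<lambda>n. LINT t|circ. of_real (h (s (r n)) t) * f (cis t)) \<longlonglongrightarrow> (LINT \<xi>|\<nu>. f \<xi>)"
    by (rule circle_weak_compactness[of "\<lambda>n. h (s n)" C]) (use assms in auto)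
  show ?thesis
    by (rule that[OF r(1-3)]) (use LIMSEQ_subseq_LIMSEQ[OF r(4)] in \<open>auto simp: o_def\<close>)
qed

lemma complex_circle_weak_compactness:
  fixes \<phi> :: "nat \<Rightarrow> real \<Rightarrow> complex"
  assumes \<phi>: "\<And>n. \<phi> n \<in> borel_measurable borel" "\<And>n. \<exists>B. \<forall>t. cmod (\<phi> n t) \<le> B"
    and C: "\<And>n. (\<integral>\<^sup>+t. ennreal (cmod (\<phi> n t)) \<partial>circ) \<le> ennreal C" "C > 0"
  obtains s \<mu> where "strict_mono (s :: nat \<Rightarrow> nat)" "complex_measure circle_borel \<mu>"
    "\<And>f. continuous_on (sphere 0 1) f \<Longrightarrow>
      (\<lambda>n. LINT t|circ. \<phi> (s n) t * f (cis t)) \<longlonglongrightarrow> complex_measure_integral circle_borel \<mu> f"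
proof -
  have bound: "(\<integral>\<^sup>+t. ennreal (max 0 (g t)) \<partial>circ) \<le> ennreal C" if "\<And>t. g t \<le> cmod (\<phi> n t)" for g n
    by (rule order_trans[OF nn_integral_mono C(1)[of n]]) (use that in \<open>auto intro!: ennreal_leI\<close>)
  define h1 h2 h3 h4 where "h1 n t = max 0 (Re (\<phi> n t))" and "h2 n t = max 0 (- Re (\<phi> n t))"
    and "h3 n t = max 0 (Im (\<phi> n t))" and "h4 n t = max 0 (- Im (\<phi> n t))" for n t
  note hd = h1_def[abs_def] h2_def[abs_def] h3_def[abs_def] h4_def[abs_def]
  have hm [measurable]: "h1 n \<in> borel_measurable borel" "h2 n \<in> borel_measurable borel" "h3 n \<in> borel_measurable borel" "h4 n \<in> borel_measurable borel" for n
    unfolding hd using \<phi>(1) by auto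
  have h0: "0 \<le> h1 n t" "0 \<le> h2 n t" "0 \<le> h3 n t" "0 \<le> h4 n t" for n t by (auto simp: hd)
  have Re_le: "Re w \<le> cmod w" "- Re w \<le> cmod w" "Im w \<le> cmod w" "- Im w \<le> cmod w" for w
    using abs_Re_le_cmod[of w] abs_Im_le_cmod[of w] by auto
  have hC: "(\<integral>\<^sup>+t. ennreal (h1 n t) \<partial>circ) \<le> ennreal C" "(\<integral>\<^sup>+t. ennreal (h2 n t) \<partial>circ) \<le> ennreal C"
    "(\<integral>\<^sup>+t. ennreal (h3 n t) \<partial>circ) \<le> ennreal C" "(\<integral>\<^sup>+t. ennreal (h4 n t) \<partial>circ) \<le> ennreal C" for n
    unfolding hd by (rule bound, rule Re_le)+
  have id: "strict_mono (\<lambda>n. n :: nat)" by (simp add: strict_mono_def)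
  obtain r1 \<nu>1 where 1: "strict_mono r1" "finite_measure \<nu>1" "sets \<nu>1 = sets circle_borel"
    and L1: "\<And>(f :: complex \<Rightarrow> complex) (q :: nat \<Rightarrow> nat). continuous_on (sphere 0 1) f \<Longrightarrow> strict_mono q \<Longrightarrow>
      (\<lambda>n. LINT t|circ. of_real (h1 (r1 (q n)) t) * f (cis t)) \<longlonglongrightarrow> (LINT \<xi>|\<nu>1. f \<xi>)"
    by (rule circle_weak_compactness_subseq[where h = h1 and s = "\<lambda>n. n", OF hm(1) h0(1) hC(1) C(2) id], rule that)
  define s1 where "s1 n = r1 n" for n
  have s1: "strict_mono s1" using 1(1) by (simp add: s1_def[abs_def])
  obtain r2 \<nu>2 where 2: "strict_mono r2" "finite_measure \<nu>2" "sets \<nu>2 = sets circle_borel"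
    and L2: "\<And>(f :: complex \<Rightarrow> complex) (q :: nat \<Rightarrow> nat). continuous_on (sphere 0 1) f \<Longrightarrow> strict_mono q \<Longrightarrow>
      (\<lambda>n. LINT t|circ. of_real (h2 (s1 (r2 (q n))) t) * f (cis t)) \<longlonglongrightarrow> (LINT \<xi>|\<nu>2. f \<xi>)"
    by (rule circle_weak_compactness_subseq[where h = h2 and s = "s1", OF hm(2) h0(2) hC(2) C(2) s1], rule that)
  define s2 where "s2 n = s1 (r2 n)" for n
  have s2: "strict_mono s2" using s1 2(1) by (simp add: s2_def[abs_def] strict_mono_def)
  obtain r3 \<nu>3 where 3: "strict_mono r3" "finite_measure \<nu>3" "sets \<nu>3 = sets circle_borel"
    and L3: "\<And>(f :: complex \<Rightarrow> complex) (q :: nat \<Rightarrow> nat). continuous_on (sphere 0 1) f \<Longrightarrow> strict_mono q \<Longrightarrow>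
      (\<lambda>n. LINT t|circ. of_real (h3 (s2 (r3 (q n))) t) * f (cis t)) \<longlonglongrightarrow> (LINT \<xi>|\<nu>3. f \<xi>)"
    by (rule circle_weak_compactness_subseq[where h = h3 and s = "s2", OF hm(3) h0(3) hC(3) C(2) s2], rule that)
  define s3 where "s3 n = s2 (r3 n)" for n
  have s3: "strict_mono s3" using s2 3(1) by (simp add: s3_def[abs_def] strict_mono_def)
  obtain r4 \<nu>4 where 4: "strict_mono r4" "finite_measure \<nu>4" "sets \<nu>4 = sets circle_borel"
    and L4: "\<And>(f :: complex \<Rightarrow> complex) (q :: nat \<Rightarrow> nat). continuous_on (sphere 0 1) f \<Longrightarrow> strict_mono q \<Longrightarrow>
      (\<lambda>n. LINT t|circ. of_real (h4 (s3 (r4 (q n))) t) * f (cis t)) \<longlonglongrightarrow> (LINT \<xi>|\<nu>4. f \<xi>)"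
    by (rule circle_weak_compactness_subseq[where h = h4 and s = "s3", OF hm(4) h0(4) hC(4) C(2) s3], rule that)
  define s where "s n = s3 (r4 n)" for n
  have s: "strict_mono s" using s3 4(1) by (simp add: s_def[abs_def] strict_mono_def)
  \<comment> \<open>The extractions still to come after the second and the first one; along them all
    four limits are taken over the common sequence \<open>s\<close>.\<close>
  have r34: "strict_mono (\<lambda>n. r3 (r4 n))" and r234: "strict_mono (\<lambda>n. r2 (r3 (r4 n)))"
    using 2(1) 3(1) 4(1) by (auto simp: strict_mono_def)
  \<comment> \<open>The limit measures need not be mutually singular, so this is in general not a
    Jordan decomposition; \<open>integral_jordan_diff\<close> bridges the gap.\<close>
  define \<mu> where "\<mu> A = Complex (measure \<nu>1 A - measure \<nu>2 A) (measure \<nu>3 A - measure \<nu>4 A)" for A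
  show ?thesis
  proof (rule that[OF s])
    show "complex_measure circle_borel \<mu>"
      unfolding complex_measure_def
    proof (intro conjI allI impI)
      show "\<mu> {} = 0" by (simp add: \<mu>_def complex_eq_iff)
      fix A :: "nat \<Rightarrow> complex set" assume A: "range A \<subseteq> sets circle_borel" "disjoint_family A"
      have "(\<lambda>n. measure \<nu> (A n)) sums measure \<nu> (\<Union>n. A n)" if "finite_measure \<nu>" "sets \<nu> = sets circle_borel" for \<nu>
        using that A by (intro finite_measure.finite_measure_UNION) auto
      then show "(\<lambda>n. \<mu> (A n)) sums \<mu> (\<Union>n. A n)"
        unfolding \<mu>_def sums_complex_iff using 1 2 3 4 by (auto intro!: sums_diff)
    qed
    fix f :: "complex \<Rightarrow> complex" assume f: "continuous_on (sphere 0 1) f"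
    have fm: "f \<in> borel_measurable circle_borel" by (rule borel_measurable_continuous_on_restrict[OF f])
    have "bounded (f ` sphere 0 1)" by (intro compact_imp_bounded compact_continuous_image f) auto
    then obtain B where B: "\<And>\<xi>. \<xi> \<in> sphere 0 1 \<Longrightarrow> cmod (f \<xi>) \<le> B" unfolding bounded_iff by blast
    then have B': "\<And>\<xi>. \<xi> \<in> space circle_borel \<Longrightarrow> cmod (f \<xi>) \<le> B" by simp
    have "complex_measure_integral circle_borel \<mu> f
      = ((LINT \<xi>|\<nu>1. f \<xi>) - (LINT \<xi>|\<nu>2. f \<xi>)) + \<i> * ((LINT \<xi>|\<nu>3. f \<xi>) - (LINT \<xi>|\<nu>4. f \<xi>))"
      unfolding complex_measure_integral_def \<mu>_def complex.sel minus_diff_eq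
      by (simp only: integral_jordan_diff[OF 1(2,3) 2(2,3) fm B'] integral_jordan_diff[OF 3(2,3) 4(2,3) fm B'])
    moreover have "(\<lambda>n. ((LINT t|circ. of_real (h1 (s n) t) * f (cis t)) - (LINT t|circ. of_real (h2 (s n) t) * f (cis t)))
        + \<i> * ((LINT t|circ. of_real (h3 (s n) t) * f (cis t)) - (LINT t|circ. of_real (h4 (s n) t) * f (cis t))))
      \<longlonglongrightarrow> ((LINT \<xi>|\<nu>1. f \<xi>) - (LINT \<xi>|\<nu>2. f \<xi>)) + \<i> * ((LINT \<xi>|\<nu>3. f \<xi>) - (LINT \<xi>|\<nu>4. f \<xi>))"
      using L1[OF f r234] L2[OF f r34] L3[OF f 4(1)] L4[OF f id]
      unfolding s_def s3_def s2_def s1_def by (intro tendsto_intros)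
    moreover have "((LINT t|circ. of_real (h1 n t) * f (cis t)) - (LINT t|circ. of_real (h2 n t) * f (cis t)))
        + \<i> * ((LINT t|circ. of_real (h3 n t) * f (cis t)) - (LINT t|circ. of_real (h4 n t) * f (cis t)))
        = (LINT t|circ. \<phi> n t * f (cis t))" for n
    proof -
      obtain b where b: "\<And>t. cmod (\<phi> n t) \<le> b" using \<phi>(2) by blast
      have fcm [measurable]: "(\<lambda>t. f (cis t)) \<in> borel_measurable borel"
        using measurable_compose[OF cis_measurable_circle fm] .
      have int: "integrable circ (\<lambda>t. of_real (g t) * f (cis t))"
        if [measurable]: "g \<in> borel_measurable borel" and g: "\<And>t. \<bar>g t\<bar> \<le> cmod (\<phi> n t)" for g :: "real \<Rightarrow> real"
      proof (rule circ_integrable_bounded)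
        show "cmod (of_real (g t) * f (cis t)) \<le> b * B" for t
          unfolding norm_mult norm_of_real
          using order_trans[OF g b, of t] B[of "cis t"] by (intro mult_mono) auto
      qed measurable
      have abs: "\<bar>h1 n t\<bar> \<le> cmod (\<phi> n t)" "\<bar>h2 n t\<bar> \<le> cmod (\<phi> n t)" "\<bar>h3 n t\<bar> \<le> cmod (\<phi> n t)" "\<bar>h4 n t\<bar> \<le> cmod (\<phi> n t)" for t
        using Re_le[of "\<phi> n t"] by (auto simp: hd)
      note i = int[OF hm(1) abs(1)] int[OF hm(2) abs(2)] int[OF hm(3) abs(3)] int[OF hm(4) abs(4)]
      have "\<phi> n t * f (cis t) = (of_real (h1 n t) * f (cis t) - of_real (h2 n t) * f (cis t))
         + \<i> * (of_real (h3 n t) * f (cis t) - of_real (h4 n t) * f (cis t))" for t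
      proof -
        have "\<phi> n t = of_real (h1 n t - h2 n t) + \<i> * of_real (h3 n t - h4 n t)"
          by (auto simp: hd complex_eq_iff max_def)
        then show ?thesis by (simp only: of_real_diff left_diff_distrib right_diff_distrib distrib_right mult.assoc)
      qed
      then show ?thesis using i by simp
    qed
    ultimately show "(\<lambda>n. LINT t|circ. \<phi> (s n) t * f (cis t)) \<longlonglongrightarrow> complex_measure_integral circle_borel \<mu> f"
      by simp
  qed
qed

section \<open>Finite bounds from \<delta> and \<sigma>, and part (b)\<close>

lemma separation_const_le:
  assumes a: "\<And>k. cmod (a k) < 1"
  shows "separation_const a \<le> (\<Prod>k\<in>{..<N} - {n}. cmod ((a k - a n) / (1 - cnj (a k) * a n)))"
proof -
  define p where "p n N = (\<Prod>k\<in>{..<N} - {n}. cmod ((a k - a n) / (1 - cnj (a k) * a n)))" for n N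
  have f1: "cmod ((a k - a n) / (1 - cnj (a k) * a n)) \<le> 1" for k n
    using norm_blaschke_factor_le_1[OF a[of k], of "a n"] a[of n] by (simp add: blaschke_factor_def)
  have p0: "p n N \<ge> 0" for n N unfolding p_def by (intro prod_nonneg) auto
  \<comment> \<open>Every factor is at most 1, so the partial products decrease; this makes
    \<open>lim\<close> a genuine limit and a lower bound for each of them.\<close>
  have dec: "decseq (p n)" for n
  proof (rule decseq_SucI)
    fix N
    show "p n (Suc N) \<le> p n N"
    proof (cases "N = n")
      case True
      then have "{..<Suc N} - {n} = {..<N} - {n}" by auto
      then show ?thesis by (simp add: p_def)
    next
      case False
      then have "{..<Suc N} - {n} = insert N ({..<N} - {n})" by auto
      then have "p n (Suc N) = cmod ((a N - a n) / (1 - cnj (a N) * a n)) * p n N"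
        unfolding p_def by (subst prod.insert[symmetric]) auto
      then show ?thesis using mult_left_le_one_le[OF p0[of n N] _ f1[of N n]] by simp
    qed
  qed
  have lim: "p n \<longlonglongrightarrow> lim (p n)" for n
  proof -
    obtain L where "p n \<longlonglongrightarrow> L"
      by (rule decseq_convergent[OF dec[of n], of 0], simp add: p0, rule that)
    then show ?thesis by (simp add: limI)
  qed
  have "separation_const a \<le> lim (p n)"
    unfolding separation_const_def p_def[symmetric]
  proof (rule cINF_lower)
    show "bdd_below (range (\<lambda>n. lim (p n)))"
      by (rule bdd_belowI[of _ 0]) (auto intro!: LIMSEQ_le_const[OF lim] p0)
  qed simp
  also have "\<dots> \<le> p n N" by (rule decseq_ge[OF dec lim])
  finally show ?thesis by (simp add: p_def)
qed

lemma sigma_const_ge: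
  assumes \<sigma>: "sigma_const \<alpha> a < \<infinity>" and "cmod \<xi> = 1" "finite J"
  shows "(\<Sum>k\<in>J. ((1 - (cmod (a k))\<^sup>2) / cmod (1 - cnj \<xi> * a k)) powr \<alpha>) \<le> enn2real (sigma_const \<alpha> a)"
proof -
  let ?t = "\<lambda>k. ((1 - (cmod (a k))\<^sup>2) / cmod (1 - cnj \<xi> * a k)) powr \<alpha>"
  have "ennreal (\<Sum>k\<in>J. ?t k) = (\<Sum>k\<in>J. ennreal (?t k))" by simp
  also have "\<dots> \<le> (\<Sum>k. ennreal (?t k))" by (rule sum_le_suminf) (use assms in auto)
  also have "\<dots> \<le> sigma_const \<alpha> a"
    unfolding sigma_const_def by (rule SUP_upper) (use assms in simp)
  finally have "ennreal (\<Sum>k\<in>J. ?t k) \<le> ennreal (enn2real (sigma_const \<alpha> a))" using \<sigma> by simp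
  then show ?thesis by (subst (asm) ennreal_le_iff) auto
qed

lemma frac_cauchy_interpolation:
  fixes a :: "nat \<Rightarrow> complex"
  assumes \<alpha>: "0 < \<alpha>" "\<alpha> \<le> 1" and a: "\<And>k. cmod (a k) < 1"
    and \<delta>: "separation_const a > 0" and \<sigma>: "sigma_const \<alpha> a < \<infinity>" and x: "x \<in> ell1"
  obtains g where "g \<in> frac_cauchy_transforms \<alpha>"
    "\<And>k. g (a k) * of_real ((1 - (cmod (a k))\<^sup>2) powr \<alpha>) = x k"
proof -
  define K where "K k \<xi> = 1 / (1 - cnj \<xi> * a k) powr of_real \<alpha>" for k \<xi>
  define w where "w k = complex_of_real ((1 - (cmod (a k))\<^sup>2) powr \<alpha>)" for k
  define C where "C = (16 / \<alpha> + 256 * \<bar>rad_const \<alpha> * enn2real (sigma_const \<alpha> a)\<bar>) / separation_const a"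
  have C: "C > 0" unfolding C_def using \<alpha> \<delta> by (intro divide_pos_pos add_pos_nonneg) auto
  \<comment> \<open>The pointwise bound B is stored with the density so that one choice supplies
    both for all n and N.\<close>
  define G where "G n N = (\<lambda>(\<psi>, B). \<psi> \<in> borel_measurable borel \<and> (\<forall>t. cmod (\<psi> t) \<le> B)
     \<and> (\<integral>\<^sup>+t. ennreal (cmod (\<psi> t)) \<partial>circ) \<le> ennreal C
     \<and> (\<forall>k<N. (LINT t|circ. \<psi> t * K k (cis t)) * w k = of_bool (k = n)))" for n N :: nat
  have ex: "\<exists>p. G n N p" if n: "n < N" for n N
  proof -
    obtain \<psi> B where "\<psi> \<in> borel_measurable borel" "\<And>t. cmod (\<psi> t) \<le> B"
      "(\<integral>\<^sup>+t. ennreal (cmod (\<psi> t)) \<partial>circ) \<le> ennreal C"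
      "\<And>k. k < N \<Longrightarrow> (LINT t|circ. \<psi> t * K k (cis t)) * w k = of_bool (k = n)"
      by (rule interpolation_density[OF \<alpha> a \<delta> separation_const_le[OF a] sigma_const_ge[OF \<sigma>] n, folded C_def K_def w_def],
          assumption, assumption, rule that)
    then show ?thesis unfolding G_def by (intro exI[of _ "(\<psi>, B)"]) simp
  qed
  define \<psi> where "\<psi> n N = fst (SOME p. G n N p)" for n N
  define B where "B n N = snd (SOME p. G n N p)" for n N
  have "G n N (\<psi> n N, B n N)" if "n < N" for n N
    unfolding \<psi>_def B_def prod.collapse by (rule someI_ex[OF ex[OF that]])
  then have \<psi>: "\<And>n N. n < N \<Longrightarrow> \<psi> n N \<in> borel_measurable borel"
    "\<And>n N t. n < N \<Longrightarrow> cmod (\<psi> n N t) \<le> B n N"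
    "\<And>n N. n < N \<Longrightarrow> (\<integral>\<^sup>+t. ennreal (cmod (\<psi> n N t)) \<partial>circ) \<le> ennreal C"
    "\<And>n N k. n < N \<Longrightarrow> k < N \<Longrightarrow> (LINT t|circ. \<psi> n N t * K k (cis t)) * w k = of_bool (k = n)"
    unfolding G_def by blast+
  \<comment> \<open>Solves the equations with index below N, with an L1 norm controlled by the l1
    norm of x.\<close>
  define \<phi> where "\<phi> N t = (\<Sum>n<N. x n * \<psi> n N t)" for N t
  define X where "X = (\<Sum>n. cmod (x n))"
  have sx: "summable (\<lambda>n. cmod (x n))" using x by (simp add: ell1_def)
  have \<phi>m: "\<phi> N \<in> borel_measurable borel" for N
    unfolding \<phi>_def[abs_def] by (intro borel_measurable_sum borel_measurable_times borel_measurable_const \<psi>) auto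
  have \<phi>B: "\<exists>B. \<forall>t. cmod (\<phi> N t) \<le> B" for N
  proof (intro exI allI)
    show "cmod (\<phi> N t) \<le> (\<Sum>n<N. cmod (x n) * B n N)" for t
      unfolding \<phi>_def by (intro sum_norm_le) (auto simp: norm_mult intro!: mult_left_mono \<psi>)
  qed
  \<comment> \<open>X + 1 instead of X: the compactness lemma wants a strictly positive bound, also
    when x = 0.\<close>
  have \<phi>C: "(\<integral>\<^sup>+t. ennreal (cmod (\<phi> N t)) \<partial>circ) \<le> ennreal (C * (X + 1))" for N
  proof -
    have "(\<integral>\<^sup>+t. ennreal (cmod (\<phi> N t)) \<partial>circ) \<le> (\<integral>\<^sup>+t. (\<Sum>n<N. ennreal (cmod (x n)) * ennreal (cmod (\<psi> n N t))) \<partial>circ)"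
    proof (rule nn_integral_mono)
      fix t
      have "cmod (\<phi> N t) \<le> (\<Sum>n<N. cmod (x n) * cmod (\<psi> n N t))"
        unfolding \<phi>_def by (intro sum_norm_le) (auto simp: norm_mult)
      then have "ennreal (cmod (\<phi> N t)) \<le> ennreal (\<Sum>n<N. cmod (x n) * cmod (\<psi> n N t))" by (rule ennreal_leI)
      also have "\<dots> = (\<Sum>n<N. ennreal (cmod (x n)) * ennreal (cmod (\<psi> n N t)))"
        by (subst sum_ennreal[symmetric]) (auto simp: ennreal_mult)
      finally show "ennreal (cmod (\<phi> N t)) \<le> (\<Sum>n<N. ennreal (cmod (x n)) * ennreal (cmod (\<psi> n N t)))" .
    qed
    also have "\<dots> = (\<Sum>n<N. ennreal (cmod (x n)) * (\<integral>\<^sup>+t. ennreal (cmod (\<psi> n N t)) \<partial>circ))"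
    proof -
      have m: "(\<lambda>t. ennreal (cmod (\<psi> n N t))) \<in> borel_measurable circ" if "n < N" for n
        using \<psi>(1)[OF that] by measurable
      show ?thesis
        by (subst nn_integral_sum) (auto intro!: sum.cong nn_integral_cmult borel_measurable_times_ennreal m)
    qed
    also have "\<dots> \<le> (\<Sum>n<N. ennreal (cmod (x n)) * ennreal C)"
      by (intro sum_mono mult_left_mono \<psi>) auto
    also have "\<dots> = ennreal ((\<Sum>n<N. cmod (x n)) * C)"
      using C by (simp add: sum_distrib_right sum_nonneg flip: ennreal_mult sum_ennreal)
    also have "\<dots> \<le> ennreal (C * (X + 1))"
    proof (rule ennreal_leI)
      have "(\<Sum>n<N. cmod (x n)) \<le> X + 1" unfolding X_def using sum_le_suminf[OF sx, of "{..<N}"] by simp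
      then show "(\<Sum>n<N. cmod (x n)) * C \<le> C * (X + 1)" using C by (simp add: mult.commute)
    qed
    finally show ?thesis .
  qed
  have "X \<ge> 0" unfolding X_def by (intro suminf_nonneg sx) auto
  then have C': "C * (X + 1) > 0" using C by simp
  obtain s \<mu> where s: "strict_mono (s :: nat \<Rightarrow> nat)" and \<mu>: "complex_measure circle_borel \<mu>"
    and L: "\<And>f. continuous_on (sphere 0 1) f \<Longrightarrow>
      (\<lambda>n. LINT t|circ. \<phi> (s n) t * f (cis t)) \<longlonglongrightarrow> complex_measure_integral circle_borel \<mu> f"
    by (rule complex_circle_weak_compactness[OF \<phi>m \<phi>B \<phi>C C'], rule that)
  have val: "(LINT t|circ. \<phi> N t * K k (cis t)) * w k = x k" if k: "k < N" for k N
  proof -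
    have Kc: "continuous_on (sphere 0 1) (K k)" unfolding K_def by (rule continuous_on_kernel[OF a])
    then have Km: "(\<lambda>t. K k (cis t)) \<in> borel_measurable borel"
      by (intro measurable_compose[OF cis_measurable_circle] borel_measurable_continuous_on_restrict)
    obtain b where b: "\<And>\<xi>. \<xi> \<in> sphere 0 1 \<Longrightarrow> cmod (K k \<xi>) \<le> b"
      by (rule kernel_bounded[OF a[of k], of \<alpha>, folded K_def], rule that)
    have int: "integrable circ (\<lambda>t. \<psi> n N t * K k (cis t))" if n: "n < N" for n
    proof (rule circ_integrable_bounded)
      show "(\<lambda>t. \<psi> n N t * K k (cis t)) \<in> borel_measurable borel"
        by (intro borel_measurable_times \<psi> n Km)
      show "cmod (\<psi> n N t * K k (cis t)) \<le> B n N * b" for t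
        unfolding norm_mult using \<psi>(2)[OF n, of t] b[of "cis t"] order_trans[OF norm_ge_zero \<psi>(2)[OF n]]
        by (intro mult_mono) auto
    qed
    have "(LINT t|circ. \<phi> N t * K k (cis t)) = (LINT t|circ. (\<Sum>n<N. x n * (\<psi> n N t * K k (cis t))))"
      by (simp add: \<phi>_def sum_distrib_right mult.assoc)
    also have "\<dots> = (\<Sum>n<N. x n * (LINT t|circ. \<psi> n N t * K k (cis t)))"
      by (subst Bochner_Integration.integral_sum) (auto intro!: integrable_mult_right int)
    finally have "(LINT t|circ. \<phi> N t * K k (cis t)) * w k = (\<Sum>n<N. x n * ((LINT t|circ. \<psi> n N t * K k (cis t)) * w k))"
      by (simp add: sum_distrib_right mult.assoc)
    also have "\<dots> = (\<Sum>n<N. if n = k then x k else 0)"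
      using k by (intro sum.cong) (auto simp: \<psi>(4))
    also have "\<dots> = x k" using k by simp
    finally show ?thesis .
  qed
  show ?thesis
  proof (rule that)
    show "(\<lambda>z. complex_measure_integral circle_borel \<mu> (\<lambda>\<xi>. 1 / (1 - cnj \<xi> * z) powr of_real \<alpha>)) \<in> frac_cauchy_transforms \<alpha>"
      using \<mu> by (auto simp: frac_cauchy_transforms_def)
    fix k
    have "continuous_on (sphere 0 1) (K k)" unfolding K_def by (rule continuous_on_kernel[OF a])
    from tendsto_mult_right[OF L[OF this], of "w k"]
    have "(\<lambda>n. (LINT t|circ. \<phi> (s n) t * K k (cis t)) * w k) \<longlonglongrightarrow> complex_measure_integral circle_borel \<mu> (K k) * w k" .
    \<comment> \<open>For fixed k the sequence is constant once s n > k, so the k-th equation passes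
      to the limit exactly.\<close>
    moreover have "(\<lambda>n. (LINT t|circ. \<phi> (s n) t * K k (cis t)) * w k) \<longlonglongrightarrow> x k"
    proof (rule tendsto_eventually, rule eventually_sequentiallyI[of "Suc k"])
      fix n assume "Suc k \<le> n"
      then have "k < s n" using seq_suble[OF s, of n] by linarith
      then show "(LINT t|circ. \<phi> (s n) t * K k (cis t)) * w k = x k" by (rule val)
    qed
    ultimately show "complex_measure_integral circle_borel \<mu> (\<lambda>\<xi>. 1 / (1 - cnj \<xi> * a k) powr of_real \<alpha>) * of_real ((1 - (cmod (a k))\<^sup>2) powr \<alpha>) = x k"
      unfolding K_def[symmetric] w_def[symmetric] by (rule LIMSEQ_unique)
  qed
qed

theorem lemma2:
  fixes \<alpha> :: real and a :: "nat \<Rightarrow> complex"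
  assumes "0 < \<alpha>" and "\<alpha> \<le> 1"
    and "\<And>k. a k \<in> ball 0 1"
    and "separation_const a > 0"
    and "sigma_const \<alpha> a < \<infinity>"
  shows "(\<forall>g\<in>frac_cauchy_transforms \<alpha>.
            (\<lambda>k. g (a k) * of_real ((1 - (cmod (a k))\<^sup>2) powr \<alpha>)) \<in> ell1)
       \<and> (\<forall>x\<in>ell1. \<exists>g\<in>frac_cauchy_transforms \<alpha>.
            \<forall>k. g (a k) * of_real ((1 - (cmod (a k))\<^sup>2) powr \<alpha>) = x k)"
proof -
  have a: "\<And>k. cmod (a k) < 1" using assms(3) by simp
  show ?thesis
  proof (intro conjI ballI)
    show "(\<lambda>k. g (a k) * of_real ((1 - (cmod (a k))\<^sup>2) powr \<alpha>)) \<in> ell1" if "g \<in> frac_cauchy_transforms \<alpha>" for g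
      using frac_cauchy_transform_ell1[OF assms(1) a assms(5) that] .
    show "\<exists>g\<in>frac_cauchy_transforms \<alpha>. \<forall>k. g (a k) * of_real ((1 - (cmod (a k))\<^sup>2) powr \<alpha>) = x k" if "x \<in> ell1" for x
      by (rule frac_cauchy_interpolation[OF assms(1,2) a assms(4,5) that]) blast
  qed
qed

end
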